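(* Let $0<\delta\le\frac12$ and $\rho=1-(1-2\delta)^{1/2}$. Let $\Phi:\mathcal H\to\mathbb R$ be such that $\exp(-\Phi)$ is $\gamma$-integrable. Assume that there are $R>0$, $\alpha_l>-\infty$ and a function $r:\mathbb R^+\to\mathbb R^+$ with $r(s)\le\frac{\rho}{2}s$ for all $s\ge R$ such that for all $x\in\mathcal H\setminus B_R(0)$ $$\inf_{z\in B_{r(\|x\|)}((1-\rho)x)}\exp\bigl(-\Phi(z)+\Phi(x)\bigr)>\exp(\alpha_l),$$ and that one of the following holds: (a) $\Phi$ is globally Lipschitz, and either $r(s)=r s^a$ with a constant $r>0$ and some $a\in(\frac12,1)$, or $r(s)=r$ with a constant $r>0$; (b) for every $\kappa>0$ there is $M_\kappa$ such that $\sup_{x\ne y\in B_s(0)}\frac{|\Phi(x)-\Phi(y)|}{\|x-y\|}\le M_\kappa e^{\kappa s}$ for all $s>0$, and $r(s)=rs^a$ with a constant $r>0$ and some $a\in(\frac12,1)$. Let $i\in\mathbb N$, let $\eta>0$ be sufficiently small and $\epsilon>0$ sufficiently small (depending on $\eta$), and let $d'$ be the metric on $\mathcal H$ defined in the context with these parameters. Let $f:\mathcal H\to\mathbb R$ be Lipschitz with respect to $d'$ and $\tilde f:=f-\mu(f)$. Let $(X_n)$ be the pCN Markov chain with kernel $\mathcal P$ started at an arbitrary deterministic point $X_0\in\mathcal H$. Then there exists $\sigma\in[0,+\infty)$ such that $$\lim_{n\to\infty}\frac1n\,\mathbb E\Bigl(\sum_{j=1}^n\tilde f(X_j)\Bigr)^2=\sigma^2.$$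 Moreover, $$\lim_{n\to\infty}\mathbb P\Bigl(\frac1{\sqrt n}\sum_{j=1}^n\tilde f(X_j)<\xi\Bigr)=\Phi_\sigma(\xi)\qquad\text{for all }\xi\in\mathbb R,$$ where $\Phi_\sigma$ is the distribution function of the normal law $\mathcal N(0,\sigma^2)$ (if $\sigma=0$, of the Dirac mass at $0$, with the convergence understood at continuity points $\xi\ne0$).
   Context: $(\mathcal H,\langle\cdot,\cdot\rangle)$ is a separable Hilbert space with norm $\|\cdot\|$, $B_s(x)$ is the ball of radius $s$ centred at $x$, $\gamma$ is a centred Gaussian measure on $\mathcal H$, and $\mu(dx)=M\exp(-\Phi(x))\gamma(dx)$ with $M$ the normalising constant. The pCN kernel $\mathcal P$ on $\mathcal H$ is the transition kernel of the following Markov chain: from $X_n$, draw $\xi\sim\gamma$ independently, set $p=(1-2\delta)^{1/2}X_n+\sqrt{2\delta}\,\xi=(1-\rho)X_n+\sqrt{2\delta}\,\xi$, and let $X_{n+1}=p$ with probability $\alpha(X_n,p)$ and $X_{n+1}=X_n$ otherwise, where $\alpha(x,y)=1\wedge\exp(\Phi(x)-\Phi(y))$. Metric $d'$: with $\mathsf A(T,x,y)=\{\psi\in C^1([0,T],\mathcal H):\psi(0)=x,\ \psi(T)=y,\ \|\dot\psi\|=1\}$, $T\ge0$, put $$d_1(x,y)=\begin{cases}0,&x=y,\\ 1+\|x\|^i+\|y\|^i,&x\ne y,\end{cases}\qquad d_2(x,y)=\inf_{T,\psi\in\mathsf A(T,x,y)}\frac1\epsilon\int_0^T\exp(\eta\|\psi(t)\|)(1+\|\psi(t)\|^i)\,dt,$$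 $d_0(x,y)=d_1(x,y)\wedge d_2(x,y)$ and $$d'(x,y)=\sqrt{\inf_{n\ge2,\ x=z_1,\dots,z_n=y}\ \sum_{j=1}^{n-1}d_0(z_j,z_{j+1})}.$$ *)

theory Defs
  imports "HOL-Probability.Probability"
begin

text \<open>The degenerate case \<open>s = 0\<close> is the Dirac mass at \<open>0\<close>.\<close>

definition centred_normal :: "real \<Rightarrow> real measure" where
  "centred_normal s = (if s = 0 then return borel 0 else density lborel (normal_density 0 s))"

definition centred_gaussian :: "'a::real_inner measure \<Rightarrow> bool" where
  "centred_gaussian \<gamma> \<longleftrightarrow> prob_space \<gamma> \<and> sets \<gamma> = sets borel \<and>
     (\<forall>h. \<exists>s\<ge>0. distr \<gamma> borel (\<lambda>x. x \<bullet> h) = centred_normal s)"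

definition target_measure :: "'a measure \<Rightarrow> ('a \<Rightarrow> real) \<Rightarrow> 'a measure" where
  "target_measure \<gamma> \<Phi> = density \<gamma> (\<lambda>x. ennreal (exp (- \<Phi> x) / (\<integral>y. exp (- \<Phi> y) \<partial>\<gamma>)))"

definition acceptance :: "('a \<Rightarrow> real) \<Rightarrow> 'a \<Rightarrow> 'a \<Rightarrow> real" where
  "acceptance \<Phi> x y = min 1 (exp (\<Phi> x - \<Phi> y))"

definition pcn_proposal :: "real \<Rightarrow> 'a::real_vector \<Rightarrow> 'a \<Rightarrow> 'a" where
  "pcn_proposal \<delta> x \<xi> = sqrt (1 - 2 * \<delta>) *\<^sub>R x + sqrt (2 * \<delta>) *\<^sub>R \<xi>"

text \<open>Acceptance with probability \<open>\<alpha>\<close> is realised by comparing \<open>\<alpha>\<close> with a variable \<open>u\<close> that is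
  uniform on \<open>[0, 1]\<close> and independent of the noise \<open>\<xi>\<close>.\<close>

definition pcn_kernel ::
  "'a::real_inner measure \<Rightarrow> ('a \<Rightarrow> real) \<Rightarrow> real \<Rightarrow> 'a \<Rightarrow> 'a measure" where
  "pcn_kernel \<gamma> \<Phi> \<delta> x =
     distr (\<gamma> \<Otimes>\<^sub>M uniform_measure lborel {0..1}) borel
       (\<lambda>(\<xi>, u). if u \<le> acceptance \<Phi> x (pcn_proposal \<delta> x \<xi>) then pcn_proposal \<delta> x \<xi> else x)"

definition history_algebra ::
  "'w measure \<Rightarrow> (nat \<Rightarrow> 'w \<Rightarrow> 'a::topological_space) \<Rightarrow> nat \<Rightarrow> 'w measure" where
  "history_algebra \<Omega> X n =
     vimage_algebra (space \<Omega>) (\<lambda>\<omega>. \<lambda>j\<in>{..n}. X j \<omega>) (\<Pi>\<^sub>M j\<in>{..n}. borel)"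

definition markov_chain ::
  "'w measure \<Rightarrow> ('a::topological_space \<Rightarrow> 'a measure) \<Rightarrow> 'a \<Rightarrow> (nat \<Rightarrow> 'w \<Rightarrow> 'a) \<Rightarrow> bool" where
  "markov_chain \<Omega> K x0 X \<longleftrightarrow>
     prob_space \<Omega> \<and> (\<forall>n. X n \<in> borel_measurable \<Omega>) \<and> (AE \<omega> in \<Omega>. X 0 \<omega> = x0) \<and>
     (\<forall>n. \<forall>A\<in>sets borel. AE \<omega> in \<Omega>.
        real_cond_exp \<Omega> (history_algebra \<Omega> X n) (indicator (X (Suc n) -` A \<inter> space \<Omega>)) \<omega>
          = measure (K (X n \<omega>)) A)"

definition unit_speed_paths :: "real \<Rightarrow> 'a::real_normed_vector \<Rightarrow> 'a \<Rightarrow> (real \<Rightarrow> 'a) set" where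
  "unit_speed_paths T x y =
     {\<psi>. \<psi> 0 = x \<and> \<psi> T = y \<and>
        (\<exists>\<psi>'. continuous_on {0..T} \<psi>' \<and>
           (\<forall>t\<in>{0..T}. (\<psi> has_vector_derivative \<psi>' t) (at t within {0..T}) \<and> norm (\<psi>' t) = 1))}"

definition dist1 :: "nat \<Rightarrow> 'a::real_normed_vector \<Rightarrow> 'a \<Rightarrow> real" where
  "dist1 i x y = (if x = y then 0 else 1 + norm x ^ i + norm y ^ i)"

text \<open>The infimum is taken in \<open>[0, \<infinity>]\<close>, so that it is \<open>\<infinity>\<close> when there is no admissible path
  (this happens only in the zero space).\<close>

definition dist2 :: "nat \<Rightarrow> real \<Rightarrow> real \<Rightarrow> 'a::real_normed_vector \<Rightarrow> 'a \<Rightarrow> ennreal" where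
  "dist2 i \<eta> \<epsilon> x y =
     (INF (T, \<psi>) \<in> {(T, \<psi>). 0 \<le> T \<and> \<psi> \<in> unit_speed_paths T x y}.
        ennreal (1 / \<epsilon> * integral {0..T} (\<lambda>t. exp (\<eta> * norm (\<psi> t)) * (1 + norm (\<psi> t) ^ i))))"

definition dist0 :: "nat \<Rightarrow> real \<Rightarrow> real \<Rightarrow> 'a::real_normed_vector \<Rightarrow> 'a \<Rightarrow> real" where
  "dist0 i \<eta> \<epsilon> x y = enn2real (min (ennreal (dist1 i x y)) (dist2 i \<eta> \<epsilon> x y))"

definition dist' :: "nat \<Rightarrow> real \<Rightarrow> real \<Rightarrow> 'a::real_normed_vector \<Rightarrow> 'a \<Rightarrow> real" where
  "dist' i \<eta> \<epsilon> x y =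
     sqrt (Inf {\<Sum>j=1..n-1. dist0 i \<eta> \<epsilon> (z j) (z (j + 1)) | (n::nat) (z::nat \<Rightarrow> 'a).
                  2 \<le> n \<and> z 1 = x \<and> z n = y})"

definition lipschitz_wrt :: "('a \<Rightarrow> 'a \<Rightarrow> real) \<Rightarrow> ('a \<Rightarrow> real) \<Rightarrow> bool" where
  "lipschitz_wrt d f \<longleftrightarrow> (\<exists>L. \<forall>x y. \<bar>f x - f y\<bar> \<le> L * d x y)"

end

theory Submission
  imports Defs
begin

text \<open>The coupling that drives two copies of the chain by the same noise and the same uniform variable contracts
  in expectation the semimetric \<open>sqrt (\<phi> x y * (1 + \<beta> * (norm x ^ m + norm y ^ m)))\<close>, where \<open>\<phi>\<close> is a bounded
  concave function of \<open>exp (\<eta> * max (norm x) (norm y)) * norm (x - y)\<close>. This needs only that proposals with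
  noise in a fixed ball are accepted with probability bounded below, that \<open>\<Phi>\<close> is locally Lipschitz with
  subexponential constants, and that the noise has an exponential moment (Fernique). Since the metric of
  the theorem is dominated by such a semimetric, no optimal transport is involved: the iterates of a
  centred Lipschitz function decay geometrically, which solves the Poisson equation \<open>g - P g = f\<close>.

  The sum then equals the martingale with increments \<open>g X\<^sub>k\<^sub>+\<^sub>1 - P g X\<^sub>k\<close> up to a bounded error in \<open>L\<^sup>2\<close>. The conditional
  variance of an increment is again a Lipschitz function of \<open>X\<^sub>k\<close> for a larger \<open>m\<close>. Its own Poisson solution
  \<open>G\<close> corrects the characteristic functions: those of the martingale, weighted by \<open>1 - s\<^sup>2 / 2 * G X\<^sub>k\<close>,
  satisfy a one-step linear recursion up to \<open>O(s\<^sup>3)\<close>, and Levy continuity gives the limit law.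
  Invariance of the target measure follows from exchangeability of state and proposal under the
  Gaussian measure, a consequence of its rotation invariance.\<close>

section \<open>Uniqueness of measures on inner product spaces\<close>

text \<open>The obstacle is disagreement: one copy may accept its proposal while the other rejects,
  and their new distance then bears no relation to the old one. Its probability is at most the
  difference of two acceptance probabilities, hence governed by increments of \<open>\<Phi>\<close>,
  whose local Lipschitz constants may grow; this dictates the exponential weight in the distance.
  Boundedness of \<open>\<phi>\<close> limits the cost of a disagreement to 1, while the slope of
  \<open>\<phi>\<close> at 0 can be raised until that cost is small against the gain from joint
  acceptance. The weight itself may grow in one transition, and this loss is made small by the
  choice of \<open>\<eta>\<close>.

  The square root lets two mechanisms work side by side: \<open>\<phi>\<close> contracts on bounded
  sets, the Lyapunov weight contracts far out, and the expectation of the root of their product is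
  controlled by the two separate expectations. The exponent \<open>m\<close> stays free because
  squares and conditional variances lead from \<open>m\<close> to \<open>2 * m\<close>; since all
  power moments are finite, this costs nothing.\<close>

lemma integrable_le:
  fixes f :: "'b \<Rightarrow> 'c::{banach, second_countable_topology}" and g :: "'b \<Rightarrow> real"
  assumes "integrable M g" "f \<in> borel_measurable M" "\<And>x. norm (f x) \<le> g x"
  shows "integrable M f"
  by (rule Bochner_Integration.integrable_bound[OF assms(1,2)])
    (use assms(3) order_trans[OF assms(3) abs_ge_self] in auto)

lemma (in prob_space) integrable_iexp':
  assumes [measurable]: "\<theta> \<in> borel_measurable M" "w \<in> borel_measurable M" and "\<And>x. norm (w x) \<le> C"
  shows "integrable M (\<lambda>x. w x * iexp (\<theta> x))"
  by (rule integrable_const_bound[where B=C]) (use assms(3) in \<open>auto simp: norm_mult\<close>)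

text \<open>Divided by its common total mass \<open>c\<close> (the case \<open>t = 0\<close> of the
  hypothesis), the weight turns the law of \<open>x \<bullet> h\<close> into a probability measure
  on the line under both \<open>M\<close> and \<open>N\<close>, and these have the same
  characteristic function. If \<open>c = 0\<close>, the weight vanishes almost everywhere and both
  sides are 0.\<close>

lemma weighted_marginal_eq:
  fixes M N :: "'b::{real_inner, second_countable_topology} measure" and w :: "'b \<Rightarrow> real"
  assumes M: "prob_space M" "sets M = sets borel" and N: "prob_space N" "sets N = sets borel"
    and w: "w \<in> borel_measurable borel" "\<And>x. 0 \<le> w x" "\<And>x. w x \<le> C"
    and eq: "\<And>t. (\<integral>x. w x * iexp (t * (x \<bullet> h)) \<partial>M) = (\<integral>x. w x * iexp (t * (x \<bullet> h)) \<partial>N)"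
    and A: "A \<in> sets borel"
  shows "(\<integral>x. w x * indicator A (x \<bullet> h) \<partial>M) = (\<integral>x. w x * indicator A (x \<bullet> h) \<partial>N)"
proof -
  define c where "c = (\<integral>x. w x \<partial>M)"
  have cN: "c = (\<integral>x. w x \<partial>N)" using eq[of 0] by (simp add: c_def)
  have int: "integrable K w" if "prob_space K" "sets K = sets borel" for K
  proof -
    interpret K: prob_space K by fact
    have [measurable]: "w \<in> borel_measurable K" using w(1) that(2) by (simp cong: measurable_cong_sets)
    show ?thesis by (rule K.integrable_const_bound[where B=C]) (use w in auto)
  qed
  show ?thesis
  proof (cases "c = 0")
    case True
    have *: "(\<integral>x. w x * indicator A (x \<bullet> h) \<partial>K) = 0"
      if K: "prob_space K" "sets K = sets borel" and 0: "(\<integral>x. w x \<partial>K) = 0" for K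
    proof -
      have "AE x in K. w x = 0"
        using 0 w(2) int[OF K] by (subst (asm) integral_nonneg_eq_0_iff_AE) auto
      then show ?thesis by (intro integral_eq_zero_AE) auto
    qed
    show ?thesis using *[OF M] *[OF N] True c_def cN by simp
  next
    case False
    have "c \<ge> 0" unfolding c_def using w(2) by simp
    with False have c: "c > 0" by simp
    define D where "D K = distr (density K (\<lambda>x. ennreal (w x / c))) borel (\<lambda>x. x \<bullet> h)" for K
    have D: "real_distribution (D K)"
        "char (D K) t = (\<integral>x. w x * iexp (t * (x \<bullet> h)) \<partial>K) / c"
        "measure (D K) A = (\<integral>x. w x * indicator A (x \<bullet> h) \<partial>K) / c"
      if K: "prob_space K" "sets K = sets borel" and cK: "c = (\<integral>x. w x \<partial>K)" for K t
    proof -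
      interpret K: prob_space K by fact
      have [measurable]: "w \<in> borel_measurable K" "(\<lambda>x. x \<bullet> h) \<in> borel_measurable K"
        using w(1) that(2) by (simp_all cong: measurable_cong_sets)
      have meas: "(\<lambda>x. x \<bullet> h) \<in> borel_measurable (density K (\<lambda>x. ennreal (w x / c)))"
        by measurable
      have "(\<integral>\<^sup>+x. ennreal (w x / c) \<partial>K) = ennreal (\<integral>x. w x / c \<partial>K)"
        using int[OF K] w(2) c by (intro nn_integral_eq_integral) auto
      also have "\<dots> = 1" using c cK by simp
      finally have "prob_space (density K (\<lambda>x. ennreal (w x / c)))"
        using K.emeasure_space_1 by (intro prob_spaceI) (simp add: emeasure_density cong: nn_integral_cong)
      then have "prob_space (D K)" unfolding D_def by (rule prob_space.prob_space_distr) (rule meas)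
      then interpret D: prob_space "D K" .
      show DK: "real_distribution (D K)" by unfold_locales (auto simp: D_def)
      have "char (D K) t = (\<integral>x. (w x / c) *\<^sub>R iexp (t * (x \<bullet> h)) \<partial>K)"
        unfolding char_def D_def using w(2) c by (simp add: integral_distr integral_density)
      then show "char (D K) t = (\<integral>x. w x * iexp (t * (x \<bullet> h)) \<partial>K) / c"
        by (simp add: scaleR_conv_of_real)
      have "measure (D K) A = (\<integral>y. indicator A y \<partial>D K)"
        using A by (simp add: D_def)
      also have "\<dots> = (\<integral>x. indicator A (x \<bullet> h) \<partial>density K (\<lambda>x. ennreal (w x / c)))"
        unfolding D_def using A by (intro integral_distr[OF meas]) auto
      also have "\<dots> = (\<integral>x. (w x / c) *\<^sub>R indicator A (x \<bullet> h) \<partial>K)"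
        using w(2) c A by (intro integral_density) auto
      also have "\<dots> = (\<integral>x. w x * indicator A (x \<bullet> h) \<partial>K) / c" by simp
      finally show "measure (D K) A = (\<integral>x. w x * indicator A (x \<bullet> h) \<partial>K) / c" .
    qed
    have "D M = D N"
      by (rule Levy_uniqueness[OF D(1)[OF M c_def] D(1)[OF N cN]])
        (rule ext, simp only: D(2)[OF M c_def] D(2)[OF N cN] eq)
    then show ?thesis using D(3)[OF M c_def] D(3)[OF N cN] c by simp
  qed
qed

text \<open>An indicator of a cylinder times a cosine is not a density, but it becomes one after adding the indicator
  itself; so one-dimensional Levy uniqueness replaces the functionals one at a time by events.\<close>

lemma cylinder_char_eq:
  fixes M N :: "'b::{real_inner, second_countable_topology} measure"
  defines "P \<equiv> \<lambda>l (x::'b). prod_list (map (\<lambda>(h, A). indicator A (x \<bullet> h) :: real) l)"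
  assumes M: "prob_space M" "sets M = sets borel" and N: "prob_space N" "sets N = sets borel"
    and eq: "\<And>h. (\<integral>x. iexp (x \<bullet> h) \<partial>M) = (\<integral>x. iexp (x \<bullet> h) \<partial>N)"
    and l: "set l \<subseteq> UNIV \<times> sets borel"
  shows "(\<integral>x. P l x * iexp (x \<bullet> h) \<partial>M) = (\<integral>x. P l x * iexp (x \<bullet> h) \<partial>N)"
  using l
proof (induction l arbitrary: h)
  case Nil
  then show ?case using eq by (simp add: P_def)
next
  case (Cons kA l)
  obtain k A where kA: "kA = (k, A)" by (cases kA)
  have l: "set l \<subseteq> UNIV \<times> sets borel" and [measurable]: "A \<in> sets borel" using Cons.prems kA by auto
  note IH = Cons.IH[OF l]
  have P01: "0 \<le> P l x" "P l x \<le> 1" for x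
    by (induction l) (auto simp: P_def indicator_def)
  have [measurable]: "P l \<in> borel_measurable borel"
    using l unfolding P_def
  proof (induction l)
    case (Cons a l)
    obtain h B where a: "a = (h, B)" by (cases a)
    have [measurable]: "B \<in> sets borel" using Cons.prems a by auto
    have [measurable]: "(\<lambda>x. prod_list (map (\<lambda>(h, A). indicator A (x \<bullet> h) :: real) l)) \<in> borel_measurable borel"
      using Cons by auto
    show ?case unfolding a by simp measurable
  qed simp
  have int: "integrable K (\<lambda>x. u x * iexp (x \<bullet> g))"
    if "prob_space K" "sets K = sets borel" "u \<in> borel_measurable borel" "\<And>x. norm (u x) \<le> 1" for K and u :: "'b \<Rightarrow> complex" and g :: 'b
    using that(2,3) by (intro prob_space.integrable_iexp'[OF that(1) _ _ that(4)]) (simp_all cong: measurable_cong_sets)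
  have intP: "integrable K (\<lambda>x. P l x * iexp (x \<bullet> g))" if "prob_space K" "sets K = sets borel" for K g
    by (rule int[OF that]) (use P01 in auto)
  \<comment> \<open>For \<open>z = 1\<close> this is the cosine of \<open>x \<bullet> h\<close>, for
    \<open>z = - \<i>\<close> the sine. Either has absolute value at most 1, so
    \<open>1 + ?R z x\<close> is a weight with values between 0 and 2. The two choices of
    \<open>z\<close> give the real and the imaginary part of the claim.\<close>
  let ?R = "\<lambda>z x. Re (z * iexp (x \<bullet> h))"
  have R: "\<bar>?R z x\<bar> \<le> 1" if "norm z = 1" for z x
    using abs_Re_le_cmod[of "z * iexp (x \<bullet> h)"] that by (simp add: norm_mult)
  have main: "(\<integral>x. P l x * indicator A (x \<bullet> k) * ?R z x \<partial>M) = (\<integral>x. P l x * indicator A (x \<bullet> k) * ?R z x \<partial>N)"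
    if z: "norm z = 1" for z
  proof -
    have a: "(\<integral>x. P l x * (1 + ?R z x) * indicator A (x \<bullet> k) \<partial>M) = (\<integral>x. P l x * (1 + ?R z x) * indicator A (x \<bullet> k) \<partial>N)"
    proof (rule weighted_marginal_eq[OF M N, where C=2])
      show "0 \<le> P l x * (1 + ?R z x)" "P l x * (1 + ?R z x) \<le> 2" for x
        using P01[of x] R[OF z, of x] mult_mono[of "P l x" 1 "1 + ?R z x" 2] by (auto simp: abs_le_iff)
      show "(\<integral>x. (P l x * (1 + ?R z x)) * iexp (t * (x \<bullet> k)) \<partial>M) = (\<integral>x. (P l x * (1 + ?R z x)) * iexp (t * (x \<bullet> k)) \<partial>N)" for t
      proof -
        \<comment> \<open>The real part is half the sum of a number and its conjugate. The weighted
          characteristic function thus splits into three integrals, each covered by the induction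
          hypothesis at another functional: \<open>t *\<^sub>R k\<close>,
          \<open>t *\<^sub>R k + h\<close> and \<open>t *\<^sub>R k - h\<close>.\<close>
        have "(P l x * (1 + ?R z x)) * iexp (t * (x \<bullet> k)) = P l x * iexp (x \<bullet> (t *\<^sub>R k)) +
            (z / 2 * (P l x * iexp (x \<bullet> (t *\<^sub>R k + h))) + cnj z / 2 * (P l x * iexp (x \<bullet> (t *\<^sub>R k - h))))" for x
        proof -
          have "of_real (?R z x) = (z * iexp (x \<bullet> h) + cnj z * iexp (- (x \<bullet> h))) / 2"
            by (simp add: complex_eq_iff Re_exp Im_exp)
          moreover have "iexp (x \<bullet> (t *\<^sub>R k)) = iexp (t * (x \<bullet> k))"
            "iexp (x \<bullet> (t *\<^sub>R k + h)) = iexp (t * (x \<bullet> k)) * iexp (x \<bullet> h)"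
            "iexp (x \<bullet> (t *\<^sub>R k - h)) = iexp (t * (x \<bullet> k)) * iexp (- (x \<bullet> h))"
            by (simp_all add: inner_add_right inner_diff_right exp_add[symmetric] algebra_simps)
          moreover have "p * (1 + (z * a + z' * b) / 2) * e = p * e + (z / 2 * (p * (e * a)) + z' / 2 * (p * (e * b)))"
            for p a b e z z' :: complex by (simp add: field_simps)
          ultimately show ?thesis by (simp only: of_real_mult of_real_add of_real_1)
        qed
        then have eqK: "(\<integral>x. (P l x * (1 + ?R z x)) * iexp (t * (x \<bullet> k)) \<partial>K) = (\<integral>x. P l x * iexp (x \<bullet> (t *\<^sub>R k)) \<partial>K) +
            (z / 2 * (\<integral>x. P l x * iexp (x \<bullet> (t *\<^sub>R k + h)) \<partial>K) + cnj z / 2 * (\<integral>x. P l x * iexp (x \<bullet> (t *\<^sub>R k - h)) \<partial>K))"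
          if "prob_space K" "sets K = sets borel" for K
          using intP[OF that, of "t *\<^sub>R k"] intP[OF that, of "t *\<^sub>R k + h"] intP[OF that, of "t *\<^sub>R k - h"]
          by (simp del: of_real_mult of_real_add)
        show ?thesis unfolding eqK[OF M] eqK[OF N] IH by (rule refl)
      qed
    qed (use z in auto)
    have b: "(\<integral>x. P l x * indicator A (x \<bullet> k) \<partial>M) = (\<integral>x. P l x * indicator A (x \<bullet> k) \<partial>N)"
      by (rule weighted_marginal_eq[OF M N, where C=1]) (use IH[of "_ *\<^sub>R k"] P01 in auto)
    have "(\<integral>x. P l x * indicator A (x \<bullet> k) * ?R z x \<partial>K) =
      (\<integral>x. P l x * (1 + ?R z x) * indicator A (x \<bullet> k) \<partial>K) - (\<integral>x. P l x * indicator A (x \<bullet> k) \<partial>K)"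
      if K: "prob_space K" "sets K = sets borel" for K
    proof -
      interpret K: prob_space K by fact
      have [measurable]: "P l \<in> borel_measurable K" "(\<lambda>x. x \<bullet> k) \<in> borel_measurable K" "(\<lambda>x. x \<bullet> h) \<in> borel_measurable K"
        using K(2) by (simp_all cong: measurable_cong_sets)
      have i1: "integrable K (\<lambda>x. P l x * indicator A (x \<bullet> k))"
        by (rule K.integrable_const_bound[where B=1]) (use P01 in \<open>auto simp: indicator_def\<close>)
      have i2: "integrable K (\<lambda>x. P l x * indicator A (x \<bullet> k) * ?R z x)"
      proof (rule integrable_le[OF i1])
        show "norm (P l x * indicator A (x \<bullet> k) * ?R z x) \<le> P l x * indicator A (x \<bullet> k)" for x
          using mult_left_mono[OF R[OF z, of x], of "P l x * indicator A (x \<bullet> k)"] P01[of x] by (simp add: abs_mult)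
      qed measurable
      have "(\<integral>x. P l x * (1 + ?R z x) * indicator A (x \<bullet> k) \<partial>K) =
        (\<integral>x. P l x * indicator A (x \<bullet> k) + P l x * indicator A (x \<bullet> k) * ?R z x \<partial>K)"
        by (rule Bochner_Integration.integral_cong) (auto simp: algebra_simps)
      with i1 i2 show ?thesis by simp
    qed
    with a b M N show ?thesis by simp
  qed
  have "(\<integral>x. P (kA # l) x * iexp (x \<bullet> h) \<partial>K) = Complex (\<integral>x. P l x * indicator A (x \<bullet> k) * ?R 1 x \<partial>K)
      (\<integral>x. P l x * indicator A (x \<bullet> k) * ?R (- \<i>) x \<partial>K)" if K: "prob_space K" "sets K = sets borel" for K
  proof -
    have "integrable K (\<lambda>x. of_real (P l x * indicator A (x \<bullet> k)) * iexp (x \<bullet> h))"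
      by (rule int[OF K]) (use P01 in \<open>auto simp: indicator_def\<close>)
    from integral_Re[OF this] integral_Im[OF this] show ?thesis
      by (simp add: P_def kA complex_eq_iff mult.commute)
  qed
  then show ?case using main[of 1] main[of "- \<i>"] M N by simp
qed

text \<open>A closed ball is an intersection of half-spaces whose directions run through a countable
  dense set, and an open set is a countable union of balls with centres in that set and rational
  radii. Finite lists of conditions, instead of single half-spaces, make the generator stable under
  intersection.\<close>

lemma borel_eq_sigma_cylinders:
  "sets (borel :: 'b::{real_inner, second_countable_topology} measure) =
     sigma_sets UNIV {{x. \<forall>(h, A)\<in>set l. x \<bullet> h \<in> A} | l. set l \<subseteq> UNIV \<times> sets borel}"
    (is "_ = sigma_sets UNIV ?E")
proof
  show "sigma_sets UNIV ?E \<subseteq> sets borel"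
  proof -
    have "{x. \<forall>(h, A)\<in>set l. x \<bullet> h \<in> A} \<in> sets borel" if "set l \<subseteq> UNIV \<times> sets borel" for l :: "('b \<times> real set) list"
    proof -
      have "{x. x \<bullet> h \<in> A} \<in> sets borel" if "A \<in> sets borel" for h :: 'b and A
        using measurable_sets[of "\<lambda>x. x \<bullet> h" borel borel A] that by (simp add: vimage_def)
      moreover have "{x. \<forall>(h, A)\<in>set l. x \<bullet> h \<in> A} = (\<Inter>p\<in>set l. {x. x \<bullet> fst p \<in> snd p})"
        by (force simp: case_prod_beta)
      ultimately show ?thesis using that
        by (cases "l = []") (auto intro!: sets.finite_INT)
    qed
    then have "?E \<subseteq> sets borel" by auto
    then show ?thesis using sets.sigma_sets_subset[of ?E borel] by simp
  qed
  obtain D :: "'b set" where D: "countable D" "\<And>X. open X \<Longrightarrow> X \<noteq> {} \<Longrightarrow> \<exists>d\<in>D. d \<in> X"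
    using countable_dense_setE by blast
  interpret S: sigma_algebra UNIV "sigma_sets UNIV ?E" by (rule sigma_algebra_sigma_sets) auto
  have half: "{x. x \<bullet> h \<le> a} \<in> sigma_sets UNIV ?E" for h :: 'b and a
  proof (rule sigma_sets.Basic)
    show "{x. x \<bullet> h \<le> a} \<in> ?E" by (auto intro!: exI[of _ "[(h, {..a})]"])
  qed
  have cball_eq: "cball c r = (\<Inter>h\<in>D. {x. x \<bullet> h \<le> c \<bullet> h + r * norm h})" if "r \<ge> 0" for c :: 'b and r
  proof (intro set_eqI iffI)
    fix x assume "x \<in> cball c r"
    then have "norm (x - c) \<le> r" by (simp add: dist_norm norm_minus_commute)
    then have "(x - c) \<bullet> h \<le> r * norm h" for h
      using norm_cauchy_schwarz[of "x - c" h] mult_right_mono[of "norm (x - c)" r "norm h"] by simp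
    then show "x \<in> (\<Inter>h\<in>D. {x. x \<bullet> h \<le> c \<bullet> h + r * norm h})" by (auto simp: inner_diff_left algebra_simps)
  next
    fix x assume x: "x \<in> (\<Inter>h\<in>D. {x. x \<bullet> h \<le> c \<bullet> h + r * norm h})"
    \<comment> \<open>The inequality is a closed condition on \<open>h\<close>, so it passes from
      the dense set to every direction; the direction \<open>x - c\<close> then yields the bound on
      the norm.\<close>
    have "closed {h. (x - c) \<bullet> h \<le> r * norm h}"
      by (intro closed_Collect_le continuous_intros)
    then have op: "open {h. \<not> (x - c) \<bullet> h \<le> r * norm h}" by (simp add: closed_def Collect_neg_eq)
    have "{h. \<not> (x - c) \<bullet> h \<le> r * norm h} = {}"
    proof (rule ccontr)
      assume "{h. \<not> (x - c) \<bullet> h \<le> r * norm h} \<noteq> {}"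
      from D(2)[OF op this] x show False by (auto simp: inner_diff_left algebra_simps)
    qed
    then have "(x - c) \<bullet> (x - c) \<le> r * norm (x - c)" by blast
    then have "norm (x - c) * norm (x - c) \<le> r * norm (x - c)" by (simp add: dot_square_norm power2_eq_square)
    then have "norm (x - c) \<le> r" using that by (cases "norm (x - c) = 0") auto
    then show "x \<in> cball c r" by (simp add: dist_norm norm_minus_commute)
  qed
  have cb: "cball c r \<in> sigma_sets UNIV ?E" for c :: 'b and r
  proof (cases "r \<ge> 0")
    case True
    have "D \<noteq> {}" using D(2)[of UNIV] by auto
    then show ?thesis unfolding cball_eq[OF True] using D(1) half by (intro S.countable_INT') auto
  qed auto
  have "U \<in> sigma_sets UNIV ?E" if U: "open U" for U :: "'b set"
  proof -
    let ?I = "{p \<in> D \<times> \<rat>. cball (fst p) (snd p) \<subseteq> U}"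
    have "U = (\<Union>p\<in>?I. cball (fst p) (snd p))"
    proof (intro set_eqI iffI)
      fix x assume "x \<in> U"
      then obtain e where e: "e > 0" "ball x e \<subseteq> U" using U openE by blast
      obtain d where d: "d \<in> D" "d \<in> ball x (e / 3)" using D(2)[of "ball x (e / 3)"] e by auto
      obtain q where q: "q \<in> \<rat>" "e / 3 < q" "q < 2 * e / 3" using Rats_dense_in_real[of "e/3" "2 * e/3"] e by auto
      have "cball d q \<subseteq> U"
      proof
        fix y assume "y \<in> cball d q"
        then have "dist x y < e" using d(2) q(3) dist_triangle[of x y d] by simp
        then show "y \<in> U" using e by auto
      qed
      moreover have "x \<in> cball d q" using d(2) q by (simp add: dist_commute)
      ultimately show "x \<in> (\<Union>p\<in>?I. cball (fst p) (snd p))" using d q by (auto intro!: bexI[of _ "(d, q)"])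
    qed auto
    moreover have "countable ?I"
      by (rule countable_subset[of _ "D \<times> \<rat>"]) (auto intro!: countable_SIGMA D(1) countable_rat)
    ultimately show ?thesis using cb by (metis (no_types, lifting) S.countable_UN' image_subsetI)
  qed
  then have "sigma_sets UNIV {S :: 'b set. open S} \<subseteq> sigma_sets UNIV ?E"
    by (intro sigma_sets_mono) auto
  then show "sets borel \<subseteq> sigma_sets UNIV ?E" by (simp add: borel_def)
qed

text \<open>The cylinders form a generator that is stable under intersection (append the lists), so
  agreement on each cylinder is enough; this is \<open>cylinder_char_eq\<close> at
  \<open>h = 0\<close>.\<close>

theorem measure_eqI_char:
  fixes M N :: "'b::{real_inner, second_countable_topology} measure"
  assumes M: "prob_space M" "sets M = sets borel" and N: "prob_space N" "sets N = sets borel"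
    and eq: "\<And>h. (\<integral>x. iexp (x \<bullet> h) \<partial>M) = (\<integral>x. iexp (x \<bullet> h) \<partial>N)"
  shows "M = N"
proof -
  let ?cyl = "\<lambda>l. {x :: 'b. \<forall>(h, A)\<in>set l. x \<bullet> h \<in> A}"
  let ?E = "{?cyl l | l. set l \<subseteq> UNIV \<times> sets borel}"
  show ?thesis
  proof (rule measure_eqI_generator_eq[where E="?E" and \<Omega>=UNIV and A="\<lambda>_. UNIV"])
    show "Int_stable ?E"
    proof (rule Int_stableI)
      fix a b assume "a \<in> ?E" "b \<in> ?E"
      then obtain l l' where "a = ?cyl l" "b = ?cyl l'" "set l \<subseteq> UNIV \<times> sets borel" "set l' \<subseteq> UNIV \<times> sets borel" by auto
      then show "a \<inter> b \<in> ?E" by (auto intro!: exI[of _ "l @ l'"])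
    qed
    show "range (\<lambda>_. UNIV) \<subseteq> ?E" by (auto intro!: exI[of _ "[]"])
    show "sets M = sigma_sets UNIV ?E" "sets N = sigma_sets UNIV ?E"
      using M N borel_eq_sigma_cylinders by auto
    show "emeasure M UNIV \<noteq> \<infinity>" for i :: nat
      using prob_space.finite_measure[OF M(1)] by (simp add: finite_measure.emeasure_eq_measure)
    fix X assume "X \<in> ?E"
    then obtain l where X: "X = ?cyl l" and l: "set l \<subseteq> UNIV \<times> sets borel" by auto
    have XB: "X \<in> sets borel" by (subst borel_eq_sigma_cylinders) (rule sigma_sets.Basic, fact)
    have ind: "prod_list (map (\<lambda>(h, A). indicator A (x \<bullet> h) :: real) l) = indicator X x" for x
      unfolding X by (induction l) (auto simp: indicator_def)
    have "(\<integral>x. complex_of_real (indicator X x) * iexp (x \<bullet> 0) \<partial>M) = (\<integral>x. complex_of_real (indicator X x) * iexp (x \<bullet> 0) \<partial>N)"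
      using cylinder_char_eq[OF M N eq l, where h=0] unfolding ind .
    moreover have "X \<in> sets M" "X \<in> sets N" "X \<inter> space M = X" "X \<inter> space N = X"
      using XB M(2) N(2) sets_eq_imp_space_eq[OF M(2)] sets_eq_imp_space_eq[OF N(2)] by auto
    ultimately have "measure M X = measure N X" by simp
    then show "emeasure M X = emeasure N X"
      by (simp add: finite_measure.emeasure_eq_measure[OF prob_space.finite_measure[OF M(1)]]
        finite_measure.emeasure_eq_measure[OF prob_space.finite_measure[OF N(1)]])
  qed (simp_all)
qed

section \<open>Gaussian measures\<close>

lemma centred_normal_std:
  assumes "s > 0"
  shows "centred_normal s = distr std_normal_distribution borel (\<lambda>x. s * x)"
proof -
  interpret prob_space std_normal_distribution by (simp add: prob_space_normal_density)
  have "distributed std_normal_distribution lborel (\<lambda>x. x) std_normal_density"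
    by (auto simp: distributed_def distr_id2 intro!: measure_eqI)
  from normal_density_affine[OF this, of s 0] assms
  have "distributed std_normal_distribution lborel (\<lambda>x. s * x) (normal_density 0 s)" by simp
  then have "distr std_normal_distribution lborel (\<lambda>x. s * x) = density lborel (normal_density 0 s)"
    by (rule distributed_distr_eq_density)
  moreover have "distr std_normal_distribution lborel (\<lambda>x. s * x) = distr std_normal_distribution borel (\<lambda>x. s * x)"
    by (rule distr_cong) auto
  ultimately show ?thesis using assms by (simp add: centred_normal_def)
qed

lemma real_distribution_centred_normal: "s \<ge> 0 \<Longrightarrow> real_distribution (centred_normal s)"
  unfolding real_distribution_def real_distribution_axioms_def centred_normal_def
  by (auto simp: prob_space_normal_density intro!: prob_space_return)

lemma char_centred_normal:
  assumes "s \<ge> 0"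
  shows "char (centred_normal s) t = of_real (exp (- (s * t)\<^sup>2 / 2))"
proof (cases "s = 0")
  case True
  then show ?thesis by (simp add: centred_normal_def char_def integral_return)
next
  case False
  with assms have "s > 0" by simp
  then have "char (centred_normal s) t = char std_normal_distribution (s * t)"
    by (simp add: centred_normal_std char_def integral_distr ac_simps)
  then show ?thesis by (simp add: char_std_normal_distribution)
qed

lemma centred_normal_second_moment:
  assumes "s \<ge> 0"
  shows "integrable (centred_normal s) (\<lambda>x. x\<^sup>2)" "(\<integral>x. x\<^sup>2 \<partial>centred_normal s) = s\<^sup>2"
proof -
  have "integrable (centred_normal s) (\<lambda>x. x\<^sup>2) \<and> (\<integral>x. x\<^sup>2 \<partial>centred_normal s) = s\<^sup>2"
  proof (cases "s = 0")
    case True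
    then show ?thesis
      by (simp add: centred_normal_def integral_return integrable_iff_bounded nn_integral_return)
  next
    case False
    with assms have s: "s > 0" by simp
    have "integrable (centred_normal s) (\<lambda>x. x\<^sup>2)"
      using integrable_normal_moment[OF s, of 0 2] s by (simp add: centred_normal_def integrable_density)
    moreover have "has_bochner_integral lborel (\<lambda>x. normal_density 0 s x * x\<^sup>2) (s\<^sup>2)"
      using normal_moment_even[OF s, of 0 1] s by (simp add: power2_eq_square)
    then have "(\<integral>x. x\<^sup>2 \<partial>centred_normal s) = s\<^sup>2"
      using s by (simp add: centred_normal_def integral_density has_bochner_integral_integral_eq)
    ultimately show ?thesis by simp
  qed
  then show "integrable (centred_normal s) (\<lambda>x. x\<^sup>2)" "(\<integral>x. x\<^sup>2 \<partial>centred_normal s) = s\<^sup>2" by auto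
qed

locale gaussian =
  fixes \<gamma> :: "'a::{real_inner, second_countable_topology} measure"
  assumes gauss: "centred_gaussian \<gamma>"
begin

sublocale prob_space \<gamma> using gauss by (simp add: centred_gaussian_def)

lemma sets_gaussian [simp, measurable_cong]: "sets \<gamma> = sets borel"
  using gauss by (simp add: centred_gaussian_def)

lemma space_gaussian [simp]: "space \<gamma> = UNIV"
  using sets_eq_imp_space_eq[OF sets_gaussian] by simp

text \<open>The variance appears as a second moment instead of the parameter \<open>s\<close> of the
  definition. In this form it is visibly a quadratic form in \<open>h\<close>, and the variances of
  linear combinations follow by integrating a pointwise identity.\<close>

lemma gaussian_marginal:
  shows integrable_inner_square: "integrable \<gamma> (\<lambda>x. (x \<bullet> h)\<^sup>2)"
    and integral_iexp_inner: "(\<integral>x. iexp (x \<bullet> h) \<partial>\<gamma>) = of_real (exp (- (\<integral>x. (x \<bullet> h)\<^sup>2 \<partial>\<gamma>) / 2))"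
proof -
  obtain s where s: "s \<ge> 0" and d: "distr \<gamma> borel (\<lambda>x. x \<bullet> h) = centred_normal s"
    using gauss unfolding centred_gaussian_def by blast
  have meas: "(\<lambda>x. x \<bullet> h) \<in> measurable \<gamma> borel" by measurable
  show "integrable \<gamma> (\<lambda>x. (x \<bullet> h)\<^sup>2)"
    using centred_normal_second_moment(1)[OF s] unfolding d[symmetric]
    by (subst (asm) integrable_distr_eq[OF meas]) auto
  have q: "(\<integral>x. (x \<bullet> h)\<^sup>2 \<partial>\<gamma>) = s\<^sup>2"
    using centred_normal_second_moment(2)[OF s] unfolding d[symmetric]
    by (subst (asm) integral_distr[OF meas]) auto
  have "(\<integral>x. iexp (x \<bullet> h) \<partial>\<gamma>) = char (centred_normal s) 1"
    unfolding char_def d[symmetric] by (subst integral_distr[OF meas]) auto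
  then show "(\<integral>x. iexp (x \<bullet> h) \<partial>\<gamma>) = of_real (exp (- (\<integral>x. (x \<bullet> h)\<^sup>2 \<partial>\<gamma>) / 2))"
    using char_centred_normal[OF s, of 1] by (simp add: q)
qed

section \<open>Rotation invariance of pairs of independent Gaussian variables\<close>

sublocale pair: pair_prob_space \<gamma> \<gamma> ..

lemma sets_pair_gaussian: "sets (\<gamma> \<Otimes>\<^sub>M \<gamma>) = sets borel"
  by (metis borel_prod sets_gaussian sets_pair_measure_cong)

lemma pair_gaussian_char:
  "(\<integral>p. iexp (fst p \<bullet> h + snd p \<bullet> k) \<partial>(\<gamma> \<Otimes>\<^sub>M \<gamma>)) =
     of_real (exp (- ((\<integral>x. (x \<bullet> h)\<^sup>2 \<partial>\<gamma>) + (\<integral>x. (x \<bullet> k)\<^sup>2 \<partial>\<gamma>)) / 2))"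
proof -
  have "(\<integral>p. iexp (fst p \<bullet> h + snd p \<bullet> k) \<partial>(\<gamma> \<Otimes>\<^sub>M \<gamma>)) = (\<integral>x. \<integral>y. iexp (x \<bullet> h + y \<bullet> k) \<partial>\<gamma> \<partial>\<gamma>)"
    by (subst pair.integral_fst'[symmetric]) (auto intro!: pair.P.integrable_const_bound[where B=1])
  also have "\<dots> = (\<integral>x. iexp (x \<bullet> h) * (\<integral>y. iexp (y \<bullet> k) \<partial>\<gamma>) \<partial>\<gamma>)"
    by (simp add: distrib_left exp_add)
  also have "\<dots> = (\<integral>x. iexp (x \<bullet> h) \<partial>\<gamma>) * (\<integral>y. iexp (y \<bullet> k) \<partial>\<gamma>)" by (rule integral_mult_left_zero)
  also have "\<dots> = of_real (exp (- (\<integral>x. (x \<bullet> h)\<^sup>2 \<partial>\<gamma>) / 2) * exp (- (\<integral>x. (x \<bullet> k)\<^sup>2 \<partial>\<gamma>) / 2))"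
    by (simp only: integral_iexp_inner of_real_mult)
  finally show ?thesis by (simp add: exp_add[symmetric] diff_divide_distrib)
qed

text \<open>The characteristic function of the pair depends on the two directions only through the
  sum of their variances, and an orthogonal change of directions preserves that sum. The map is a
  reflection, not a rotation: it is its own adjoint and its own inverse. The first property is
  \<open>inner_T\<close>, the second serves \<open>gaussian_exchangeable\<close>.\<close>

lemma pair_gaussian_reflection:
  fixes c s :: real
  assumes cs: "c\<^sup>2 + s\<^sup>2 = 1"
  shows "distr (\<gamma> \<Otimes>\<^sub>M \<gamma>) (\<gamma> \<Otimes>\<^sub>M \<gamma>)
    (\<lambda>p. (c *\<^sub>R fst p + s *\<^sub>R snd p, s *\<^sub>R fst p - c *\<^sub>R snd p)) = \<gamma> \<Otimes>\<^sub>M \<gamma>"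
    (is "distr _ _ ?T = _")
proof -
  have T [measurable]: "?T \<in> measurable (\<gamma> \<Otimes>\<^sub>M \<gamma>) (\<gamma> \<Otimes>\<^sub>M \<gamma>)" by measurable
  have q: "(\<integral>x. (x \<bullet> (c *\<^sub>R h + s *\<^sub>R k))\<^sup>2 \<partial>\<gamma>) + (\<integral>x. (x \<bullet> (s *\<^sub>R h - c *\<^sub>R k))\<^sup>2 \<partial>\<gamma>) =
      (\<integral>x. (x \<bullet> h)\<^sup>2 \<partial>\<gamma>) + (\<integral>x. (x \<bullet> k)\<^sup>2 \<partial>\<gamma>)" for h k
  proof -
    have "(c * a + s * b)\<^sup>2 + (s * a - c * b)\<^sup>2 = a\<^sup>2 + b\<^sup>2" for a b :: real
    proof -
      have "(c * a + s * b)\<^sup>2 + (s * a - c * b)\<^sup>2 = (c\<^sup>2 + s\<^sup>2) * (a\<^sup>2 + b\<^sup>2)" by algebra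
      then show ?thesis by (simp add: cs)
    qed
    then have "(x \<bullet> (c *\<^sub>R h + s *\<^sub>R k))\<^sup>2 + (x \<bullet> (s *\<^sub>R h - c *\<^sub>R k))\<^sup>2 = (x \<bullet> h)\<^sup>2 + (x \<bullet> k)\<^sup>2" for x
      by (simp add: inner_add_right inner_diff_right)
    then have "(\<integral>x. (x \<bullet> (c *\<^sub>R h + s *\<^sub>R k))\<^sup>2 + (x \<bullet> (s *\<^sub>R h - c *\<^sub>R k))\<^sup>2 \<partial>\<gamma>) = (\<integral>x. (x \<bullet> h)\<^sup>2 + (x \<bullet> k)\<^sup>2 \<partial>\<gamma>)"
      by simp
    then show ?thesis
      by (subst (asm) (1 2) Bochner_Integration.integral_add) (auto intro: integrable_inner_square)
  qed
  have inner_T: "?T p \<bullet> v = fst p \<bullet> (c *\<^sub>R fst v + s *\<^sub>R snd v) + snd p \<bullet> (s *\<^sub>R fst v - c *\<^sub>R snd v)" for p v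
    by (simp add: inner_prod_def inner_add_left inner_add_right inner_diff_left inner_diff_right)
  have inner_p: "p \<bullet> v = fst p \<bullet> fst v + snd p \<bullet> snd v" for p v :: "'a \<times> 'a"
    by (simp add: inner_prod_def)
  have meas: "(\<lambda>p. iexp (p \<bullet> v)) \<in> borel_measurable (\<gamma> \<Otimes>\<^sub>M \<gamma>)" for v
    unfolding inner_p by measurable
  show ?thesis
  proof (rule measure_eqI_char)
    show "prob_space (distr (\<gamma> \<Otimes>\<^sub>M \<gamma>) (\<gamma> \<Otimes>\<^sub>M \<gamma>) ?T)" by (rule pair.P.prob_space_distr) (rule T)
    show "prob_space (\<gamma> \<Otimes>\<^sub>M \<gamma>)" by (rule pair.P.prob_space_axioms)
    show "(\<integral>p. iexp (p \<bullet> v) \<partial>distr (\<gamma> \<Otimes>\<^sub>M \<gamma>) (\<gamma> \<Otimes>\<^sub>M \<gamma>) ?T) = (\<integral>p. iexp (p \<bullet> v) \<partial>(\<gamma> \<Otimes>\<^sub>M \<gamma>))" for v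
      by (subst integral_distr[OF T meas], simp only: inner_T, simp only: inner_p pair_gaussian_char q)
  qed (use sets_pair_gaussian in simp_all)
qed

text \<open>The reflection sends the pair of state and noise to the pair of proposal and a fresh
  noise, and from there the proposal leads back to the original state because the reflection is an
  involution. This is reversibility of the proposal with respect to \<open>\<gamma>\<close>.\<close>

lemma gaussian_exchangeable:
  fixes c s :: real and w :: "'a \<times> 'a \<Rightarrow> ennreal"
  assumes cs: "c\<^sup>2 + s\<^sup>2 = 1" and w [measurable]: "w \<in> borel_measurable (borel \<Otimes>\<^sub>M borel)"
  shows "(\<integral>\<^sup>+p. w (fst p, c *\<^sub>R fst p + s *\<^sub>R snd p) \<partial>(\<gamma> \<Otimes>\<^sub>M \<gamma>)) =
    (\<integral>\<^sup>+p. w (c *\<^sub>R fst p + s *\<^sub>R snd p, fst p) \<partial>(\<gamma> \<Otimes>\<^sub>M \<gamma>))"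
proof -
  let ?T = "\<lambda>p :: 'a \<times> 'a. (c *\<^sub>R fst p + s *\<^sub>R snd p, s *\<^sub>R fst p - c *\<^sub>R snd p)"
  have T: "?T \<in> measurable (\<gamma> \<Otimes>\<^sub>M \<gamma>) (\<gamma> \<Otimes>\<^sub>M \<gamma>)" by measurable
  have e: "c *\<^sub>R (c *\<^sub>R x + s *\<^sub>R y) + s *\<^sub>R (s *\<^sub>R x - c *\<^sub>R y) = x" for x y :: 'a
  proof -
    have "c *\<^sub>R (c *\<^sub>R x + s *\<^sub>R y) + s *\<^sub>R (s *\<^sub>R x - c *\<^sub>R y) = (c\<^sup>2 + s\<^sup>2) *\<^sub>R x"
      by (simp add: algebra_simps power2_eq_square)
    then show ?thesis by (simp add: cs)
  qed
  have "(\<integral>\<^sup>+p. w (fst p, c *\<^sub>R fst p + s *\<^sub>R snd p) \<partial>(\<gamma> \<Otimes>\<^sub>M \<gamma>)) =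
    (\<integral>\<^sup>+p. w (fst p, c *\<^sub>R fst p + s *\<^sub>R snd p) \<partial>distr (\<gamma> \<Otimes>\<^sub>M \<gamma>) (\<gamma> \<Otimes>\<^sub>M \<gamma>) ?T)"
    by (simp only: pair_gaussian_reflection[OF cs])
  also have "\<dots> = (\<integral>\<^sup>+p. w (fst (?T p), c *\<^sub>R fst (?T p) + s *\<^sub>R snd (?T p)) \<partial>(\<gamma> \<Otimes>\<^sub>M \<gamma>))"
    by (rule nn_integral_distr[OF T]) measurable
  finally show ?thesis by (simp add: e)
qed

text \<open>Fernique's argument: after a rotation by \<open>\<pi>/4\<close>, one of the two independent copies is bounded by
  \<open>s\<close> and the other exceeds \<open>2 * u\<close> only if both of the original copies exceed \<open>u\<close>.\<close>

lemma gaussian_tail_doubling: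
  assumes half: "prob {x. norm x \<le> s} \<ge> 1 / 2" and s: "s > 0" "u \<ge> 2 * s"
  shows "prob {x. norm x > 2 * u} \<le> 2 * (prob {x. norm x > u})\<^sup>2"
proof -
  define c where "c = 1 / sqrt 2"
  have cs: "c\<^sup>2 + c\<^sup>2 = 1" and c0: "c > 0" by (simp_all add: c_def power_divide)
  let ?T = "\<lambda>p :: 'a \<times> 'a. (c *\<^sub>R fst p + c *\<^sub>R snd p, c *\<^sub>R fst p - c *\<^sub>R snd p)"
  have T: "?T \<in> measurable (\<gamma> \<Otimes>\<^sub>M \<gamma>) (\<gamma> \<Otimes>\<^sub>M \<gamma>)" by measurable
  let ?E = "{x. norm x \<le> s} \<times> {x :: 'a. norm x > 2 * u}"
  have [measurable]: "{x :: 'a. norm x \<le> s} \<in> sets borel" "{x :: 'a. norm x > r} \<in> sets borel" for r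
    by measurable
  have E [measurable]: "?E \<in> sets (\<gamma> \<Otimes>\<^sub>M \<gamma>)" by (intro pair_measureI) auto
  have times: "pair.P.prob (A \<times> B) = prob A * prob B" if "A \<in> sets borel" "B \<in> sets borel" for A B
    using that emeasure_pair_measure_Times[of A \<gamma> B]
    by (simp add: measure_def enn2real_mult)
  have "?T -` ?E \<inter> space (\<gamma> \<Otimes>\<^sub>M \<gamma>) \<subseteq> {x. norm x > u} \<times> {x. norm x > u}"
  proof
    fix p assume "p \<in> ?T -` ?E \<inter> space (\<gamma> \<Otimes>\<^sub>M \<gamma>)"
    then have a: "norm (c *\<^sub>R fst p + c *\<^sub>R snd p) \<le> s" "norm (c *\<^sub>R fst p - c *\<^sub>R snd p) > 2 * u" by auto
    \<comment> \<open>Here \<open>2 * c\<close> is the square root of 2, which is below 3/2, while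
      \<open>s\<close> is at most half of \<open>u\<close>.\<close>
    have "2 * u - s \<ge> 2 * c * u"
    proof -
      have "c \<le> 3 / 4" unfolding c_def using real_le_rsqrt[of "4/3" 2] by (simp add: field_simps power2_eq_square)
      then have "2 * c * u \<le> 3 / 2 * u" using s by (intro mult_right_mono) auto
      then show ?thesis using s by linarith
    qed
    moreover have "2 * c * norm (fst p) \<ge> norm (c *\<^sub>R fst p - c *\<^sub>R snd p) - norm (c *\<^sub>R fst p + c *\<^sub>R snd p)"
    proof -
      have "norm ((c *\<^sub>R fst p - c *\<^sub>R snd p) + (c *\<^sub>R fst p + c *\<^sub>R snd p)) = 2 * c * norm (fst p)"
        using c0 by (simp add: scaleR_add_left[symmetric])
      then show ?thesis using norm_diff_ineq[of "c *\<^sub>R fst p - c *\<^sub>R snd p" "c *\<^sub>R fst p + c *\<^sub>R snd p"] by linarith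
    qed
    moreover have "2 * c * norm (snd p) \<ge> norm (c *\<^sub>R fst p - c *\<^sub>R snd p) - norm (c *\<^sub>R fst p + c *\<^sub>R snd p)"
    proof -
      have "norm ((c *\<^sub>R fst p + c *\<^sub>R snd p) - (c *\<^sub>R fst p - c *\<^sub>R snd p)) = 2 * c * norm (snd p)"
        using c0 by (simp add: scaleR_add_left[symmetric])
      then show ?thesis using norm_triangle_ineq2[of "c *\<^sub>R fst p - c *\<^sub>R snd p" "c *\<^sub>R fst p + c *\<^sub>R snd p"]
        by (simp add: norm_minus_commute)
    qed
    ultimately have "2 * c * u < 2 * c * norm (fst p)" "2 * c * u < 2 * c * norm (snd p)" using a by linarith+
    then show "p \<in> {x. norm x > u} \<times> {x. norm x > u}" using c0 by (cases p) auto
  qed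
  then have "measure (distr (\<gamma> \<Otimes>\<^sub>M \<gamma>) (\<gamma> \<Otimes>\<^sub>M \<gamma>) ?T) ?E \<le> pair.P.prob ({x. norm x > u} \<times> {x. norm x > u})"
    by (subst measure_distr[OF T E]) (intro pair.P.finite_measure_mono pair_measureI, auto)
  then have "pair.P.prob ?E \<le> pair.P.prob ({x. norm x > u} \<times> {x. norm x > u})"
    by (simp only: pair_gaussian_reflection[OF cs])
  then have "prob {x. norm x \<le> s} * prob {x. norm x > 2 * u} \<le> (prob {x. norm x > u})\<^sup>2"
    by (simp add: times power2_eq_square)
  moreover have "1 / 2 * prob {x. norm x > 2 * u} \<le> prob {x. norm x \<le> s} * prob {x. norm x > 2 * u}"
    using half by (intro mult_right_mono) auto
  ultimately show ?thesis by simp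
qed

lemma gaussian_ball_prob:
  assumes "e > 0"
  shows "\<exists>s>0. prob {x. norm x \<le> s} \<ge> 1 - e"
proof -
  have "(\<lambda>n. prob {x. norm x \<le> real n}) \<longlonglongrightarrow> prob (\<Union>n. {x. norm x \<le> real n})"
    by (intro finite_Lim_measure_incseq) (auto simp: incseq_def)
  moreover have "(\<Union>n. {x :: 'a. norm x \<le> real n}) = space \<gamma>" using real_arch_simple by auto
  ultimately have "(\<lambda>n. prob {x. norm x \<le> real n}) \<longlonglongrightarrow> 1" using prob_space by simp
  then have "\<forall>\<^sub>F n in sequentially. prob {x. norm x \<le> real n} > 1 - e"
    using assms by (intro order_tendstoD) auto
  then obtain N where "\<And>n. n \<ge> N \<Longrightarrow> prob {x. norm x \<le> real n} > 1 - e"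
    by (auto simp: eventually_sequentially)
  then show ?thesis by (intro exI[of _ "real (Suc N)"]) (simp add: less_imp_le del: of_nat_Suc)
qed

text \<open>Twice the tail at \<open>2 ^ n * u\<close> is at least squared when \<open>n\<close>
  increases by one. Once it starts at or below \<open>exp (-1)\<close>, which is why
  \<open>s\<close> is chosen with the deficit \<open>exp (-1) / 2\<close>, it is at most
  \<open>exp (- (2 ^ n))\<close>. This beats a linear exponent on dyadic shells.\<close>

theorem gaussian_exp_moment: "\<exists>a>0. integrable \<gamma> (\<lambda>x. exp (a * norm x))"
proof -
  obtain s where s: "s > 0" "prob {x. norm x \<le> s} \<ge> 1 - exp (-1) / 2"
    using gaussian_ball_prob[of "exp (-1) / 2"] by auto
  have "exp (-1 :: real) \<le> 1" by simp
  with s(2) have half: "prob {x. norm x \<le> s} \<ge> 1 / 2" by linarith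
  define u where "u = 2 * s"
  have u: "u > 0" using s by (simp add: u_def)
  have tail: "2 * prob {x. norm x > 2 ^ n * u} \<le> exp (- (2 ^ n))" for n
  proof (induction n)
    case 0
    have "prob {x. norm x > u} \<le> prob (space \<gamma> - {x. norm x \<le> s})"
      using s(1) by (intro finite_measure_mono) (auto simp: u_def)
    also have "\<dots> = 1 - prob {x. norm x \<le> s}" by (rule prob_compl) simp
    finally show ?case using s(2) by simp
  next
    case (Suc n)
    have "1 * u \<le> 2 ^ n * u" using u by (intro mult_right_mono) auto
    then have "prob {x. norm x > 2 * (2 ^ n * u)} \<le> 2 * (prob {x. norm x > 2 ^ n * u})\<^sup>2"
      by (intro gaussian_tail_doubling[OF half s(1)]) (simp add: u_def)
    moreover have "(2 * prob {x. norm x > 2 ^ n * u})\<^sup>2 \<le> (exp (- (2 ^ n)))\<^sup>2"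
      using Suc.IH by (intro power_mono) auto
    moreover have "(exp (- (2 ^ n)))\<^sup>2 = exp (- (2 ^ Suc n) :: real)"
      by (simp add: power2_eq_square exp_add[symmetric])
    ultimately show ?case by (simp add: power_mult_distrib mult.assoc)
  qed
  \<comment> \<open>On the shell between \<open>2 ^ n * u\<close> and \<open>2 ^ Suc n * u\<close>
    the exponent \<open>a * norm x\<close> is then at most \<open>2 ^ n / 2\<close>, half the rate
    of decay of the tail. What remains, \<open>exp (- (2 ^ n) / 2)\<close>, is dominated by a
    geometric series because \<open>n\<close> is less than \<open>2 ^ n\<close>.\<close>
  define a where "a = 1 / (4 * u)"
  have a: "a > 0" using u by (simp add: a_def)
  have au: "a * (2 ^ Suc n * u) = 2 ^ n / 2" for n using u by (simp add: a_def field_simps)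
  have pw: "ennreal (exp (a * norm x)) \<le> ennreal (exp (a * u)) +
      (\<Sum>n. ennreal (exp (2 ^ n / 2)) * indicator {x. norm x > 2 ^ n * u} x)" (is "?L \<le> ?C + suminf (?f x)") for x
  proof (cases "norm x \<le> u")
    case True
    then have "?L \<le> ?C" using a by (intro ennreal_leI) simp
    then show ?thesis by (simp add: add_increasing2)
  next
    case False
    obtain N where "norm x / u < 2 ^ N" using real_arch_pow[of 2 "norm x / u"] by auto
    then have N: "norm x \<le> 2 ^ N * u" using u by (simp add: field_simps)
    define k where "k = (LEAST k. norm x \<le> 2 ^ k * u)"
    have k: "norm x \<le> 2 ^ k * u" unfolding k_def by (rule LeastI[of _ N]) (rule N)
    have "k \<noteq> 0" using k False by (intro notI) simp
    then obtain m where m: "k = Suc m" by (cases k) auto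
    have "\<not> norm x \<le> 2 ^ m * u" using not_less_Least[of m "\<lambda>k. norm x \<le> 2 ^ k * u"] m k_def by auto
    then have "?f x m = ennreal (exp (2 ^ m / 2))" by simp
    moreover have "a * norm x \<le> a * (2 ^ Suc m * u)" using a k m by (intro mult_left_mono) auto
    then have "exp (a * norm x) \<le> exp (2 ^ m / 2)" unfolding au by simp
    ultimately have "?L \<le> ?f x m" by (simp add: ennreal_leI)
    also have "\<dots> \<le> suminf (?f x)" using sum_le_suminf[OF summableI, of "{m}" "?f x"] by (simp del: sum_mult_indicator)
    finally show ?thesis by (simp add: add_increasing)
  qed
  have "(\<integral>\<^sup>+x. ennreal (exp (a * norm x)) \<partial>\<gamma>) \<le> (\<integral>\<^sup>+x. ?C + suminf (?f x) \<partial>\<gamma>)"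
    by (intro nn_integral_mono pw)
  also have "\<dots> = ?C + (\<Sum>n. ennreal (exp (2 ^ n / 2)) * emeasure \<gamma> {x. norm x > 2 ^ n * u})"
    by (subst nn_integral_add) (auto simp: emeasure_space_1[simplified] nn_integral_suminf nn_integral_cmult_indicator)
  also have "\<dots> \<le> ?C + (\<Sum>n. ennreal (exp (-1/2) ^ n))"
  proof (intro add_mono order_refl suminf_le summableI)
    fix n
    have "prob {x. norm x > 2 ^ n * u} \<le> exp (- (2 ^ n))" using tail[of n] measure_nonneg[of \<gamma> "{x. norm x > 2 ^ n * u}"] by linarith
    then have "exp (2 ^ n / 2) * prob {x. norm x > 2 ^ n * u} \<le> exp (2 ^ n / 2) * exp (- (2 ^ n))" by simp
    also have "\<dots> = exp (- (2 ^ n) / 2)" by (simp add: exp_add[symmetric])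
    also have "\<dots> \<le> exp (real n * (-1/2))"
      using of_nat_less_two_power[of n, where ?'a=real] by simp
    also have "\<dots> = exp (-1/2) ^ n" by (rule exp_of_nat_mult)
    finally show "ennreal (exp (2 ^ n / 2)) * emeasure \<gamma> {x. norm x > 2 ^ n * u} \<le> ennreal (exp (-1/2) ^ n)"
      by (simp add: emeasure_eq_measure ennreal_mult[symmetric] ennreal_leI)
  qed
  also have "\<dots> < \<infinity>"
  proof -
    have "summable (\<lambda>n. exp (-1/2 :: real) ^ n)" by (rule summable_geometric) simp
    then have "(\<Sum>n. ennreal (exp (-1/2) ^ n)) = ennreal (\<Sum>n. exp (-1/2) ^ n)"
      by (intro suminf_ennreal2) auto
    then show ?thesis by simp
  qed
  finally have "integrable \<gamma> (\<lambda>x. exp (a * norm x))"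
    by (intro integrableI_bounded) auto
  with a show ?thesis by blast
qed

end

section \<open>Contraction for random maps\<close>

text \<open>Compare \<open>b\<close> with a small multiple \<kappa> of \<open>a\<close>: either the
  sum is at most \<open>(1 + \<kappa>) * a\<close>, or it is at most
  \<open>(1 / \<kappa> + 1) * b\<close>. What matters is a factor of \<open>a ^ m\<close>
  arbitrarily close to 1, since the drift estimate has only a small margin to spend.\<close>

lemma power_add_le_weighted:
  fixes \<tau> :: real and m :: nat
  assumes "\<tau> > 0"
  shows "\<exists>C\<ge>0. \<forall>a\<ge>0. \<forall>b\<ge>0. (a + b) ^ m \<le> (1 + \<tau>) * a ^ m + C * b ^ m"
proof -
  have "((\<lambda>\<kappa>. (1 + \<kappa>) ^ m) \<longlongrightarrow> (1 + 0) ^ m) (at_right (0::real))" by (intro tendsto_intros)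
  then have "\<forall>\<^sub>F \<kappa> in at_right (0::real). (1 + \<kappa>) ^ m < 1 + \<tau>" using assms by (intro order_tendstoD) auto
  then obtain \<kappa> :: real where k: "\<kappa> > 0" "(1 + \<kappa>) ^ m < 1 + \<tau>"
    unfolding eventually_at_right_field by (metis dense)
  have "(a + b) ^ m \<le> (1 + \<tau>) * a ^ m + (1 / \<kappa> + 1) ^ m * b ^ m" if ab: "a \<ge> 0" "b \<ge> 0" for a b :: real
  proof (cases "b \<le> \<kappa> * a")
    case True
    then have "(a + b) ^ m \<le> ((1 + \<kappa>) * a) ^ m" using ab by (intro power_mono) (auto simp: algebra_simps)
    also have "\<dots> \<le> (1 + \<tau>) * a ^ m" unfolding power_mult_distrib using k ab by (intro mult_right_mono) auto
    finally show ?thesis using ab k by (simp add: add_increasing2)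
  next
    case False
    then have "(a + b) ^ m \<le> ((1 / \<kappa> + 1) * b) ^ m" using ab k by (intro power_mono) (auto simp: field_simps)
    then show ?thesis using ab assms by (simp add: power_mult_distrib add_increasing)
  qed
  then show ?thesis using k by (intro exI[of _ "(1 / \<kappa> + 1) ^ m"]) auto
qed

lemma power_le_exp:
  fixes z a :: real
  assumes "z \<ge> 0" "a > 0"
  shows "z ^ m \<le> (real m / a) ^ m * exp (a * z)"
proof (cases "m = 0")
  case False
  have "a * z / real m \<le> 1 + a * z / real m" by simp
  then have "(a * z / real m) ^ m \<le> (1 + a * z / real m) ^ m" using assms by (intro power_mono) auto
  also have "\<dots> \<le> exp (a * z)"
    by (rule exp_ge_one_plus_x_over_n_power_n) (use False assms order_trans[of "- real m" 0 "a * z"] in auto)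
  finally show ?thesis using assms False by (simp add: power_mult_distrib power_divide field_simps)
qed (use assms in simp)

text \<open>This is Cauchy-Schwarz in terms of upper bounds \<open>a\<close> and \<open>b\<close>,
  obtained by averaging the arithmetic-geometric mean inequality for \<open>c * U\<close> and
  \<open>V / c\<close>. The choice \<open>c = sqrt (b / a)\<close> balances the two terms;
  \<open>c = 1\<close> gives integrability.\<close>

lemma (in prob_space) expectation_sqrt_mult_le:
  fixes U V :: "'a \<Rightarrow> real"
  assumes U: "integrable M U" "\<And>w. 0 \<le> U w" "expectation U \<le> a" "a > 0"
    and V: "integrable M V" "\<And>w. 0 \<le> V w" "expectation V \<le> b" "b > 0"
  shows "integrable M (\<lambda>w. sqrt (U w * V w))" "expectation (\<lambda>w. sqrt (U w * V w)) \<le> sqrt (a * b)"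
proof -
  have [measurable]: "U \<in> borel_measurable M" "V \<in> borel_measurable M" using U V by auto
  have le: "sqrt (U w * V w) \<le> (c * U w + V w / c) / 2" if "c > 0" for c w
    using arith_geo_mean_sqrt[of "c * U w" "V w / c"] that U(2)[of w] V(2)[of w] by simp
  show int: "integrable M (\<lambda>w. sqrt (U w * V w))"
    by (rule Bochner_Integration.integrable_bound[of _ "\<lambda>w. (1 * U w + V w / 1) / 2"])
      (use U V le[of 1] in \<open>auto simp: real_sqrt_mult\<close>)
  define c where "c = sqrt (b / a)"
  have c: "c > 0" using U(4) V(4) by (simp add: c_def)
  have "expectation (\<lambda>w. sqrt (U w * V w)) \<le> expectation (\<lambda>w. (c * U w + V w / c) / 2)"
    using U V by (intro integral_mono int le c) auto
  also have "\<dots> = (c * expectation U + expectation V / c) / 2" using U V by simp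
  also have "\<dots> \<le> (c * a + b / c) / 2" using U V c by (intro divide_right_mono add_mono mult_left_mono) auto
  also have "\<dots> = sqrt (a * b)"
  proof -
    have ab: "sqrt a * sqrt a = a" "sqrt b * sqrt b = b" "sqrt a > 0" "sqrt b > 0" using U(4) V(4) by auto
    have "c * a = sqrt a * sqrt b" unfolding c_def real_sqrt_divide using ab by (simp add: field_simps)
    moreover have "b / c = sqrt a * sqrt b" unfolding c_def real_sqrt_divide using ab by (simp add: field_simps)
    ultimately show ?thesis by (simp add: real_sqrt_mult)
  qed
  finally show "expectation (\<lambda>w. sqrt (U w * V w)) \<le> sqrt (a * b)" .
qed

text \<open>\<open>F x\<close> is one random transition from \<open>x\<close>. On the event \<open>B\<close> all transitions are simultaneously
  contracting; off \<open>B\<close>, two of them fail to be nonexpansive only with the probability of a mismatch.\<close>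

locale contracting_random_map = prob_space N for N :: "'w measure" +
  fixes F :: "'a::{real_normed_vector, second_countable_topology} \<Rightarrow> 'w \<Rightarrow> 'a"
    and Z :: "'w \<Rightarrow> real" and B :: "'w set" and \<rho> K\<^sub>B \<eta> C :: real
  assumes F_measurable [measurable]: "case_prod F \<in> borel \<Otimes>\<^sub>M N \<rightarrow>\<^sub>M borel"
    and Z_measurable [measurable]: "Z \<in> borel_measurable N" and Z_nonneg: "\<And>w. 0 \<le> Z w"
    and B_sets [measurable]: "B \<in> sets N" and B_pos: "prob B > 0"
    and rho: "0 < \<rho>" "\<rho> \<le> 1" and KB: "0 \<le> K\<^sub>B" and eta: "0 < \<eta>" and C: "0 \<le> C"
    and growth: "\<And>x w. norm (F x w) \<le> norm x + Z w"
    and growth_B: "\<And>x w. w \<in> B \<Longrightarrow> norm (F x w) \<le> (1 - \<rho>) * norm x + K\<^sub>B"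
    and contract_B: "\<And>x y w. w \<in> B \<Longrightarrow> norm (F x w - F y w) \<le> (1 - \<rho>) * norm (x - y)"
    and exp_Z: "integrable N (\<lambda>w. exp (\<eta> * Z w))"
    and exp_Z_le: "expectation (\<lambda>w. exp (\<eta> * Z w)) \<le> 1 + prob B * \<rho> / 8"
    and eta_KB: "(1 - \<rho>) * exp (\<eta> * K\<^sub>B) \<le> 1 - \<rho> / 2"
    and mismatch: "\<And>x y. prob {w \<in> space N. norm (F x w - F y w) > norm (x - y)}
      \<le> C * (exp (\<eta> * max (norm x) (norm y)) * norm (x - y))"
begin

lemma F_measurable' [measurable]: "F x \<in> N \<rightarrow>\<^sub>M borel"
  using measurable_Pair2[OF F_measurable, of x] by simp

definition wdist :: "'a \<Rightarrow> 'a \<Rightarrow> real" where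
  "wdist x y = exp (\<eta> * max (norm x) (norm y)) * norm (x - y)"

text \<open>The second entry makes the mismatch probability at most
  \<open>prob B * \<rho> / 8\<close> times \<open>\<Lambda> * wdist x y\<close>. The first makes
  \<open>\<phi>\<close> at least as large as the same function with rate 1, which is needed to
  dominate the metric of the theorem.\<close>

definition \<Lambda> :: real where "\<Lambda> = max 1 (8 * C / (prob B * \<rho>))"

definition \<phi> :: "'a \<Rightarrow> 'a \<Rightarrow> real" where "\<phi> x y = 1 - exp (- \<Lambda> * wdist x y)"

lemma Lambda: "\<Lambda> \<ge> 1" "C \<le> \<Lambda> * (prob B * \<rho> / 8)"
proof -
  show "\<Lambda> \<ge> 1" by (simp add: \<Lambda>_def)
  have "8 * C / (prob B * \<rho>) \<le> \<Lambda>" by (simp add: \<Lambda>_def)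
  then show "C \<le> \<Lambda> * (prob B * \<rho> / 8)" using B_pos rho by (simp add: field_simps)
qed

lemma wdist_nonneg: "wdist x y \<ge> 0" by (simp add: wdist_def)

lemma phi_bounds: "0 \<le> \<phi> x y" "\<phi> x y \<le> 1"
  using wdist_nonneg[of x y] Lambda(1) by (auto simp: \<phi>_def)

lemma phi_refl [simp]: "\<phi> x x = 0" by (simp add: \<phi>_def wdist_def)

lemma phi_pos: "x \<noteq> y \<Longrightarrow> \<phi> x y > 0"
  using Lambda(1) by (simp add: \<phi>_def wdist_def)

lemma phi_measurable [measurable]:
  assumes [measurable]: "f \<in> borel_measurable M'" "g \<in> borel_measurable M'"
  shows "(\<lambda>w. \<phi> (f w) (g w)) \<in> borel_measurable M'"
  unfolding \<phi>_def wdist_def by measurable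

text \<open>The gain on \<open>B\<close> is proportional to \<open>\<Lambda> * wdist x y\<close>, and so are both losses (exponential growth of
  the weight, mismatch). The choice of \<open>\<Lambda>\<close> and the smallness of \<open>\<eta>\<close> make each loss a quarter of the
  gain, uniformly in \<open>x\<close> and \<open>y\<close>.\<close>

lemma expectation_phi:
  "expectation (\<lambda>w. \<phi> (F x w) (F y w)) \<le>
     \<phi> x y - exp (- \<Lambda> * wdist x y) * (\<Lambda> * wdist x y) * (prob B * \<rho> / 4)"
proof -
  let ?t = "wdist x y" let ?A = "\<Lambda> * ?t"
  let ?D = "{w \<in> space N. norm (F x w - F y w) > norm (x - y)}"
  have A0: "?A \<ge> 0" using Lambda(1) wdist_nonneg[of x y] by simp
  \<comment> \<open>One bound linear in the quantities with known expectation serves three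
    situations. On \<open>B\<close> the weight grows by \<open>exp (\<eta> * K\<^sub>B)\<close>,
    which \<open>eta_KB\<close> absorbs, and the exponential of the gain is bounded below by its
    tangent. At a mismatch off \<open>B\<close> the bracket is at most 0. Otherwise only the weight
    grows, and the tangent bound is applied to that loss.\<close>
  have lower: "exp (- ?A) * (1 + (?A * \<rho> / 2) * indicator B w - ?A * (exp (\<eta> * Z w) - 1) - indicator ?D w)
      \<le> exp (- \<Lambda> * wdist (F x w) (F y w))" (is "exp (- ?A) * ?R w \<le> _") if w: "w \<in> space N" for w
  proof -
    have eZ: "exp (\<eta> * Z w) - 1 \<ge> 0" using Z_nonneg[of w] eta by simp
    then have AeZ: "?A * (exp (\<eta> * Z w) - 1) \<ge> 0" using A0 by simp
    consider "w \<in> B" | "w \<notin> B" "w \<in> ?D" | "w \<notin> B" "w \<notin> ?D" by blast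
    then show ?thesis
    proof cases
      case 1
      have "max (norm (F x w)) (norm (F y w)) \<le> max (norm x) (norm y) + K\<^sub>B"
        using growth_B[OF 1, of x] growth_B[OF 1, of y] mult_right_mono[of "1 - \<rho>" 1 "norm x"]
          mult_right_mono[of "1 - \<rho>" 1 "norm y"] rho by (auto simp: max_def)
      then have "exp (\<eta> * max (norm (F x w)) (norm (F y w))) \<le> exp (\<eta> * max (norm x) (norm y)) * exp (\<eta> * K\<^sub>B)"
        using eta by (simp add: exp_add[symmetric] distrib_left[symmetric])
      then have "wdist (F x w) (F y w) \<le> exp (\<eta> * max (norm x) (norm y)) * exp (\<eta> * K\<^sub>B) * ((1 - \<rho>) * norm (x - y))"
        unfolding wdist_def using contract_B[OF 1, of x y] by (intro mult_mono) auto
      also have "\<dots> = ((1 - \<rho>) * exp (\<eta> * K\<^sub>B)) * ?t" by (simp add: wdist_def)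
      also have "\<dots> \<le> (1 - \<rho> / 2) * ?t" using eta_KB wdist_nonneg[of x y] by (rule mult_right_mono)
      finally have "\<Lambda> * wdist (F x w) (F y w) \<le> \<Lambda> * ((1 - \<rho> / 2) * ?t)" using Lambda(1) by (intro mult_left_mono) auto
      also have "\<dots> = ?A - ?A * \<rho> / 2" by (simp add: algebra_simps)
      finally have "exp (- ?A) * exp (?A * \<rho> / 2) \<le> exp (- \<Lambda> * wdist (F x w) (F y w))"
        by (simp add: exp_add[symmetric])
      moreover have iB: "indicator B w = (1::real)" and iD: "indicator ?D w \<ge> (0::real)" using 1 by simp_all
      have "?R w \<le> 1 + ?A * \<rho> / 2" unfolding iB using AeZ iD by linarith
      then have "?R w \<le> exp (?A * \<rho> / 2)" using exp_ge_add_one_self[of "?A * \<rho> / 2"] by linarith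
      then have "exp (- ?A) * ?R w \<le> exp (- ?A) * exp (?A * \<rho> / 2)" by (intro mult_left_mono) auto
      ultimately show ?thesis by linarith
    next
      case 2
      then have iB: "indicator B w = (0::real)" and iD: "indicator ?D w = (1::real)" by simp_all
      have "?R w \<le> 0" unfolding iB iD using AeZ by linarith
      then have "exp (- ?A) * ?R w \<le> 0" by (simp add: mult_le_0_iff)
      then show ?thesis using exp_ge_zero[of "- \<Lambda> * wdist (F x w) (F y w)"] by linarith
    next
      case 3
      then have nD: "norm (F x w - F y w) \<le> norm (x - y)" using w by auto
      have "max (norm (F x w)) (norm (F y w)) \<le> max (norm x) (norm y) + Z w"
        using growth[of x w] growth[of y w] by (auto simp: max_def)
      then have "exp (\<eta> * max (norm (F x w)) (norm (F y w))) \<le> exp (\<eta> * max (norm x) (norm y)) * exp (\<eta> * Z w)"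
        using eta by (simp add: exp_add[symmetric] distrib_left[symmetric])
      then have "wdist (F x w) (F y w) \<le> exp (\<eta> * max (norm x) (norm y)) * exp (\<eta> * Z w) * norm (x - y)"
        unfolding wdist_def using nD by (intro mult_mono) auto
      then have "\<Lambda> * wdist (F x w) (F y w) \<le> \<Lambda> * (exp (\<eta> * Z w) * ?t)"
        using Lambda(1) by (intro mult_left_mono) (auto simp: wdist_def ac_simps)
      also have "\<dots> = ?A + ?A * (exp (\<eta> * Z w) - 1)" by (simp add: algebra_simps)
      finally have "exp (- ?A) * exp (- (?A * (exp (\<eta> * Z w) - 1))) \<le> exp (- \<Lambda> * wdist (F x w) (F y w))"
        by (simp add: exp_add[symmetric])
      moreover from 3 have iB: "indicator B w = (0::real)" and iD: "indicator ?D w = (0::real)" by simp_all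
      have "?R w = 1 - ?A * (exp (\<eta> * Z w) - 1)" unfolding iB iD by linarith
      then have "?R w \<le> exp (- (?A * (exp (\<eta> * Z w) - 1)))"
        using exp_ge_add_one_self[of "- (?A * (exp (\<eta> * Z w) - 1))"] by linarith
      then have "exp (- ?A) * ?R w \<le> exp (- ?A) * exp (- (?A * (exp (\<eta> * Z w) - 1)))" by (intro mult_left_mono) auto
      ultimately show ?thesis by linarith
    qed
  qed
  have D: "?D \<in> sets N" by measurable
  have iR: "integrable N ?R"
    using exp_Z D by (intro Bochner_Integration.integrable_add Bochner_Integration.integrable_diff
      integrable_mult_right integrable_const) (auto simp: emeasure_eq_measure)
  have iE: "integrable N (\<lambda>w. exp (- \<Lambda> * wdist (F x w) (F y w)))"
    by (rule integrable_const_bound[where B=1])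
      (use wdist_nonneg Lambda(1) in \<open>auto simp: wdist_def\<close>)
  have ER: "expectation ?R = 1 + ?A * \<rho> / 2 * prob B - ?A * (expectation (\<lambda>w. exp (\<eta> * Z w)) - 1) - prob ?D"
    using exp_Z D by (simp add: prob_space emeasure_eq_measure)
  have "?A * (expectation (\<lambda>w. exp (\<eta> * Z w)) - 1) \<le> ?A * (prob B * \<rho> / 8)"
    using A0 exp_Z_le by (intro mult_left_mono) auto
  moreover have "prob ?D \<le> ?A * (prob B * \<rho> / 8)"
  proof -
    have "prob ?D \<le> C * ?t" using mismatch[of x y] by (simp add: wdist_def)
    also have "\<dots> \<le> \<Lambda> * (prob B * \<rho> / 8) * ?t" using Lambda(2) wdist_nonneg[of x y] by (rule mult_right_mono)
    finally show ?thesis by (simp add: ac_simps)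
  qed
  ultimately have "1 + ?A * (prob B * \<rho> / 4) \<le> expectation ?R"
    unfolding ER by (simp add: field_simps)
  then have "exp (- ?A) * (1 + ?A * (prob B * \<rho> / 4)) \<le> exp (- ?A) * expectation ?R"
    by (intro mult_left_mono) auto
  also have "\<dots> = expectation (\<lambda>w. exp (- ?A) * ?R w)" by (rule integral_mult_right_zero[symmetric])
  also have "\<dots> \<le> expectation (\<lambda>w. exp (- \<Lambda> * wdist (F x w) (F y w)))"
    by (rule integral_mono_AE[OF integrable_mult_right[OF iR] iE]) (use lower in auto)
  finally have "1 - expectation (\<lambda>w. exp (- \<Lambda> * wdist (F x w) (F y w))) \<le>
     \<phi> x y - exp (- ?A) * ?A * (prob B * \<rho> / 4)"
    by (simp add: \<phi>_def algebra_simps)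
  moreover have "expectation (\<lambda>w. \<phi> (F x w) (F y w)) = 1 - expectation (\<lambda>w. exp (- \<Lambda> * wdist (F x w) (F y w)))"
    unfolding \<phi>_def using iE by (simp add: prob_space)
  ultimately show ?thesis by simp
qed

section \<open>The Lyapunov drift and the weighted semimetric\<close>

lemma integrable_Z_power: "integrable N (\<lambda>w. Z w ^ m)"
  by (rule Bochner_Integration.integrable_bound[OF integrable_mult_right[OF exp_Z, of "(real m / \<eta>) ^ m"]])
    (use power_le_exp[OF Z_nonneg eta] Z_nonneg eta in \<open>auto simp: abs_mult\<close>)

text \<open>On \<open>B\<close> the norm shrinks by the factor \<open>1 - \<rho>\<close> up to a
  constant, off \<open>B\<close> it grows by at most \<open>Z\<close>. Splitting the power of the
  sum costs the factor \<open>1 + \<tau>\<close>; with \<open>\<tau> = prob B * \<rho> / 2\<close>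
  this spends at most half of the gain, as
  \<open>(1 + \<tau>) * (1 - 2 * \<tau>) \<le> 1 - \<tau>\<close>.\<close>

lemma lyapunov:
  assumes m: "m \<ge> 1"
  shows "\<exists>\<alpha> K. 0 < \<alpha> \<and> \<alpha> < 1 \<and> 0 \<le> K \<and> (\<forall>x. integrable N (\<lambda>w. norm (F x w) ^ m) \<and>
    expectation (\<lambda>w. norm (F x w) ^ m) \<le> \<alpha> * norm x ^ m + K)"
proof -
  let ?q = "prob B"
  have q: "0 < ?q" "?q \<le> 1" "0 < ?q * \<rho>" "?q * \<rho> \<le> 1" using B_pos rho mult_le_one[of ?q \<rho>] by auto
  define \<tau> where "\<tau> = ?q * \<rho> / 2"
  have tau: "\<tau> > 0" using q by (simp add: \<tau>_def)
  obtain c where c: "c \<ge> 0" "\<And>a b. a \<ge> 0 \<Longrightarrow> b \<ge> 0 \<Longrightarrow> (a + b) ^ m \<le> (1 + \<tau>) * a ^ m + c * b ^ m"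
    using power_add_le_weighted[OF tau, of m] by blast
  define K where "K = c * (K\<^sub>B ^ m + expectation (\<lambda>w. Z w ^ m))"
  have "K \<ge> 0" unfolding K_def using c(1) KB Z_nonneg by (intro mult_nonneg_nonneg add_nonneg_nonneg integral_nonneg_AE) auto
  have pw: "norm (F x w) ^ m \<le> (1 + \<tau>) * norm x ^ m * (1 - \<rho> * indicator B w) + c * (K\<^sub>B ^ m + Z w ^ m)" (is "_ \<le> ?G x w") for x w
  proof (cases "w \<in> B")
    case True
    have "norm (F x w) ^ m \<le> ((1 - \<rho>) * norm x + K\<^sub>B) ^ m" using growth_B[OF True] by (intro power_mono) auto
    also have "\<dots> \<le> (1 + \<tau>) * ((1 - \<rho>) * norm x) ^ m + c * K\<^sub>B ^ m" using rho KB by (intro c) auto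
    also have "((1 - \<rho>) * norm x) ^ m \<le> (1 - \<rho>) * norm x ^ m"
      unfolding power_mult_distrib using rho m power_decreasing[of 1 m "1 - \<rho>"] by (intro mult_right_mono) auto
    finally have "norm (F x w) ^ m \<le> (1 + \<tau>) * ((1 - \<rho>) * norm x ^ m) + c * K\<^sub>B ^ m" using tau by (simp add: mult_left_mono)
    moreover have "c * Z w ^ m \<ge> 0" using c(1) Z_nonneg by simp
    ultimately show ?thesis using True by (simp add: algebra_simps)
  next
    case False
    have "norm (F x w) ^ m \<le> (norm x + Z w) ^ m" using growth by (intro power_mono) auto
    also have "\<dots> \<le> (1 + \<tau>) * norm x ^ m + c * Z w ^ m" using Z_nonneg by (intro c) auto
    moreover have "c * K\<^sub>B ^ m \<ge> 0" using c(1) KB by simp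
    ultimately show ?thesis using False by (simp add: algebra_simps)
  qed
  have iG: "integrable N (?G x)" for x
    using integrable_Z_power[of m] by (intro Bochner_Integration.integrable_add Bochner_Integration.integrable_diff
      integrable_mult_right integrable_const) (auto simp: emeasure_eq_measure)
  have iF: "integrable N (\<lambda>w. norm (F x w) ^ m)" for x
    by (rule integrable_le[OF iG[of x]]) (use pw in auto)
  have "expectation (\<lambda>w. norm (F x w) ^ m) \<le> (1 - ?q * \<rho> / 2) * norm x ^ m + K" for x
  proof -
    have "expectation (\<lambda>w. norm (F x w) ^ m) \<le> expectation (?G x)" by (intro integral_mono iF iG pw)
    also have "\<dots> = (1 + \<tau>) * norm x ^ m * (1 - \<rho> * ?q) + K"
      using integrable_Z_power[of m] by (simp add: prob_space K_def emeasure_eq_measure)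
    also have "(1 + \<tau>) * norm x ^ m * (1 - \<rho> * ?q) \<le> (1 - ?q * \<rho> / 2) * norm x ^ m"
    proof -
      have "(1 + \<tau>) * (1 - \<rho> * ?q) \<le> 1 - ?q * \<rho> / 2"
        using q mult_nonneg_nonneg[of "?q * \<rho>" "?q * \<rho>"] by (simp add: \<tau>_def algebra_simps)
      then have "(1 + \<tau>) * (1 - \<rho> * ?q) * norm x ^ m \<le> (1 - ?q * \<rho> / 2) * norm x ^ m" by (rule mult_right_mono) simp
      then show ?thesis by (simp add: ac_simps)
    qed
    finally show ?thesis by simp
  qed
  then show ?thesis using iF \<open>K \<ge> 0\<close> q by (intro exI[of _ "1 - ?q * \<rho> / 2"] exI[of _ K]) auto
qed

text \<open>All positive values of \<open>\<beta>\<close> give equivalent semimetrics, but the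
  contraction is proved for a particular small one.\<close>

definition wsemi :: "real \<Rightarrow> nat \<Rightarrow> 'a \<Rightarrow> 'a \<Rightarrow> real" where
  "wsemi \<beta> m x y = sqrt (\<phi> x y * (1 + \<beta> * (norm x ^ m + norm y ^ m)))"

text \<open>Far out the Lyapunov weight contracts and \<open>\<phi>\<close> does not grow; on bounded sets \<open>\<phi>\<close> contracts, and a small
  \<open>\<beta>\<close> keeps the growth of the weight below that gain. Cauchy-Schwarz combines the two factors.\<close>

lemma wsemi_contraction:
  assumes m: "m \<ge> 1"
  shows "\<exists>\<beta> \<theta>. 0 < \<beta> \<and> 0 \<le> \<theta> \<and> \<theta> < 1 \<and> (\<forall>x y. integrable N (\<lambda>w. wsemi \<beta> m (F x w) (F y w)) \<and>
    expectation (\<lambda>w. wsemi \<beta> m (F x w) (F y w)) \<le> \<theta> * wsemi \<beta> m x y)"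
proof -
  obtain \<alpha> K where lK: "0 < \<alpha>" "\<alpha> < 1" "0 \<le> K"
    and int: "\<And>x. integrable N (\<lambda>w. norm (F x w) ^ m)"
    and lyap: "\<And>x. expectation (\<lambda>w. norm (F x w) ^ m) \<le> \<alpha> * norm x ^ m + K"
    using lyapunov[OF m] by blast
  \<comment> \<open>Two copies contribute \<open>2 * K\<close> to the drift. As soon as the sum
    \<open>v\<close> of their norm powers reaches \<open>S\<close>, this is at most
    \<open>(1 - \<alpha>) / 2 * v\<close>, so the weight still contracts with the rate
    \<open>(1 + \<alpha>) / 2\<close>.\<close>
  define S where "S = 4 * K / (1 - \<alpha>) + 1"
  have S: "S \<ge> 1" "4 * K \<le> (1 - \<alpha>) * S" using lK 
  proof -
    have "(1 - \<alpha>) * S = 4 * K + (1 - \<alpha>)" using lK by (simp add: S_def distrib_left)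
    then show "S \<ge> 1" "4 * K \<le> (1 - \<alpha>) * S" using lK by (auto simp: S_def)
  qed
  \<comment> \<open>Where the norm powers add up to less than \<open>S\<close>, both norms are at
    most \<open>1 + S\<close>, so \<open>T\<close> bounds \<open>wdist\<close>. Since
    \<open>\<phi>\<close> is at most \<open>\<Lambda> * wdist\<close>, the gain in
    \<open>expectation_phi\<close> is there at least \<open>c * exp (- \<Lambda> * T)\<close> times
    \<open>\<phi>\<close>; hence the factor \<open>\<kappa>\<close> below.\<close>
  define T where "T = exp (\<eta> * (1 + S)) * (2 * (1 + S))"
  define c where "c = prob B * \<rho> / 4"
  have c: "0 < c" "c \<le> 1 / 4" using B_pos rho mult_le_one[of "prob B" \<rho>] by (auto simp: c_def)
  define \<kappa> where "\<kappa> = 1 - c * exp (- \<Lambda> * T)"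
  have T: "T \<ge> 0" using S by (simp add: T_def)
  have kap: "0 < \<kappa>" "\<kappa> < 1"
  proof -
    have "exp (- \<Lambda> * T) \<le> 1" using Lambda(1) T by simp
    then have "c * exp (- \<Lambda> * T) \<le> 1 / 4 * 1" using c by (intro mult_mono) auto
    then show "0 < \<kappa>" "\<kappa> < 1" using c by (simp_all add: \<kappa>_def)
  qed
  \<comment> \<open>With this \<open>\<beta>\<close> the weight grows on bounded sets at most by the
    factor \<open>2 - \<kappa>\<close>. Against the factor \<open>\<kappa>\<close> of
    \<open>\<phi>\<close> the product is \<open>1 - (1 - \<kappa>)\<^sup>2\<close>, still below
    1.\<close>
  define \<beta> where "\<beta> = (1 - \<kappa>) / (2 * K + 1)"
  have beta: "\<beta> > 0" "2 * \<beta> * K \<le> 1 - \<kappa>"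
    using kap lK by (auto simp: \<beta>_def field_simps)
  define \<theta>\<^sub>1 where "\<theta>\<^sub>1 = \<kappa> * (2 - \<kappa>)"
  have "\<theta>\<^sub>1 = 1 - (1 - \<kappa>)\<^sup>2" by (simp add: \<theta>\<^sub>1_def power2_eq_square algebra_simps)
  then have th1: "0 < \<theta>\<^sub>1" "\<theta>\<^sub>1 < 1" using kap zero_less_power2[of "1 - \<kappa>"] mult_pos_pos[of \<kappa> "2 - \<kappa>"]
    by (simp_all only: \<theta>\<^sub>1_def) simp_all
  \<comment> \<open>The ratio of the new weight to the old one decreases in \<open>v\<close>, so its
    worst value on \<open>v \<ge> S\<close> is the one at \<open>S\<close>.\<close>
  define \<theta>\<^sub>2 where "\<theta>\<^sub>2 = (1 + \<beta> * ((1 + \<alpha>) / 2 * S)) / (1 + \<beta> * S)"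
  have bS: "\<beta> * S > 0" using beta S by simp
  have th2: "0 < \<theta>\<^sub>2" "\<theta>\<^sub>2 < 1"
  proof -
    have "\<beta> * ((1 + \<alpha>) / 2 * S) = (1 + \<alpha>) / 2 * (\<beta> * S)" by simp
    moreover have "(1 + \<alpha>) / 2 * (\<beta> * S) < 1 * (\<beta> * S)" using lK bS by (intro mult_strict_right_mono) auto
    ultimately have "\<beta> * ((1 + \<alpha>) / 2 * S) < \<beta> * S" by linarith
    moreover have "0 \<le> \<beta> * ((1 + \<alpha>) / 2 * S)" using beta S lK by simp
    ultimately show "0 < \<theta>\<^sub>2" "\<theta>\<^sub>2 < 1" unfolding \<theta>\<^sub>2_def by (simp_all add: field_simps add_pos_nonneg)
  qed
  define \<theta> where "\<theta> = sqrt (max \<theta>\<^sub>1 \<theta>\<^sub>2)"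
  have th: "0 \<le> \<theta>" "\<theta> < 1" using th1 th2 by (auto simp: \<theta>_def)
  have main: "integrable N (\<lambda>w. wsemi \<beta> m (F x w) (F y w)) \<and>
      expectation (\<lambda>w. wsemi \<beta> m (F x w) (F y w)) \<le> \<theta> * wsemi \<beta> m x y" for x y
  proof (cases "x = y")
    case True
    then show ?thesis by (simp add: wsemi_def)
  next
    case False
    then have phi0: "\<phi> x y > 0" by (rule phi_pos)
    define v where "v = norm x ^ m + norm y ^ m"
    have v: "v \<ge> 0" by (simp add: v_def)
    define W where "W = 1 + \<beta> * v"
    have W: "W \<ge> 1" using beta v by (simp add: W_def)
    let ?U = "\<lambda>w. \<phi> (F x w) (F y w)"
    let ?V = "\<lambda>w. 1 + \<beta> * (norm (F x w) ^ m + norm (F y w) ^ m)"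
    have iU: "integrable N ?U"
      by (rule integrable_const_bound[where B=1]) (use phi_bounds in auto)
    have iV: "integrable N ?V" using int by auto
    have EV: "expectation ?V \<le> 1 + \<beta> * (\<alpha> * v + 2 * K)"
    proof -
      have "expectation ?V = 1 + \<beta> * (expectation (\<lambda>w. norm (F x w) ^ m) + expectation (\<lambda>w. norm (F y w) ^ m))"
        using int by (simp add: prob_space)
      also have "\<dots> \<le> 1 + \<beta> * (\<alpha> * v + 2 * K)"
        using lyap[of x] lyap[of y] beta by (intro add_left_mono mult_left_mono) (auto simp: v_def algebra_simps)
      finally show ?thesis .
    qed
    have EU: "expectation ?U \<le> \<phi> x y - exp (- \<Lambda> * wdist x y) * (\<Lambda> * wdist x y) * c"
      using expectation_phi[of x y] by (simp add: c_def)
    have "\<exists>a b. expectation ?U \<le> a \<and> expectation ?V \<le> b \<and> 0 < a \<and> 0 < b \<and> a * b \<le> max \<theta>\<^sub>1 \<theta>\<^sub>2 * (\<phi> x y * W)"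
    proof (cases "v \<ge> S")
      case True
      have "exp (- \<Lambda> * wdist x y) * (\<Lambda> * wdist x y) * c \<ge> 0" using Lambda(1) wdist_nonneg c by simp
      then have 1: "expectation ?U \<le> \<phi> x y" using EU by linarith
      have "(1 - \<alpha>) * S \<le> (1 - \<alpha>) * v" using True lK by (intro mult_left_mono) auto
      then have "\<alpha> * v + 2 * K \<le> (1 + \<alpha>) / 2 * v" using S(2) by (simp add: field_simps)
      then have "expectation ?V \<le> 1 + \<beta> * ((1 + \<alpha>) / 2 * v)"
        using EV beta by (smt (verit) mult_left_mono)
      also have "\<dots> \<le> \<theta>\<^sub>2 * W"
      proof -
        have "(1 - \<alpha>) * (\<beta> * S) \<le> (1 - \<alpha>) * (\<beta> * v)" using True lK beta by (intro mult_left_mono) auto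
        then have "(1 + \<beta> * ((1 + \<alpha>) / 2 * v)) * (1 + \<beta> * S) \<le> (1 + \<beta> * ((1 + \<alpha>) / 2 * S)) * W"
          unfolding W_def by (simp add: field_simps)
        then show ?thesis unfolding \<theta>\<^sub>2_def using bS by (simp add: pos_le_divide_eq)
      qed
      finally have 2: "expectation ?V \<le> \<theta>\<^sub>2 * W" .
      have "\<phi> x y * (\<theta>\<^sub>2 * W) = \<theta>\<^sub>2 * (\<phi> x y * W)" by simp
      also have "\<dots> \<le> max \<theta>\<^sub>1 \<theta>\<^sub>2 * (\<phi> x y * W)" using phi0 W by (intro mult_right_mono) auto
      finally show ?thesis using 1 2 phi0 th2 W by (intro exI[of _ "\<phi> x y"] exI[of _ "\<theta>\<^sub>2 * W"]) auto
    next
      case False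
      have nb: "norm z \<le> 1 + S" if "norm z ^ m \<le> S" for z :: 'a
      proof (rule ccontr)
        assume n: "\<not> norm z \<le> 1 + S"
        then have "norm z ^ 1 \<le> norm z ^ m" using S m by (intro power_increasing) auto
        then show False using that n by simp
      qed
      have nx: "norm x \<le> 1 + S" "norm y \<le> 1 + S"
      proof -
        have "0 \<le> norm x ^ m" "0 \<le> norm y ^ m" by auto
        then have "norm x ^ m \<le> S" "norm y ^ m \<le> S" using False unfolding v_def by linarith+
        then show "norm x \<le> 1 + S" "norm y \<le> 1 + S" by (auto intro: nb)
      qed
      have "wdist x y \<le> T" unfolding wdist_def T_def
        using nx eta norm_triangle_ineq4[of x y] by (intro mult_mono) auto
      then have "exp (- \<Lambda> * T) \<le> exp (- \<Lambda> * wdist x y)" using Lambda(1) by simp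
      moreover have "\<phi> x y \<le> \<Lambda> * wdist x y"
        using exp_ge_add_one_self[of "- \<Lambda> * wdist x y"] by (simp add: \<phi>_def)
      ultimately have "exp (- \<Lambda> * T) * \<phi> x y * c \<le> exp (- \<Lambda> * wdist x y) * (\<Lambda> * wdist x y) * c"
        using phi0 c by (intro mult_right_mono mult_mono) auto
      then have 1: "expectation ?U \<le> \<kappa> * \<phi> x y" using EU by (simp add: \<kappa>_def algebra_simps)
      have "\<alpha> * v \<le> v" using lK v mult_right_mono[of \<alpha> 1 v] by simp
      then have "\<beta> * (\<alpha> * v + 2 * K) \<le> \<beta> * (v + 2 * K)" using beta by (intro mult_left_mono) auto
      then have "expectation ?V \<le> W + 2 * \<beta> * K" using EV by (simp add: W_def algebra_simps)
      also have "2 * \<beta> * K \<le> (1 - \<kappa>) * W"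
      proof (rule order_trans[OF beta(2)])
        have "(1 - \<kappa>) * 1 \<le> (1 - \<kappa>) * W" using W kap by (intro mult_left_mono) auto
        then show "1 - \<kappa> \<le> (1 - \<kappa>) * W" by (simp only: mult_1_right)
      qed
      finally have 2: "expectation ?V \<le> (2 - \<kappa>) * W" by (simp add: algebra_simps)
      have "(\<kappa> * \<phi> x y) * ((2 - \<kappa>) * W) = \<theta>\<^sub>1 * (\<phi> x y * W)" by (simp add: \<theta>\<^sub>1_def)
      also have "\<dots> \<le> max \<theta>\<^sub>1 \<theta>\<^sub>2 * (\<phi> x y * W)" using phi0 W by (intro mult_right_mono) auto
      finally show ?thesis using 1 2 phi0 kap W by (intro exI[of _ "\<kappa> * \<phi> x y"] exI[of _ "(2 - \<kappa>) * W"]) auto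
    qed
    then obtain a b where ab: "expectation ?U \<le> a" "expectation ?V \<le> b" "0 < a" "0 < b"
      "a * b \<le> max \<theta>\<^sub>1 \<theta>\<^sub>2 * (\<phi> x y * W)" by blast
    have V0: "0 \<le> ?V w" for w using beta by simp
    note sq = expectation_sqrt_mult_le[OF iU phi_bounds(1) ab(1,3) iV V0 ab(2,4)]
    have "sqrt (a * b) \<le> sqrt (max \<theta>\<^sub>1 \<theta>\<^sub>2 * (\<phi> x y * W))" using ab by simp
    also have "\<dots> = \<theta> * wsemi \<beta> m x y" by (simp add: \<theta>_def wsemi_def W_def v_def real_sqrt_mult)
    finally show ?thesis using sq by (simp add: wsemi_def)
  qed
  with beta th show ?thesis by blast
qed

end

section \<open>The Poisson equation\<close>

context contracting_random_map
begin

text \<open>The constant 1 in place of \<open>\<beta>\<close> makes the class independent of the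
  contraction estimate. The constant \<open>L\<close> is a parameter because its geometric decay
  under iteration of \<open>step\<close> is what sums the Poisson series.\<close>

definition dlip :: "nat \<Rightarrow> real \<Rightarrow> ('a \<Rightarrow> real) \<Rightarrow> bool" where
  "dlip m L f \<longleftrightarrow> 0 \<le> L \<and> (\<forall>x y. \<bar>f x - f y\<bar> \<le> L * wsemi 1 m x y)"

definition step :: "('a \<Rightarrow> real) \<Rightarrow> 'a \<Rightarrow> real" where
  "step f x = expectation (\<lambda>w. f (F x w))"

lemma wsemi_nonneg: "0 \<le> \<beta> \<Longrightarrow> 0 \<le> wsemi \<beta> m x y"
  using phi_bounds[of x y] by (simp add: wsemi_def)

lemma wsemi_le_sqrt: "wsemi 1 m x y \<le> sqrt (1 + norm x ^ m + norm y ^ m)"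
  using phi_bounds[of x y] mult_right_mono[of "\<phi> x y" 1 "1 + norm x ^ m + norm y ^ m"]
  by (simp add: wsemi_def add.assoc)

lemma sqrt_le_self: "1 \<le> (a::real) \<Longrightarrow> sqrt a \<le> a"
  using real_sqrt_le_mono[of a "a * a"] by simp

lemma wsemi_le: "wsemi 1 m x y \<le> 1 + norm x ^ m + norm y ^ m"
  using wsemi_le_sqrt[of m x y] sqrt_le_self[of "1 + norm x ^ m + norm y ^ m"] by simp

lemma dlip_const: "dlip m 0 (\<lambda>_. c)" by (simp add: dlip_def)

lemma dlip_add: "dlip m L f \<Longrightarrow> dlip m L' g \<Longrightarrow> dlip m (L + L') (\<lambda>x. f x + g x)"
  unfolding dlip_def
proof (intro conjI allI)
  fix x y
  assume a: "0 \<le> L \<and> (\<forall>x y. \<bar>f x - f y\<bar> \<le> L * wsemi 1 m x y)"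
    "0 \<le> L' \<and> (\<forall>x y. \<bar>g x - g y\<bar> \<le> L' * wsemi 1 m x y)"
  have "\<bar>f x + g x - (f y + g y)\<bar> \<le> \<bar>f x - f y\<bar> + \<bar>g x - g y\<bar>" by linarith
  also have "\<dots> \<le> L * wsemi 1 m x y + L' * wsemi 1 m x y" using a by (intro add_mono) auto
  finally show "\<bar>f x + g x - (f y + g y)\<bar> \<le> (L + L') * wsemi 1 m x y" by (simp add: algebra_simps)
qed auto

lemma dlip_cmult: "dlip m L f \<Longrightarrow> dlip m (\<bar>c\<bar> * L) (\<lambda>x. c * f x)"
  unfolding dlip_def by (auto simp: right_diff_distrib[symmetric] abs_mult mult.assoc intro!: mult_left_mono)

lemma dlip_diff: "dlip m L f \<Longrightarrow> dlip m L' g \<Longrightarrow> dlip m (L + L') (\<lambda>x. f x - g x)"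
  using dlip_add[of m L f L' "\<lambda>x. - 1 * g x"] dlip_cmult[of m L' g "-1"] by simp

text \<open>The semimetric tends to 0 as its arguments merge. Through this lemma the iterates of
  \<open>step\<close> become measurable from their Lipschitz estimate alone.\<close>

lemma dlip_continuous:
  assumes "dlip m L f"
  shows "continuous_on UNIV f"
proof -
  have "isCont f x" for x
  proof -
    have "((\<lambda>y. L * wsemi 1 m y x) \<longlongrightarrow> L * wsemi 1 m x x) (at x)"
      unfolding wsemi_def \<phi>_def wdist_def
      by (intro tendsto_intros)
    then have "((\<lambda>y. L * wsemi 1 m y x) \<longlongrightarrow> 0) (at x)" by (simp add: wsemi_def)
    then have "((\<lambda>y. f y - f x) \<longlongrightarrow> 0) (at x)"
      by (rule Lim_null_comparison[rotated]) (use assms in \<open>auto simp: dlip_def\<close>)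
    then show ?thesis by (simp add: isCont_def Lim_null[symmetric])
  qed
  then show ?thesis by (simp add: continuous_at_imp_continuous_on)
qed

lemma dlip_measurable: "dlip m L f \<Longrightarrow> f \<in> borel_measurable borel"
  by (intro borel_measurable_continuous_onI dlip_continuous)

text \<open>Compare with the value at 0, where \<open>\<phi>\<close> is at most 1. The growth is of
  order \<open>m / 2\<close> because of the square root in the semimetric, so that a product of two
  such functions has order \<open>m\<close>.\<close>

lemma dlip_growth:
  assumes m: "m \<ge> 1" and f: "dlip m L f"
  shows "\<exists>c\<ge>0. \<forall>x. \<bar>f x\<bar> \<le> c * sqrt (1 + norm x ^ m)"
proof -
  have "\<bar>f x\<bar> \<le> (\<bar>f 0\<bar> + L) * sqrt (1 + norm x ^ m)" for x
  proof -
    have "wsemi 1 m x 0 \<le> sqrt (1 + norm x ^ m)" using wsemi_le_sqrt[of m x 0] m by (simp add: power_0_left)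
    then have "L * wsemi 1 m x 0 \<le> L * sqrt (1 + norm x ^ m)" using f by (intro mult_left_mono) (auto simp: dlip_def)
    moreover have "\<bar>f x - f 0\<bar> \<le> L * wsemi 1 m x 0" using f by (simp add: dlip_def)
    ultimately have "\<bar>f x\<bar> \<le> \<bar>f 0\<bar> * 1 + L * sqrt (1 + norm x ^ m)" by linarith
    also have "\<bar>f 0\<bar> * 1 \<le> \<bar>f 0\<bar> * sqrt (1 + norm x ^ m)" by (intro mult_left_mono) auto
    finally show ?thesis by (simp add: algebra_simps)
  qed
  then show ?thesis using f by (intro exI[of _ "\<bar>f 0\<bar> + L"]) (auto simp: dlip_def)
qed

lemma dlip_growth':
  assumes m: "m \<ge> 1" and f: "dlip m L f"
  shows "\<exists>c\<ge>0. \<forall>x. \<bar>f x\<bar> \<le> c * (1 + norm x ^ m)"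
proof -
  obtain c where c: "c \<ge> 0" "\<And>x. \<bar>f x\<bar> \<le> c * sqrt (1 + norm x ^ m)" using dlip_growth[OF assms] by blast
  have "\<bar>f x\<bar> \<le> c * (1 + norm x ^ m)" for x
    using c(2)[of x] mult_left_mono[OF sqrt_le_self[of "1 + norm x ^ m"] c(1)] by simp
  with c(1) show ?thesis by blast
qed

text \<open>By the product rule it is enough to absorb the growth of one factor into the semimetric.
  That growth is the square root of the weight \<open>W\<close>, and \<open>W\<^sup>2\<close> is at
  most four times the weight with exponent \<open>2 * m\<close>. Hence conditional variances stay
  within the Lipschitz classes.\<close>

lemma dlip_mult:
  assumes m: "m \<ge> 1" and f: "dlip m L f" and g: "dlip m L' g"
  shows "\<exists>K. dlip (2 * m) K (\<lambda>x. f x * g x)"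
proof -
  obtain c where c: "c \<ge> 0" "\<And>x. \<bar>f x\<bar> \<le> c * sqrt (1 + norm x ^ m)" using dlip_growth[OF m f] by blast
  obtain c' where c': "c' \<ge> 0" "\<And>x. \<bar>g x\<bar> \<le> c' * sqrt (1 + norm x ^ m)" using dlip_growth[OF m g] by blast
  define K where "K = (c * L' + c' * L) * 2"
  have L: "L \<ge> 0" "L' \<ge> 0" using f g by (auto simp: dlip_def)
  have "\<bar>f x * g x - f y * g y\<bar> \<le> K * wsemi 1 (2 * m) x y" for x y
  proof -
    define W where "W = 1 + norm x ^ m + norm y ^ m"
    have W: "sqrt W \<ge> 0" "sqrt (1 + norm x ^ m) \<le> sqrt W" "sqrt (1 + norm y ^ m) \<le> sqrt W" by (auto simp: W_def)
    have ws: "wsemi 1 m x y \<ge> 0" by (rule wsemi_nonneg) simp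
    have "\<bar>f x * g x - f y * g y\<bar> = \<bar>f x * (g x - g y) + g y * (f x - f y)\<bar>" by (simp add: algebra_simps)
    also have "\<dots> \<le> \<bar>f x\<bar> * \<bar>g x - g y\<bar> + \<bar>g y\<bar> * \<bar>f x - f y\<bar>"
      by (metis abs_mult abs_triangle_ineq)
    also have "\<dots> \<le> (c * sqrt W) * (L' * wsemi 1 m x y) + (c' * sqrt W) * (L * wsemi 1 m x y)"
    proof (intro add_mono mult_mono)
      show "\<bar>f x\<bar> \<le> c * sqrt W" "\<bar>g y\<bar> \<le> c' * sqrt W"
        using c(2)[of x] c'(2)[of y] mult_left_mono[OF W(2) c(1)] mult_left_mono[OF W(3) c'(1)] by linarith+
    qed (use f g c c' W in \<open>auto simp: dlip_def\<close>)
    also have "\<dots> = (c * L' + c' * L) * (sqrt W * wsemi 1 m x y)" by (simp add: algebra_simps)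
    also have "sqrt W * wsemi 1 m x y \<le> 2 * wsemi 1 (2 * m) x y"
    proof -
      have "W * W \<le> 4 * (1 + (norm x ^ (2 * m) + norm y ^ (2 * m)))"
      proof -
        have "(1 + a + b) * (1 + a + b) \<le> 4 * (1 + (a\<^sup>2 + b\<^sup>2))" for a b :: real
        proof -
          have "4 * (1 + (a\<^sup>2 + b\<^sup>2)) - (1 + a + b) * (1 + a + b) =
              (1 - a)\<^sup>2 + (1 - b)\<^sup>2 + (a - b)\<^sup>2 + a\<^sup>2 + b\<^sup>2 + 1" by algebra
          also have "\<dots> \<ge> 0" by simp
          finally show ?thesis by simp
        qed
        from this[of "norm x ^ m" "norm y ^ m"] show ?thesis by (simp add: W_def power_mult[symmetric] mult.commute)
      qed
      then have "\<phi> x y * (W * W) \<le> \<phi> x y * (4 * (1 + (norm x ^ (2 * m) + norm y ^ (2 * m))))"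
        using phi_bounds by (intro mult_left_mono)
      then have "sqrt (\<phi> x y * (W * W)) \<le> sqrt (\<phi> x y * (4 * (1 + (norm x ^ (2 * m) + norm y ^ (2 * m)))))"
        by (simp only: real_sqrt_le_iff)
      also have "\<dots> = 2 * wsemi 1 (2 * m) x y"
      proof -
        have "sqrt (4 * a) = 2 * sqrt a" for a by (simp add: real_sqrt_mult)
        then show ?thesis unfolding wsemi_def by (simp only: real_sqrt_mult[of "\<phi> x y"]) simp
      qed
      finally show ?thesis by (simp add: wsemi_def W_def real_sqrt_mult ac_simps)
    qed
    then have "(c * L' + c' * L) * (sqrt W * wsemi 1 m x y) \<le> (c * L' + c' * L) * (2 * wsemi 1 (2 * m) x y)"
      using c c' L by (intro mult_left_mono) auto
    finally show ?thesis unfolding K_def by (simp only: mult.assoc)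
  qed
  moreover have "K \<ge> 0" using c c' L by (simp add: K_def)
  ultimately show ?thesis by (auto simp: dlip_def)
qed

lemma integrable_norm_power_step:
  assumes m: "m \<ge> 1"
  shows "integrable N (\<lambda>w. norm (F x w) ^ m)"
  using lyapunov[OF m] by blast

lemma integrable_dlip_step:
  assumes m: "m \<ge> 1" and f: "dlip m L f"
  shows "integrable N (\<lambda>w. f (F x w))"
proof -
  obtain c where c: "c \<ge> 0" "\<And>x. \<bar>f x\<bar> \<le> c * (1 + norm x ^ m)" using dlip_growth'[OF m f] by blast
  have [measurable]: "f \<in> borel_measurable borel" using f by (rule dlip_measurable)
  have "integrable N (\<lambda>w. c * (1 + norm (F x w) ^ m))" using integrable_norm_power_step[OF m] by auto
  then show ?thesis
    by (rule integrable_le) (use c(2) in auto)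
qed

text \<open>The induction runs in the semimetric with the small \<open>\<beta>\<close>, where one
  application of \<open>step\<close> gains \<open>\<theta>\<close>. Passing to this semimetric and
  back happens once, at the two ends, so the comparison factors do not accumulate with
  \<open>k\<close>.\<close>

lemma step_iterate_dlip:
  assumes m: "m \<ge> 1"
  shows "\<exists>c \<theta>. 0 \<le> c \<and> 0 \<le> \<theta> \<and> \<theta> < 1 \<and>
    (\<forall>f L k. dlip m L f \<longrightarrow> dlip m (c * L * \<theta> ^ k) ((step ^^ k) f))"
proof -
  obtain \<beta> \<theta> where bt: "0 < \<beta>" "0 \<le> \<theta>" "\<theta> < 1"
    and int: "\<And>x y. integrable N (\<lambda>w. wsemi \<beta> m (F x w) (F y w))"
    and contr: "\<And>x y. expectation (\<lambda>w. wsemi \<beta> m (F x w) (F y w)) \<le> \<theta> * wsemi \<beta> m x y"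
    using wsemi_contraction[OF m] by blast
  have cmp: "wsemi a m x y \<le> sqrt (max 1 (a / b)) * wsemi b m x y" if ab: "a > 0" "b > 0" for a b x y
  proof -
    let ?v = "norm x ^ m + norm y ^ m"
    have "a * ?v = (a / b) * (b * ?v)" using ab by simp
    also have "\<dots> \<le> max 1 (a / b) * (b * ?v)" using ab by (intro mult_right_mono) auto
    finally have "1 + a * ?v \<le> max 1 (a / b) * (1 + b * ?v)" by (simp add: distrib_left add_mono)
    then have "\<phi> x y * (1 + a * ?v) \<le> \<phi> x y * (max 1 (a / b) * (1 + b * ?v))"
      using phi_bounds by (intro mult_left_mono)
    then have "sqrt (\<phi> x y * (1 + a * ?v)) \<le> sqrt (max 1 (a / b) * (\<phi> x y * (1 + b * ?v)))"
      by (simp add: ac_simps)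
    then show ?thesis unfolding wsemi_def by (simp only: real_sqrt_mult[of "max 1 (a / b)"])
  qed
  define c1 where "c1 = sqrt (max 1 (1 / \<beta>))"
  define c2 where "c2 = sqrt (max 1 (\<beta> / 1))"
  have c0: "c1 \<ge> 0" "c2 \<ge> 0" by (auto simp: c1_def c2_def)
  have "dlip m (c1 * c2 * L * \<theta> ^ k) ((step ^^ k) f)" if f: "dlip m L f" for f L k
  proof -
    have L: "L \<ge> 0" using f by (simp add: dlip_def)
    have dl: "dlip m (c1 * c2 * L * \<theta> ^ k) h" if h: "\<And>x y. \<bar>h x - h y\<bar> \<le> c1 * L * \<theta> ^ k * wsemi \<beta> m x y" for h k
    proof -
      have "\<bar>h x - h y\<bar> \<le> c1 * c2 * L * \<theta> ^ k * wsemi 1 m x y" for x y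
      proof -
        have "c1 * L * \<theta> ^ k * wsemi \<beta> m x y \<le> c1 * L * \<theta> ^ k * (c2 * wsemi 1 m x y)"
          using cmp[of \<beta> 1 x y] bt L c0 by (intro mult_left_mono) (auto simp: c2_def)
        with h[of x y] show ?thesis by (simp add: ac_simps)
      qed
      then show ?thesis using L bt c0 by (simp add: dlip_def)
    qed
    have "\<bar>(step ^^ k) f x - (step ^^ k) f y\<bar> \<le> c1 * L * \<theta> ^ k * wsemi \<beta> m x y" for x y
    proof (induction k arbitrary: x y)
      case 0
      have "\<bar>f x - f y\<bar> \<le> L * wsemi 1 m x y" using f by (simp add: dlip_def)
      also have "\<dots> \<le> L * (c1 * wsemi \<beta> m x y)"
        using cmp[of 1 \<beta> x y] bt L by (intro mult_left_mono) (auto simp: c1_def)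
      finally show ?case by (simp add: ac_simps)
    next
      case (Suc k)
      let ?h = "(step ^^ k) f"
      have i: "integrable N (\<lambda>w. ?h (F x w))" for x
        by (rule integrable_dlip_step[OF m dl[OF Suc.IH]])
      have "\<bar>step ?h x - step ?h y\<bar> = \<bar>expectation (\<lambda>w. ?h (F x w) - ?h (F y w))\<bar>"
        using i by (simp add: step_def[of ?h])
      also have "\<dots> \<le> expectation (\<lambda>w. \<bar>?h (F x w) - ?h (F y w)\<bar>)" by (rule integral_abs_bound)
      also have "\<dots> \<le> expectation (\<lambda>w. c1 * L * \<theta> ^ k * wsemi \<beta> m (F x w) (F y w))"
        using i int Suc.IH by (intro integral_mono) auto
      also have "\<dots> \<le> c1 * L * \<theta> ^ k * (\<theta> * wsemi \<beta> m x y)"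
        using contr[of x y] c0 L bt by (simp add: mult_left_mono)
      finally show ?case by (simp add: ac_simps)
    qed
    then show ?thesis by (rule dl)
  qed
  then show ?thesis using bt c0 by (intro exI[of _ "c1 * c2"] exI[of _ \<theta>]) auto
qed

lemma dlip_step:
  assumes m: "m \<ge> 1" and f: "dlip m L f"
  shows "\<exists>L'. dlip m L' (step f)"
proof -
  obtain c \<theta> where "\<And>k. dlip m (c * L * \<theta> ^ k) ((step ^^ k) f)"
    using step_iterate_dlip[OF m] f by meson
  from this[of 1] show ?thesis by auto
qed

end

section \<open>Moments of the invariant measure and the Poisson series\<close>

locale invariant_random_map = contracting_random_map N F Z B \<rho> K\<^sub>B \<eta> C
  for N :: "'w measure" and F :: "'a::{real_normed_vector, second_countable_topology} \<Rightarrow> 'w \<Rightarrow> 'a"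
    and Z B \<rho> K\<^sub>B \<eta> C +
  fixes \<mu> :: "'a measure"
  assumes mu_prob: "prob_space \<mu>" and sets_mu [simp, measurable_cong]: "sets \<mu> = sets borel"
    and invariant: "distr (\<mu> \<Otimes>\<^sub>M N) borel (case_prod F) = \<mu>"
begin

sublocale \<mu>: prob_space \<mu> by (rule mu_prob)
sublocale mu_N: pair_prob_space \<mu> N ..

lemma space_mu [simp]: "space \<mu> = UNIV"
  using sets_eq_imp_space_eq[OF sets_mu] by simp

lemma prob_mu_UNIV [simp]: "\<mu>.prob UNIV = 1"
  using \<mu>.prob_space by simp

lemma F_measurable_mu [measurable]: "case_prod F \<in> \<mu> \<Otimes>\<^sub>M N \<rightarrow>\<^sub>M borel"
  using F_measurable by (simp cong: measurable_cong_sets sets_pair_measure_cong)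

lemma integral_invariant:
  fixes f :: "'a \<Rightarrow> real"
  assumes f: "integrable \<mu> f"
  shows "integrable \<mu> (step f)" "(\<integral>x. step f x \<partial>\<mu>) = (\<integral>x. f x \<partial>\<mu>)"
proof -
  have [measurable]: "f \<in> borel_measurable borel" using f by (simp cong: measurable_cong_sets)
  have "integrable (distr (\<mu> \<Otimes>\<^sub>M N) borel (case_prod F)) f" using f by (simp add: invariant)
  then have i: "integrable (\<mu> \<Otimes>\<^sub>M N) (\<lambda>p. f (case_prod F p))"
    by (subst (asm) integrable_distr_eq) auto
  then show "integrable \<mu> (step f)"
    unfolding step_def using mu_N.integrable_fst'[OF i] by simp
  have "(\<integral>x. f x \<partial>\<mu>) = (\<integral>x. f x \<partial>distr (\<mu> \<Otimes>\<^sub>M N) borel (case_prod F))" by (simp only: invariant)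
  also have "\<dots> = (\<integral>p. f (case_prod F p) \<partial>(\<mu> \<Otimes>\<^sub>M N))" by (rule integral_distr) auto
  also have "\<dots> = (\<integral>x. step f x \<partial>\<mu>)"
    unfolding step_def using mu_N.integral_fst'[OF i] by simp
  finally show "(\<integral>x. step f x \<partial>\<mu>) = (\<integral>x. f x \<partial>\<mu>)" by simp
qed

text \<open>Invariance is only available for functions already known to be integrable, so it is applied to
  truncations of the Lyapunov function.\<close>

lemma mu_moment:
  assumes m: "m \<ge> 1"
  shows "integrable \<mu> (\<lambda>x. norm x ^ m)"
proof -
  obtain \<alpha> K where lK: "0 < \<alpha>" "\<alpha> < 1" "0 \<le> K"
    and int: "\<And>x. integrable N (\<lambda>w. norm (F x w) ^ m)"
    and lyap: "\<And>x. expectation (\<lambda>w. norm (F x w) ^ m) \<le> \<alpha> * norm x ^ m + K"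
    using lyapunov[OF m] by blast
  let ?V = "\<lambda>x :: 'a. norm x ^ m"
  let ?T = "\<lambda>n x. ?V x * indicator {x. ?V x \<le> real n} x"
  have iT: "integrable \<mu> (?T n)" for n
    by (rule \<mu>.integrable_const_bound[where B="real n"]) (auto simp: indicator_def)
  have bound: "(\<integral>x. ?T n x \<partial>\<mu>) \<le> K / (1 - \<alpha>)" for n
  proof -
    have i1: "integrable \<mu> (\<lambda>x. min (?V x) n)"
      by (rule \<mu>.integrable_const_bound[where B="real n"]) auto
    have i2: "integrable \<mu> (\<lambda>x. min (\<alpha> * ?V x + K) n)"
      by (rule \<mu>.integrable_const_bound[where B="real n"]) (use lK in auto)
    have "(\<integral>x. min (?V x) n \<partial>\<mu>) = (\<integral>x. step (\<lambda>x. min (?V x) n) x \<partial>\<mu>)"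
      using integral_invariant(2)[OF i1] by simp
    also have "\<dots> \<le> (\<integral>x. min (\<alpha> * ?V x + K) n \<partial>\<mu>)"
    proof (rule integral_mono[OF integral_invariant(1)[OF i1] i2])
      fix x
      have im: "integrable N (\<lambda>w. min (?V (F x w)) n)"
        by (rule integrable_const_bound[where B="real n"]) auto
      have "step (\<lambda>x. min (?V x) n) x \<le> expectation (\<lambda>w. ?V (F x w))"
        unfolding step_def by (rule integral_mono[OF im int]) simp
      moreover have "step (\<lambda>x. min (?V x) n) x \<le> expectation (\<lambda>w. real n)"
        unfolding step_def by (rule integral_mono[OF im]) auto
      ultimately show "step (\<lambda>x. min (?V x) n) x \<le> min (\<alpha> * ?V x + K) n"
        using lyap[of x] by (simp add: prob_space)
    qed
    finally have 1: "(\<integral>x. min (?V x) n \<partial>\<mu>) \<le> (\<integral>x. min (\<alpha> * ?V x + K) n \<partial>\<mu>)" .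
    \<comment> \<open>Invariance and drift compare the integral of \<open>min (?V x) n\<close> with
      that of \<open>min (\<alpha> * ?V x + K) n\<close>. Both are finite, so they can be cancelled,
      and what is left bounds the truncated moment independently of \<open>n\<close>. The pointwise
      inequality is checked separately for \<open>?V x\<close> up to \<open>n\<close> and
      above.\<close>
    have "(\<integral>x. (1 - \<alpha>) * ?T n x + min (\<alpha> * ?V x + K) n \<partial>\<mu>) \<le> (\<integral>x. min (?V x) n + K \<partial>\<mu>)"
      using i1 i2 iT lK by (intro integral_mono) (auto simp: indicator_def algebra_simps min_def)
    then have "(1 - \<alpha>) * (\<integral>x. ?T n x \<partial>\<mu>) \<le> K" using 1 i1 i2 iT by (simp add: \<mu>.prob_space)
    then show ?thesis using lK by (simp add: field_simps)
  qed
  have "(\<integral>\<^sup>+x. ennreal (?V x) \<partial>\<mu>) \<le> (\<integral>\<^sup>+x. (SUP n. ennreal (?T n x)) \<partial>\<mu>)"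
  proof (rule nn_integral_mono)
    fix x
    obtain n where "?V x \<le> real n" using real_arch_simple by blast
    then have eq: "?V x = ?T n x" by simp
    show "ennreal (?V x) \<le> (SUP n. ennreal (?T n x))"
      by (subst eq) (rule SUP_upper, rule UNIV_I)
  qed
  also have "\<dots> = (SUP n. \<integral>\<^sup>+x. ennreal (?T n x) \<partial>\<mu>)"
  proof (rule nn_integral_monotone_convergence_SUP)
    show "incseq (\<lambda>n x. ennreal (?T n x))"
    proof (intro incseq_SucI le_funI ennreal_leI mult_left_mono)
      show "indicator {x. ?V x \<le> real n} x \<le> (indicator {x. ?V x \<le> real (Suc n)} x :: real)" for n and x :: 'a
        by (simp add: indicator_def)
    qed simp
    show "(\<lambda>x. ennreal (?T n x)) \<in> borel_measurable \<mu>" for n by measurable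
  qed
  also have "\<dots> \<le> ennreal (K / (1 - \<alpha>))"
  proof (rule SUP_least)
    fix n
    have eq: "(\<integral>\<^sup>+x. ennreal (?T n x) \<partial>\<mu>) = ennreal (\<integral>x. ?T n x \<partial>\<mu>)"
      by (rule nn_integral_eq_integral[OF iT]) simp
    show "(\<integral>\<^sup>+x. ennreal (?T n x) \<partial>\<mu>) \<le> ennreal (K / (1 - \<alpha>))"
      unfolding eq by (rule ennreal_leI[OF bound])
  qed
  also have "\<dots> < \<infinity>" by simp
  finally show ?thesis by (intro integrableI_bounded) auto
qed

lemma integrable_dlip_mu:
  assumes m: "m \<ge> 1" and f: "dlip m L f"
  shows "integrable \<mu> f"
proof -
  obtain c where c: "c \<ge> 0" "\<And>x. \<bar>f x\<bar> \<le> c * (1 + norm x ^ m)" using dlip_growth'[OF m f] by blast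
  have [measurable]: "f \<in> borel_measurable borel" using f by (rule dlip_measurable)
  have "integrable \<mu> (\<lambda>x. c * (1 + norm x ^ m))" using mu_moment[OF m] by auto
  then show ?thesis
    by (rule integrable_le) (use c(2) in auto)
qed

text \<open>The solution is the series of the iterates of \<open>f\<close>, which converges geometrically.\<close>

lemma poisson_equation:
  assumes m: "m \<ge> 1" and f: "dlip m L f" and mean: "(\<integral>x. f x \<partial>\<mu>) = 0"
  shows "\<exists>g L'. dlip m L' g \<and> (\<forall>x. g x - step g x = f x)"
proof -
  obtain c \<theta> where c: "0 \<le> c" "0 \<le> \<theta>" "\<theta> < 1"
    and dl: "\<And>k. dlip m (c * L * \<theta> ^ k) ((step ^^ k) f)"
    using step_iterate_dlip[OF m] f by meson
  have L: "L \<ge> 0" using f by (simp add: dlip_def)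
  let ?f = "\<lambda>k. (step ^^ k) f"
  have mean_k: "(\<integral>x. ?f k x \<partial>\<mu>) = 0" for k
  proof (induction k)
    case (Suc k)
    then show ?case using integral_invariant(2)[OF integrable_dlip_mu[OF m dl[of k]]] by simp
  qed (use mean in simp)
  define E where "E = (\<integral>y. norm y ^ m \<partial>\<mu>)"
  have E: "E \<ge> 0" unfolding E_def by simp
  define K where "K = c * L * (1 + E)"
  have K: "K \<ge> 0" using c L E by (simp add: K_def)
  \<comment> \<open>A function with mean 0 equals the average of its differences
    \<open>?f k x - ?f k y\<close> over the invariant measure. The decay of the Lipschitz constant
    thus becomes decay of the values.\<close>
  have bound: "\<bar>?f k x\<bar> \<le> K * \<theta> ^ k * (1 + norm x ^ m)" for k x
  proof -
    have ik: "integrable \<mu> (?f k)" by (rule integrable_dlip_mu[OF m dl])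
    have i: "integrable \<mu> (\<lambda>y. 1 + norm x ^ m + norm y ^ m)" using mu_moment[OF m] by auto
    have "?f k x = (\<integral>y. ?f k x - ?f k y \<partial>\<mu>)" using ik mean_k by (simp add: \<mu>.prob_space)
    then have "\<bar>?f k x\<bar> \<le> (\<integral>y. \<bar>?f k x - ?f k y\<bar> \<partial>\<mu>)" using integral_abs_bound[of \<mu> "\<lambda>y. ?f k x - ?f k y"] by simp
    also have "\<dots> \<le> (\<integral>y. c * L * \<theta> ^ k * (1 + norm x ^ m + norm y ^ m) \<partial>\<mu>)"
    proof (rule integral_mono)
      fix y
      have "\<bar>?f k x - ?f k y\<bar> \<le> c * L * \<theta> ^ k * wsemi 1 m x y" using dl[of k] by (simp add: dlip_def)
      also have "\<dots> \<le> c * L * \<theta> ^ k * (1 + norm x ^ m + norm y ^ m)"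
        using wsemi_le c L by (intro mult_left_mono) auto
      finally show "\<bar>?f k x - ?f k y\<bar> \<le> c * L * \<theta> ^ k * (1 + norm x ^ m + norm y ^ m)" .
    qed (use ik i in auto)
    also have "\<dots> = c * L * \<theta> ^ k * (1 + norm x ^ m + E)"
      using mu_moment[OF m] by (simp add: E_def \<mu>.prob_space)
    also have "\<dots> \<le> c * L * \<theta> ^ k * ((1 + E) * (1 + norm x ^ m))"
      using c L E by (intro mult_left_mono) (auto simp: algebra_simps)
    finally show ?thesis by (simp add: K_def ac_simps)
  qed
  have geo: "summable (\<lambda>k. \<theta> ^ k)" using c by (intro summable_geometric) auto
  have sumf: "summable (\<lambda>k. \<bar>?f k x\<bar>)" for x
  proof (rule summable_comparison_test')
    show "summable (\<lambda>k. K * \<theta> ^ k * (1 + norm x ^ m))" using geo by (intro summable_mult2 summable_mult)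
    show "norm \<bar>?f k x\<bar> \<le> K * \<theta> ^ k * (1 + norm x ^ m)" for k using bound by simp
  qed
  have sumf': "summable (\<lambda>k. ?f k x)" for x using sumf by (rule summable_rabs_cancel)
  define g where "g x = (\<Sum>k. ?f k x)" for x
  have "\<bar>g x - g y\<bar> \<le> c * L / (1 - \<theta>) * wsemi 1 m x y" for x y
  proof -
    have s: "summable (\<lambda>k. c * L * \<theta> ^ k * wsemi 1 m x y)" using geo by (intro summable_mult2 summable_mult)
    have le: "\<bar>?f k x - ?f k y\<bar> \<le> c * L * \<theta> ^ k * wsemi 1 m x y" for k using dl[of k] by (simp add: dlip_def)
    have sd: "summable (\<lambda>k. \<bar>?f k x - ?f k y\<bar>)"
      by (rule summable_comparison_test'[OF s]) (use le in auto)
    have "g x - g y = (\<Sum>k. ?f k x - ?f k y)" unfolding g_def by (rule suminf_diff[OF sumf' sumf'])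
    then have "\<bar>g x - g y\<bar> \<le> (\<Sum>k. \<bar>?f k x - ?f k y\<bar>)" using summable_rabs[OF sd] by simp
    also have "\<dots> \<le> (\<Sum>k. c * L * \<theta> ^ k * wsemi 1 m x y)" by (rule suminf_le[OF le sd s])
    also have "\<dots> = c * L * (\<Sum>k. \<theta> ^ k) * wsemi 1 m x y"
      using geo by (simp add: suminf_mult suminf_mult2[symmetric] summable_mult)
    also have "(\<Sum>k. \<theta> ^ k) = 1 / (1 - \<theta>)" using c by (intro suminf_geometric) auto
    finally show ?thesis by simp
  qed
  then have g: "dlip m (c * L / (1 - \<theta>)) g" using c L by (auto simp: dlip_def)
  \<comment> \<open>Applying \<open>step\<close> to the series shifts it by one term, so only the
    term with index 0 survives in the difference. The geometric bound permits the exchange of sum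
    and expectation.\<close>
  have "g x - step g x = f x" for x
  proof -
    have i: "integrable N (\<lambda>w. ?f k (F x w))" for k by (rule integrable_dlip_step[OF m dl])
    have V: "integrable N (\<lambda>w. norm (F x w) ^ m)" by (rule integrable_norm_power_step[OF m])
    have "step g x = expectation (\<lambda>w. \<Sum>k. ?f k (F x w))" by (simp add: step_def[of g] g_def)
    also have "\<dots> = (\<Sum>k. expectation (\<lambda>w. ?f k (F x w)))"
    proof (rule integral_suminf[OF i])
      show "AE w in N. summable (\<lambda>k. norm (?f k (F x w)))" using sumf by simp
      show "summable (\<lambda>k. expectation (\<lambda>w. norm (?f k (F x w))))"
      proof (rule summable_comparison_test')
        show "summable (\<lambda>k. K * \<theta> ^ k * (1 + expectation (\<lambda>w. norm (F x w) ^ m)))" using geo by (intro summable_mult2 summable_mult)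
        fix k
        have "expectation (\<lambda>w. norm (?f k (F x w))) \<le> expectation (\<lambda>w. K * \<theta> ^ k * (1 + norm (F x w) ^ m))"
          using i V bound by (intro integral_mono) auto
        then show "norm (expectation (\<lambda>w. norm (?f k (F x w)))) \<le> K * \<theta> ^ k * (1 + expectation (\<lambda>w. norm (F x w) ^ m))"
          using V by (simp add: prob_space)
      qed
    qed
    also have "\<dots> = (\<Sum>k. ?f (Suc k) x)" by (simp add: step_def)
    also have "\<dots> = g x - f x" unfolding g_def using suminf_split_head[OF sumf', of x] by simp
    finally show ?thesis by simp
  qed
  with g show ?thesis by blast
qed

end

section \<open>Markov chains driven by a random map\<close>

lemma subalgebra_history_algebra:
  assumes "\<And>n. X n \<in> borel_measurable \<Omega>"
  shows "subalgebra \<Omega> (history_algebra \<Omega> X n)"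
proof -
  let ?f = "\<lambda>w. \<lambda>j\<in>{..n}. X j w"
  have f: "?f \<in> \<Omega> \<rightarrow>\<^sub>M (\<Pi>\<^sub>M j\<in>{..n}. borel)"
    by (rule measurable_restrict) (use assms in auto)
  have "sets (history_algebra \<Omega> X n) = {?f -` A \<inter> space \<Omega> | A. A \<in> sets (\<Pi>\<^sub>M j\<in>{..n}. borel)}"
    unfolding history_algebra_def by (rule sets_vimage_algebra2) (use measurable_space[OF f] in auto)
  then show ?thesis using measurable_sets[OF f] by (auto simp: subalgebra_def history_algebra_def)
qed

lemma measurable_history_algebra:
  assumes "j \<le> n"
  shows "X j \<in> borel_measurable (history_algebra \<Omega> X n)"
proof -
  let ?f = "\<lambda>w. \<lambda>j\<in>{..n}. X j w"
  have "?f \<in> history_algebra \<Omega> X n \<rightarrow>\<^sub>M (\<Pi>\<^sub>M j\<in>{..n}. borel)"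
    unfolding history_algebra_def by (rule measurable_vimage_algebra1) (auto simp: space_PiM)
  from measurable_compose[OF this measurable_component_singleton[of j]] assms
  show ?thesis by simp
qed

locale random_map_chain = invariant_random_map N F Z B \<rho> K\<^sub>B \<eta> C \<mu>
  for N :: "'w measure" and F :: "'a::{real_normed_vector, second_countable_topology} \<Rightarrow> 'w \<Rightarrow> 'a"
    and Z B \<rho> K\<^sub>B \<eta> C \<mu> +
  fixes \<Omega> :: "'p measure" and X :: "nat \<Rightarrow> 'p \<Rightarrow> 'a" and x0 :: 'a
  assumes chain: "markov_chain \<Omega> (\<lambda>x. distr N borel (F x)) x0 X"
begin

lemma prob_space_chain: "prob_space \<Omega>"
  and X_measurable [measurable]: "X n \<in> borel_measurable \<Omega>"
  and X_start: "AE w in \<Omega>. X 0 w = x0"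
  and X_transition: "A \<in> sets borel \<Longrightarrow> AE w in \<Omega>.
        real_cond_exp \<Omega> (history_algebra \<Omega> X n) (indicator (X (Suc n) -` A \<inter> space \<Omega>)) w
          = measure (distr N borel (F (X n w))) A"
  using chain by (auto simp: markov_chain_def)

sublocale \<Omega>: prob_space \<Omega> by (rule prob_space_chain)
sublocale \<Omega>N: pair_prob_space \<Omega> N ..

abbreviation "Hist \<equiv> history_algebra \<Omega> X"
abbreviation "E \<equiv> integral\<^sup>L \<Omega>"

lemma subalgebra_Hist: "subalgebra \<Omega> (Hist n)"
  by (rule subalgebra_history_algebra) (rule X_measurable)

lemma sigma_finite_Hist: "sigma_finite_subalgebra \<Omega> (Hist n)"
proof -
  interpret finite_measure_subalgebra \<Omega> "Hist n"
    using subalgebra_Hist by unfold_locales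
  show ?thesis by (rule sigma_finite_subalgebra_axioms)
qed

lemma sets_Hist: "A \<in> sets (Hist n) \<Longrightarrow> A \<in> sets \<Omega>"
  using subalgebra_Hist by (auto simp: subalgebra_def)

lemma F_X_measurable [measurable]: "(\<lambda>p. F (X n (fst p)) (snd p)) \<in> \<Omega> \<Otimes>\<^sub>M N \<rightarrow>\<^sub>M borel"
proof -
  have "(\<lambda>p. (X n (fst p), snd p)) \<in> \<Omega> \<Otimes>\<^sub>M N \<rightarrow>\<^sub>M borel \<Otimes>\<^sub>M N" by measurable
  from measurable_compose[OF this F_measurable] show ?thesis by simp
qed

text \<open>The chain is given by its conditional laws, not as \<open>X (Suc n) = F (X n) v\<close>
  with independent noise \<open>v\<close>, and these laws are given event by event up to null sets.
  Integrated over a past event \<open>A\<close> they become one equality of finite measures, after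
  which Borel functions and Fubini's theorem are available for a transition.\<close>

lemma transition_law:
  assumes A: "A \<in> sets (Hist n)"
  shows "distr (density \<Omega> (indicator A)) borel (X (Suc n)) =
    distr (density \<Omega> (indicator A) \<Otimes>\<^sub>M N) borel (\<lambda>p. F (X n (fst p)) (snd p))"
proof (rule measure_eqI)
  fix S assume "S \<in> sets (distr (density \<Omega> (indicator A)) borel (X (Suc n)))"
  then have S [measurable]: "S \<in> sets borel" by simp
  interpret H: sigma_finite_subalgebra \<Omega> "Hist n" by (rule sigma_finite_Hist)
  have [measurable]: "A \<in> sets \<Omega>" by (rule sets_Hist[OF A])
  let ?D = "density \<Omega> (indicator A)"
  let ?XS = "X (Suc n) -` S \<inter> space \<Omega>"
  have XS [measurable]: "?XS \<in> sets \<Omega>" by measurable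
  have FX: "(\<lambda>p. F (X n (fst p)) (snd p)) \<in> ?D \<Otimes>\<^sub>M N \<rightarrow>\<^sub>M borel"
    using F_X_measurable by (simp cong: measurable_cong_sets sets_pair_measure_cong)
  have mN: "measure (distr N borel (F x)) S = prob (F x -` S \<inter> space N)" for x
    by (rule measure_distr) auto
  have m1: "(\<lambda>w. prob (F (X n w) -` S \<inter> space N)) \<in> borel_measurable \<Omega>"
  proof -
    have "(\<lambda>w. expectation (\<lambda>v. indicator S (F (X n (fst (w, v))) (snd (w, v))) :: real)) \<in> borel_measurable \<Omega>"
      by (intro borel_measurable_lebesgue_integral) (simp add: case_prod_beta)
    also have "(\<lambda>w. expectation (\<lambda>v. indicator S (F (X n (fst (w, v))) (snd (w, v))) :: real)) =
        (\<lambda>w. prob (F (X n w) -` S \<inter> space N))"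
    proof
      fix w
      have "expectation (\<lambda>v. indicator S (F (X n w) v) :: real) = expectation (indicator (F (X n w) -` S \<inter> space N))"
        by (rule Bochner_Integration.integral_cong) (auto simp: indicator_def)
      then show "expectation (\<lambda>v. indicator S (F (X n (fst (w, v))) (snd (w, v))) :: real) = prob (F (X n w) -` S \<inter> space N)"
        by simp
    qed
    finally show ?thesis .
  qed
  have "emeasure (distr ?D borel (X (Suc n))) S = emeasure ?D ?XS"
    by (subst emeasure_distr) auto
  also have "\<dots> = emeasure \<Omega> (A \<inter> ?XS)"
    by (subst emeasure_density) (auto simp: nn_integral_indicator[symmetric] indicator_inter_arith simp del: nn_integral_indicator intro!: nn_integral_cong)
  also have "\<dots> = ennreal (\<integral>w\<in>A. indicator ?XS w \<partial>\<Omega>)"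
    by (simp add: set_lebesgue_integral_def \<Omega>.emeasure_eq_measure indicator_inter_arith[symmetric])
  also have "(\<integral>w\<in>A. indicator ?XS w \<partial>\<Omega>) = (\<integral>w\<in>A. real_cond_exp \<Omega> (Hist n) (indicator ?XS) w \<partial>\<Omega>)"
    by (rule H.real_cond_exp_intA) (use A in \<open>auto simp: \<Omega>.emeasure_eq_measure\<close>)
  also have "\<dots> = E (\<lambda>w. indicator A w * prob (F (X n w) -` S \<inter> space N))"
    unfolding set_lebesgue_integral_def
    using X_transition[OF S, of n] m1 by (intro integral_cong_AE) (auto simp: mN)
  also have "ennreal \<dots> = (\<integral>\<^sup>+w. ennreal (indicator A w * prob (F (X n w) -` S \<inter> space N)) \<partial>\<Omega>)"
    using m1 by (intro nn_integral_eq_integral[symmetric] \<Omega>.integrable_const_bound[where B=1])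
      (auto simp: indicator_def)
  also have "\<dots> = (\<integral>\<^sup>+w. indicator A w * emeasure N (F (X n w) -` S \<inter> space N) \<partial>\<Omega>)"
    by (intro nn_integral_cong) (auto simp: indicator_def emeasure_eq_measure)
  also have "\<dots> = (\<integral>\<^sup>+w. emeasure N (F (X n w) -` S \<inter> space N) \<partial>?D)"
    using m1 by (subst nn_integral_density) (auto simp: emeasure_eq_measure)
  also have "\<dots> = (\<integral>\<^sup>+w. (\<integral>\<^sup>+v. indicator S (F (X n (fst (w, v))) (snd (w, v))) \<partial>N) \<partial>?D)"
    by (intro nn_integral_cong)
      (auto simp: nn_integral_indicator[symmetric] indicator_def simp del: nn_integral_indicator intro!: nn_integral_cong)
  also have "\<dots> = (\<integral>\<^sup>+p. indicator S (F (X n (fst p)) (snd p)) \<partial>(?D \<Otimes>\<^sub>M N))"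
    by (rule nn_integral_fst) (use measurable_compose[OF FX borel_measurable_indicator[OF S]] in simp)
  also have "\<dots> = (\<integral>\<^sup>+x. indicator S x \<partial>distr (?D \<Otimes>\<^sub>M N) borel (\<lambda>p. F (X n (fst p)) (snd p)))"
    by (rule nn_integral_distr[symmetric, OF FX]) auto
  also have "\<dots> = emeasure (distr (?D \<Otimes>\<^sub>M N) borel (\<lambda>p. F (X n (fst p)) (snd p))) S"
    by simp
  finally show "emeasure (distr ?D borel (X (Suc n))) S =
    emeasure (distr (?D \<Otimes>\<^sub>M N) borel (\<lambda>p. F (X n (fst p)) (snd p))) S" .
qed simp

lemma step_measurable [measurable]:
  assumes [measurable]: "f \<in> borel_measurable borel"
  shows "step f \<in> borel_measurable borel"
proof -
  have "(\<lambda>x. expectation (\<lambda>v. f (F x v))) \<in> borel_measurable borel"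
    by (intro borel_measurable_lebesgue_integral) (simp add: case_prod_beta')
  then show ?thesis by (simp add: step_def[abs_def])
qed

lemma integral_transition:
  fixes f :: "'a \<Rightarrow> real"
  assumes [measurable]: "f \<in> borel_measurable borel" and i: "integrable \<Omega> (\<lambda>w. f (X (Suc n) w))"
    and A: "A \<in> sets (Hist n)"
  shows "integrable \<Omega> (\<lambda>w. indicator A w * step f (X n w))"
    "(\<integral>w\<in>A. f (X (Suc n) w) \<partial>\<Omega>) = (\<integral>w\<in>A. step f (X n w) \<partial>\<Omega>)"
proof -
  let ?D = "density \<Omega> (indicator A)"
  let ?G = "\<lambda>p. F (X n (fst p)) (snd p)"
  have [measurable]: "A \<in> sets \<Omega>" by (rule sets_Hist[OF A])
  have D: "?D = density \<Omega> (\<lambda>w. ennreal (indicator A w))" by (intro density_cong) (auto simp: indicator_def)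
  have "emeasure ?D (space ?D) \<le> emeasure \<Omega> (space \<Omega>)"
    by (simp add: emeasure_density emeasure_space)
  then have "finite_measure ?D"
    by (intro finite_measureI) (use \<Omega>.emeasure_space_1 in \<open>auto simp: top_unique\<close>)
  then interpret D: finite_measure ?D .
  interpret DN: pair_sigma_finite ?D N ..
  have FX: "?G \<in> ?D \<Otimes>\<^sub>M N \<rightarrow>\<^sub>M borel"
    using F_X_measurable by (simp cong: measurable_cong_sets sets_pair_measure_cong)
  have XD: "X (Suc n) \<in> ?D \<rightarrow>\<^sub>M borel" by simp
  have iA: "integrable \<Omega> (\<lambda>w. indicator A w *\<^sub>R f (X (Suc n) w))"
    by (rule integrable_mult_indicator[OF _ i]) auto
  have "integrable ?D (\<lambda>w. f (X (Suc n) w))"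
    unfolding D using iA by (subst integrable_density) auto
  then have "integrable (distr ?D borel (X (Suc n))) f"
    by (subst integrable_distr_eq) auto
  then have iG: "integrable (?D \<Otimes>\<^sub>M N) (\<lambda>p. f (?G p))"
    unfolding transition_law[OF A] by (subst (asm) integrable_distr_eq[OF FX]) auto
  have iS: "integrable ?D (\<lambda>w. step f (X n w))"
    unfolding step_def using DN.integrable_fst'[OF iG] by simp
  then have "integrable \<Omega> (\<lambda>w. indicator A w *\<^sub>R step f (X n w))"
    unfolding D by (subst (asm) integrable_density) auto
  then show "integrable \<Omega> (\<lambda>w. indicator A w * step f (X n w))" by simp
  have "(\<integral>w\<in>A. f (X (Suc n) w) \<partial>\<Omega>) = (\<integral>w. f (X (Suc n) w) \<partial>?D)"
    unfolding D set_lebesgue_integral_def by (subst integral_density) auto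
  also have "\<dots> = (\<integral>x. f x \<partial>distr ?D borel (X (Suc n)))"
    by (rule integral_distr[symmetric, OF XD]) auto
  also have "\<dots> = (\<integral>p. f (?G p) \<partial>(?D \<Otimes>\<^sub>M N))"
    unfolding transition_law[OF A] by (rule integral_distr[OF FX]) auto
  also have "\<dots> = (\<integral>w. step f (X n w) \<partial>?D)"
    unfolding step_def using DN.integral_fst'[OF iG] by simp
  also have "\<dots> = (\<integral>w\<in>A. step f (X n w) \<partial>\<Omega>)"
    unfolding D set_lebesgue_integral_def by (subst integral_density) auto
  finally show "(\<integral>w\<in>A. f (X (Suc n) w) \<partial>\<Omega>) = (\<integral>w\<in>A. step f (X n w) \<partial>\<Omega>)" .
qed

lemma cond_exp_transition:
  fixes f :: "'a \<Rightarrow> real"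
  assumes f [measurable]: "f \<in> borel_measurable borel" and i: "integrable \<Omega> (\<lambda>w. f (X (Suc n) w))"
  shows "AE w in \<Omega>. real_cond_exp \<Omega> (Hist n) (\<lambda>w. f (X (Suc n) w)) w = step f (X n w)"
proof -
  interpret H: sigma_finite_subalgebra \<Omega> "Hist n" by (rule sigma_finite_Hist)
  have sp: "space \<Omega> \<in> sets (Hist n)"
    by (metis sets.top subalgebra_Hist subalgebra_def)
  have "integrable \<Omega> (\<lambda>w. indicator (space \<Omega>) w * step f (X n w))"
    by (rule integral_transition(1)[OF f i sp])
  then have iS: "integrable \<Omega> (\<lambda>w. step f (X n w))"
    by (rule Bochner_Integration.integrable_cong[THEN iffD1, rotated -1]) auto
  show ?thesis
  proof (rule H.real_cond_exp_charact)
    show "(\<integral>w\<in>A. f (X (Suc n) w) \<partial>\<Omega>) = (\<integral>w\<in>A. step f (X n w) \<partial>\<Omega>)" if "A \<in> sets (Hist n)" for A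
      by (rule integral_transition(2)[OF f i that])
    show "(\<lambda>w. step f (X n w)) \<in> borel_measurable (Hist n)"
      using measurable_compose[OF measurable_history_algebra step_measurable[OF f], of n n] by simp
  qed (use i iS in auto)
qed

lemma markov_integral:
  fixes f :: "'a \<Rightarrow> real" and Y :: "'p \<Rightarrow> real"
  assumes f [measurable]: "f \<in> borel_measurable borel" and i: "integrable \<Omega> (\<lambda>w. f (X (Suc n) w))"
    and Y: "Y \<in> borel_measurable (Hist n)" and iY: "integrable \<Omega> (\<lambda>w. Y w * f (X (Suc n) w))"
  shows "integrable \<Omega> (\<lambda>w. Y w * step f (X n w))"
    "E (\<lambda>w. Y w * f (X (Suc n) w)) = E (\<lambda>w. Y w * step f (X n w))"
proof -
  interpret H: sigma_finite_subalgebra \<Omega> "Hist n" by (rule sigma_finite_Hist)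
  have [measurable]: "Y \<in> borel_measurable \<Omega>" by (rule measurable_from_subalg[OF subalgebra_Hist Y])
  have meas: "(\<lambda>w. f (X (Suc n) w)) \<in> borel_measurable \<Omega>" by measurable
  note ce = cond_exp_transition[OF f i]
  have ae: "AE w in \<Omega>. Y w * real_cond_exp \<Omega> (Hist n) (\<lambda>w. f (X (Suc n) w)) w = Y w * step f (X n w)"
    using ce by eventually_elim simp
  have m: "(\<lambda>w. Y w * real_cond_exp \<Omega> (Hist n) (\<lambda>w. f (X (Suc n) w)) w) \<in> borel_measurable \<Omega>"
    using borel_measurable_cond_exp2 by auto
  note g = H.real_cond_exp_intg[OF iY Y meas]
  show "integrable \<Omega> (\<lambda>w. Y w * step f (X n w))"
    by (rule integrable_cong_AE[THEN iffD1, OF m _ ae g(1)]) measurable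
  have "E (\<lambda>w. Y w * real_cond_exp \<Omega> (Hist n) (\<lambda>w. f (X (Suc n) w)) w) = E (\<lambda>w. Y w * step f (X n w))"
    by (rule integral_cong_AE[OF m _ ae]) measurable
  then show "E (\<lambda>w. Y w * f (X (Suc n) w)) = E (\<lambda>w. Y w * step f (X n w))"
    using g(2) by simp
qed

lemma markov_integral_complex:
  fixes f :: "'a \<Rightarrow> real" and Y :: "'p \<Rightarrow> complex"
  assumes f [measurable]: "f \<in> borel_measurable borel" and i: "integrable \<Omega> (\<lambda>w. f (X (Suc n) w))"
    and Y: "Y \<in> borel_measurable (Hist n)" and iY: "integrable \<Omega> (\<lambda>w. Y w * of_real (f (X (Suc n) w)))"
  shows "E (\<lambda>w. Y w * of_real (f (X (Suc n) w))) = E (\<lambda>w. Y w * of_real (step f (X n w)))"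
proof -
  have Y': "(\<lambda>w. Re (Y w)) \<in> borel_measurable (Hist n)" "(\<lambda>w. Im (Y w)) \<in> borel_measurable (Hist n)"
    using Y by measurable
  have iRe: "integrable \<Omega> (\<lambda>w. Re (Y w) * f (X (Suc n) w))" and iIm: "integrable \<Omega> (\<lambda>w. Im (Y w) * f (X (Suc n) w))"
    using integrable_Re[OF iY] integrable_Im[OF iY] by simp_all
  note r = markov_integral[OF f i Y'(1) iRe] markov_integral[OF f i Y'(2) iIm]
  have eq: "Y w * of_real c = of_real (Re (Y w) * c) + \<i> * of_real (Im (Y w) * c)" for w c
    by (simp add: complex_eq_iff)
  show ?thesis unfolding eq using r iRe iIm by (simp del: of_real_mult)
qed

text \<open>The drift inequality keeps the moments below the initial value plus
  \<open>K / (1 - \<alpha>)\<close>, the fixed point of the recursion. Integrability is part of the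
  induction: it is proved by Fubini's theorem on the product with \<open>N\<close>, whose inner
  integrals are bounded by the drift.\<close>

lemma chain_moment:
  assumes m: "m \<ge> 1"
  shows "\<exists>c. \<forall>n. integrable \<Omega> (\<lambda>w. norm (X n w) ^ m) \<and> E (\<lambda>w. norm (X n w) ^ m) \<le> c"
proof -
  obtain \<alpha> K where lK: "0 < \<alpha>" "\<alpha> < 1" "0 \<le> K"
    and int: "\<And>x. integrable N (\<lambda>w. norm (F x w) ^ m)"
    and lyap: "\<And>x. expectation (\<lambda>w. norm (F x w) ^ m) \<le> \<alpha> * norm x ^ m + K"
    using lyapunov[OF m] by blast
  have [measurable]: "(\<lambda>x::'a. norm x ^ m) \<in> borel_measurable borel" by measurable
  have "integrable \<Omega> (\<lambda>w. norm (X n w) ^ m) \<and> E (\<lambda>w. norm (X n w) ^ m) \<le> norm x0 ^ m + K / (1 - \<alpha>)" for n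
  proof (induction n)
    case 0
    have ae: "AE w in \<Omega>. norm (X 0 w) ^ m = norm x0 ^ m" using X_start by eventually_elim simp
    have "integrable \<Omega> (\<lambda>w. norm (X 0 w) ^ m)"
      by (rule integrable_cong_AE[THEN iffD2, OF _ _ ae]) auto
    moreover have "E (\<lambda>w. norm (X 0 w) ^ m) = E (\<lambda>w. norm x0 ^ m)" by (rule integral_cong_AE[OF _ _ ae]) auto
    ultimately show ?case using lK by (simp add: \<Omega>.prob_space)
  next
    case (Suc n)
    let ?G = "\<lambda>p. F (X n (fst p)) (snd p)"
    have sp: "space \<Omega> \<in> sets (Hist n)" by (metis sets.top subalgebra_Hist subalgebra_def)
    have "density \<Omega> (indicator (space \<Omega>)) = density \<Omega> (\<lambda>_. 1)" by (rule density_cong) auto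
    then have law: "distr \<Omega> borel (X (Suc n)) = distr (\<Omega> \<Otimes>\<^sub>M N) borel ?G"
      using transition_law[OF sp] by (simp add: density_1)
    have iV: "integrable \<Omega> (\<lambda>w. \<alpha> * norm (X n w) ^ m + K)" using Suc.IH by auto
    have iE: "integrable \<Omega> (\<lambda>w. expectation (\<lambda>v. norm (F (X n w) v) ^ m))"
    proof (rule integrable_le[OF iV])
      show "(\<lambda>w. expectation (\<lambda>v. norm (F (X n w) v) ^ m)) \<in> borel_measurable \<Omega>"
        using measurable_compose[OF X_measurable step_measurable[of "\<lambda>x. norm x ^ m"]] by (simp add: step_def)
      show "norm (expectation (\<lambda>v. norm (F (X n w) v) ^ m)) \<le> \<alpha> * norm (X n w) ^ m + K" for w
        using lyap[of "X n w"] by simp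
    qed
    have iG: "integrable (\<Omega> \<Otimes>\<^sub>M N) (\<lambda>p. norm (?G p) ^ m)"
    proof (rule \<Omega>N.Fubini_integrable)
      show "(\<lambda>p. norm (?G p) ^ m) \<in> borel_measurable (\<Omega> \<Otimes>\<^sub>M N)" by measurable
      show "integrable \<Omega> (\<lambda>w. expectation (\<lambda>v. norm (norm (?G (w, v)) ^ m)))" using iE by simp
      show "AE w in \<Omega>. integrable N (\<lambda>v. norm (?G (w, v)) ^ m)" using int by simp
    qed
    then have "integrable (distr \<Omega> borel (X (Suc n))) (\<lambda>x. norm x ^ m)"
      unfolding law by (subst integrable_distr_eq) auto
    then have i: "integrable \<Omega> (\<lambda>w. norm (X (Suc n) w) ^ m)" by (subst (asm) integrable_distr_eq) auto
    have "E (\<lambda>w. norm (X (Suc n) w) ^ m) = (\<integral>x. norm x ^ m \<partial>distr \<Omega> borel (X (Suc n)))"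
      by (rule integral_distr[symmetric]) auto
    also have "\<dots> = (\<integral>p. norm (?G p) ^ m \<partial>(\<Omega> \<Otimes>\<^sub>M N))" unfolding law by (rule integral_distr) auto
    also have "\<dots> = E (\<lambda>w. expectation (\<lambda>v. norm (F (X n w) v) ^ m))"
      using \<Omega>N.integral_fst'[OF iG] by simp
    also have "\<dots> \<le> E (\<lambda>w. \<alpha> * norm (X n w) ^ m + K)" by (intro integral_mono iE iV lyap)
    also have "\<dots> = \<alpha> * E (\<lambda>w. norm (X n w) ^ m) + K" using Suc.IH by (simp add: \<Omega>.prob_space)
    also have "\<dots> \<le> \<alpha> * (norm x0 ^ m + K / (1 - \<alpha>)) + K" using Suc.IH lK by (intro add_right_mono mult_left_mono) auto
    also have "\<dots> = \<alpha> * norm x0 ^ m + K / (1 - \<alpha>)" using lK by (simp add: field_simps)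
    also have "\<dots> \<le> norm x0 ^ m + K / (1 - \<alpha>)" using lK mult_right_mono[of \<alpha> 1 "norm x0 ^ m"] by simp
    finally show ?case using i by simp
  qed
  then show ?thesis by blast
qed

lemma chain_dlip_power:
  assumes m: "m \<ge> 1" and f: "dlip m L f"
  shows "\<exists>c. \<forall>n. integrable \<Omega> (\<lambda>w. \<bar>f (X n w)\<bar> ^ k) \<and> E (\<lambda>w. \<bar>f (X n w)\<bar> ^ k) \<le> c"
proof -
  obtain c where c: "c \<ge> 0" "\<And>x. \<bar>f x\<bar> \<le> c * (1 + norm x ^ m)" using dlip_growth'[OF m f] by blast
  have [measurable]: "f \<in> borel_measurable borel" using f by (rule dlip_measurable)
  obtain C\<^sub>k where Ck: "\<And>a b :: real. a \<ge> 0 \<Longrightarrow> b \<ge> 0 \<Longrightarrow> (a + b) ^ k \<le> (1 + 1) * a ^ k + C\<^sub>k * b ^ k"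
    using power_add_le_weighted[of 1 k] by (meson zero_less_one)
  \<comment> \<open>The moment bounds concern exponents of at least 1, whereas \<open>m * k\<close>
    is 0 for \<open>k = 0\<close>.\<close>
  define p where "p = max 1 (m * k)"
  have p: "p \<ge> 1" by (simp add: p_def)
  obtain c' where c': "\<And>n. integrable \<Omega> (\<lambda>w. norm (X n w) ^ p)" "\<And>n. (E (\<lambda>w. norm (X n w) ^ p)) \<le> c'"
    using chain_moment[OF p] by blast
  have bound: "\<bar>f x\<bar> ^ k \<le> c ^ k * (2 + \<bar>C\<^sub>k\<bar> * (1 + norm x ^ p))" for x
  proof -
    have "\<bar>f x\<bar> ^ k \<le> (c * (1 + norm x ^ m)) ^ k" using c by (intro power_mono) auto
    also have "\<dots> = c ^ k * (1 + norm x ^ m) ^ k" by (rule power_mult_distrib)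
    also have "(1 + norm x ^ m) ^ k \<le> 2 + \<bar>C\<^sub>k\<bar> * (1 + norm x ^ p)"
    proof -
      have "(1 + norm x ^ m) ^ k \<le> 2 + C\<^sub>k * norm x ^ (m * k)" using Ck[of 1 "norm x ^ m"] by (simp add: power_mult)
      also have "C\<^sub>k * norm x ^ (m * k) \<le> \<bar>C\<^sub>k\<bar> * (1 + norm x ^ p)"
      proof (rule mult_mono)
        show "norm x ^ (m * k) \<le> 1 + norm x ^ p"
        proof (cases "norm x \<le> 1")
          case True
          then have "norm x ^ (m * k) \<le> 1" by (simp add: power_le_one)
          then show ?thesis by (simp add: add_increasing2)
        next
          case False
          then have "norm x ^ (m * k) \<le> norm x ^ p" by (intro power_increasing) (auto simp: p_def)
          then show ?thesis by simp
        qed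
      qed auto
      finally show ?thesis by simp
    qed
    finally show ?thesis using c(1) by (simp add: mult_left_mono)
  qed
  have ib: "integrable \<Omega> (\<lambda>w. c ^ k * (2 + \<bar>C\<^sub>k\<bar> * (1 + norm (X n w) ^ p)))" for n using c' by auto
  have i: "integrable \<Omega> (\<lambda>w. \<bar>f (X n w)\<bar> ^ k)" for n
    by (rule integrable_le[OF ib[of n]]) (use bound in auto)
  have "E (\<lambda>w. \<bar>f (X n w)\<bar> ^ k) \<le> c ^ k * (2 + \<bar>C\<^sub>k\<bar> * (1 + c'))" for n
  proof -
    have "E (\<lambda>w. \<bar>f (X n w)\<bar> ^ k) \<le> E (\<lambda>w. c ^ k * (2 + \<bar>C\<^sub>k\<bar> * (1 + norm (X n w) ^ p)))"
      by (intro integral_mono i ib bound)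
    also have "\<dots> = c ^ k * (2 + \<bar>C\<^sub>k\<bar> * (1 + E (\<lambda>w. norm (X n w) ^ p)))" using c' by (simp add: \<Omega>.prob_space)
    also have "\<dots> \<le> c ^ k * (2 + \<bar>C\<^sub>k\<bar> * (1 + c'))" using c' c(1) by (intro mult_left_mono add_left_mono) auto
    finally show ?thesis .
  qed
  with i show ?thesis by blast
qed

end

section \<open>Characteristic functions of the martingale part\<close>

context random_map_chain
begin

context
  fixes g G :: "'a \<Rightarrow> real" and m :: nat and L L' \<sigma>2 :: real
  assumes m: "m \<ge> 1" and g: "dlip m L g" and G: "dlip (2 * m) L' G" and \<sigma>2: "\<sigma>2 \<ge> 0"
    and G_eq: "\<And>x. G x - step G x = step (\<lambda>x. (g x)\<^sup>2) x - (step g x)\<^sup>2 - \<sigma>2"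
begin

definition mdiff :: "nat \<Rightarrow> 'p \<Rightarrow> real" where
  "mdiff k w = g (X (Suc k) w) - step g (X k w)"

definition mart :: "nat \<Rightarrow> 'p \<Rightarrow> real" where
  "mart n w = (\<Sum>k<n. mdiff k w)"

lemma mart_0 [simp]: "mart 0 w = 0" and mart_Suc: "mart (Suc n) w = mart n w + mdiff n w"
  by (simp_all add: mart_def)

lemma two_m_ge_1: "2 * m \<ge> 1" using m by simp

lemma g_measurable [measurable]: "g \<in> borel_measurable borel" and G_measurable [measurable]: "G \<in> borel_measurable borel"
  using dlip_measurable[OF g] dlip_measurable[OF G] by auto

lemma mdiff_measurable [measurable]: "mdiff k \<in> borel_measurable \<Omega>"
  unfolding mdiff_def[abs_def] by measurable

lemma mart_measurable [measurable]: "mart n \<in> borel_measurable \<Omega>"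
  unfolding mart_def[abs_def] by measurable

lemma mart_adapted: "mart n \<in> borel_measurable (Hist n)"
proof -
  have [measurable]: "X j \<in> borel_measurable (Hist n)" if "j \<le> n" for j
    by (rule measurable_history_algebra[OF that])
  show ?thesis unfolding mart_def[abs_def] mdiff_def
    by (intro borel_measurable_sum borel_measurable_diff) (auto intro!: measurable_compose[of "X _" _ borel])
qed

lemma step_adapted: "(\<lambda>w. step g (X n w)) \<in> borel_measurable (Hist n)"
  using measurable_compose[OF measurable_history_algebra step_measurable[OF g_measurable], of n n] by simp

lemma bounded_moments:
  shows "\<exists>c. \<forall>n. integrable \<Omega> (\<lambda>w. \<bar>g (X n w)\<bar> ^ k) \<and> E (\<lambda>w. \<bar>g (X n w)\<bar> ^ k) \<le> c"
    and "\<exists>c. \<forall>n. integrable \<Omega> (\<lambda>w. \<bar>step g (X n w)\<bar> ^ k) \<and> E (\<lambda>w. \<bar>step g (X n w)\<bar> ^ k) \<le> c"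
    and "\<exists>c. \<forall>n. integrable \<Omega> (\<lambda>w. \<bar>G (X n w)\<bar> ^ k) \<and> E (\<lambda>w. \<bar>G (X n w)\<bar> ^ k) \<le> c"
  using chain_dlip_power[OF m g] chain_dlip_power[OF two_m_ge_1 G] dlip_step[OF m g] chain_dlip_power[OF m] by metis+

lemma g_integrable: "integrable \<Omega> (\<lambda>w. g (X n w))" "integrable \<Omega> (\<lambda>w. (g (X n w))\<^sup>2)"
  and step_integrable: "integrable \<Omega> (\<lambda>w. step g (X n w))" "integrable \<Omega> (\<lambda>w. (step g (X n w))\<^sup>2)"
  and G_integrable: "integrable \<Omega> (\<lambda>w. G (X n w))" "integrable \<Omega> (\<lambda>w. (G (X n w))\<^sup>2)"
  using bounded_moments(1)[of 1] bounded_moments(1)[of 2] bounded_moments(2)[of 1] bounded_moments(2)[of 2]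
    bounded_moments(3)[of 1] bounded_moments(3)[of 2]
  by (auto intro: integrable_abs_cancel)

lemma integrable_mult_of_squares:
  fixes u v :: "'p \<Rightarrow> real"
  assumes [measurable]: "u \<in> borel_measurable \<Omega>" "v \<in> borel_measurable \<Omega>"
    and "integrable \<Omega> (\<lambda>w. (u w)\<^sup>2)" "integrable \<Omega> (\<lambda>w. (v w)\<^sup>2)"
  shows "integrable \<Omega> (\<lambda>w. u w * v w)"
proof (rule integrable_le)
  show "integrable \<Omega> (\<lambda>w. (u w)\<^sup>2 + (v w)\<^sup>2)" using assms by auto
  have "\<bar>a * b\<bar> \<le> a\<^sup>2 + b\<^sup>2" for a b :: real
  proof -
    have "0 \<le> \<bar>a\<bar> * \<bar>b\<bar>" by simp
    then show ?thesis using sum_squares_bound[of "\<bar>a\<bar>" "\<bar>b\<bar>"] unfolding abs_mult power2_abs by linarith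
  qed
  then show "norm (u w * v w) \<le> (u w)\<^sup>2 + (v w)\<^sup>2" for w by simp
qed measurable

lemma mdiff_power: "\<exists>c. \<forall>k. integrable \<Omega> (\<lambda>w. \<bar>mdiff k w\<bar> ^ j) \<and> E (\<lambda>w. \<bar>mdiff k w\<bar> ^ j) \<le> c"
proof -
  obtain c where c: "\<And>n. integrable \<Omega> (\<lambda>w. \<bar>g (X n w)\<bar> ^ j)" "\<And>n. (E (\<lambda>w. \<bar>g (X n w)\<bar> ^ j)) \<le> c"
    using bounded_moments(1) by metis
  obtain c' where c': "\<And>n. integrable \<Omega> (\<lambda>w. \<bar>step g (X n w)\<bar> ^ j)" "\<And>n. (E (\<lambda>w. \<bar>step g (X n w)\<bar> ^ j)) \<le> c'"
    using bounded_moments(2) by metis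
  have pw: "\<bar>a - b\<bar> ^ j \<le> 2 ^ j * (\<bar>a\<bar> ^ j + \<bar>b\<bar> ^ j)" for a b :: real
  proof -
    have "\<bar>a - b\<bar> ^ j \<le> (2 * max \<bar>a\<bar> \<bar>b\<bar>) ^ j" by (intro power_mono) auto
    also have "\<dots> = 2 ^ j * max \<bar>a\<bar> \<bar>b\<bar> ^ j" by (rule power_mult_distrib)
    also have "max \<bar>a\<bar> \<bar>b\<bar> ^ j \<le> \<bar>a\<bar> ^ j + \<bar>b\<bar> ^ j" by (auto simp: max_def)
    finally show ?thesis by simp
  qed
  have ib: "integrable \<Omega> (\<lambda>w. 2 ^ j * (\<bar>g (X (Suc k) w)\<bar> ^ j + \<bar>step g (X k w)\<bar> ^ j))" for k
    using c(1)[of "Suc k"] c'(1)[of k] by auto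
  have i: "integrable \<Omega> (\<lambda>w. \<bar>mdiff k w\<bar> ^ j)" for k
    by (rule integrable_le[OF ib[of k]]) (use pw in \<open>auto simp: mdiff_def\<close>)
  have "E (\<lambda>w. \<bar>mdiff k w\<bar> ^ j) \<le> 2 ^ j * (c + c')" for k
  proof -
    have "E (\<lambda>w. \<bar>mdiff k w\<bar> ^ j) \<le> E (\<lambda>w. 2 ^ j * (\<bar>g (X (Suc k) w)\<bar> ^ j + \<bar>step g (X k w)\<bar> ^ j))"
      using pw by (intro integral_mono i ib) (simp add: mdiff_def)
    also have "\<dots> = 2 ^ j * (E (\<lambda>w. \<bar>g (X (Suc k) w)\<bar> ^ j) + E (\<lambda>w. \<bar>step g (X k w)\<bar> ^ j))"
      using c(1)[of "Suc k"] c'(1)[of k] by simp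
    also have "\<dots> \<le> 2 ^ j * (c + c')" using c c' by (intro mult_left_mono add_mono) auto
    finally show ?thesis .
  qed
  with i show ?thesis by blast
qed

lemma mdiff_integrable: "integrable \<Omega> (mdiff k)" "integrable \<Omega> (\<lambda>w. (mdiff k w)\<^sup>2)" "integrable \<Omega> (\<lambda>w. \<bar>mdiff k w\<bar> ^ 3)"
  using mdiff_power[of 1] mdiff_power[of 2] mdiff_power[of 3] by (auto intro: integrable_abs_cancel)

lemma mart_square_integrable: "integrable \<Omega> (\<lambda>w. (mart n w)\<^sup>2)"
proof (induction n)
  case (Suc n)
  have "(\<lambda>w. (mart (Suc n) w)\<^sup>2) = (\<lambda>w. (mart n w)\<^sup>2 + (mdiff n w)\<^sup>2 + 2 * (mart n w * mdiff n w))"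
    by (auto simp: mart_Suc power2_sum)
  then show ?case using Suc mdiff_integrable(2)[of n] integrable_mult_of_squares[of "mart n" "mdiff n"] by simp
qed simp

lemma mart_orthogonal: "E (\<lambda>w. mart n w * mdiff n w) = 0"
proof -
  have i: "integrable \<Omega> (\<lambda>w. mart n w * g (X (Suc n) w))"
    by (intro integrable_mult_of_squares mart_square_integrable g_integrable) measurable
  note mi = markov_integral[OF g_measurable g_integrable(1) mart_adapted i]
  have "E (\<lambda>w. mart n w * mdiff n w) = E (\<lambda>w. mart n w * g (X (Suc n) w) - mart n w * step g (X n w))"
    by (simp add: mdiff_def right_diff_distrib)
  also have "\<dots> = 0" using mi i by simp
  finally show ?thesis .
qed

lemma integrable_bounded_mult:
  fixes Y :: "'p \<Rightarrow> complex" and u :: "'p \<Rightarrow> real"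
  assumes [measurable]: "Y \<in> borel_measurable \<Omega>" and Y: "\<And>w. norm (Y w) \<le> 1" and u: "integrable \<Omega> u"
  shows "integrable \<Omega> (\<lambda>w. Y w * of_real (u w))"
proof (rule Bochner_Integration.integrable_bound[OF u])
  show "AE w in \<Omega>. norm (Y w * of_real (u w)) \<le> norm (u w)"
    using mult_right_mono[OF Y, of "\<bar>u _\<bar>"] by (auto simp: norm_mult)
qed (use u in measurable)

lemma cond_mean_mdiff:
  fixes Y :: "'p \<Rightarrow> complex"
  assumes Y: "Y \<in> borel_measurable (Hist n)" "\<And>w. norm (Y w) \<le> 1"
  shows "E (\<lambda>w. Y w * of_real (mdiff n w)) = 0"
proof -
  have Y' [measurable]: "Y \<in> borel_measurable \<Omega>" by (rule measurable_from_subalg[OF subalgebra_Hist Y(1)])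
  note ib = integrable_bounded_mult[OF Y' Y(2)]
  have "E (\<lambda>w. Y w * of_real (mdiff n w)) =
     E (\<lambda>w. Y w * of_real (g (X (Suc n) w)) - Y w * of_real (step g (X n w)))"
    by (simp add: mdiff_def right_diff_distrib)
  also have "\<dots> = 0"
    using markov_integral_complex[OF g_measurable g_integrable(1) Y(1) ib[OF g_integrable(1)]]
      ib[OF g_integrable(1)] ib[OF step_integrable(1)] by simp
  finally show ?thesis .
qed

text \<open>The Poisson equation of \<open>G\<close> trades the conditional variance, which
  fluctuates with the state, for the constant \<open>\<sigma>2\<close> and a difference of values of
  \<open>G\<close> at successive states. The square is expanded into a function of the next state, a
  cross term whose factor \<open>step g\<close> is known from the past, and a term known from the
  past. The factor \<open>Y\<close> will be 1 or a characteristic exponential of the past.\<close>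

lemma cond_square_mdiff:
  fixes Y :: "'p \<Rightarrow> complex"
  assumes Y: "Y \<in> borel_measurable (Hist n)" "\<And>w. norm (Y w) \<le> 1"
  shows "E (\<lambda>w. Y w * of_real ((mdiff n w)\<^sup>2 + G (X (Suc n) w))) = E (\<lambda>w. Y w * of_real (\<sigma>2 + G (X n w)))"
proof -
  have Y' [measurable]: "Y \<in> borel_measurable \<Omega>" by (rule measurable_from_subalg[OF subalgebra_Hist Y(1)])
  note ib = integrable_bounded_mult[OF Y' Y(2)]
  let ?g = "\<lambda>w. g (X (Suc n) w)" and ?p = "\<lambda>w. step g (X n w)"
  let ?q = "\<lambda>x. (g x)\<^sup>2 + G x"
  have q_meas: "?q \<in> borel_measurable borel" by measurable
  have i1: "integrable \<Omega> (\<lambda>w. ?q (X (Suc n) w))" using g_integrable G_integrable by auto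
  have i2: "integrable \<Omega> (\<lambda>w. 2 * (?p w * ?g w))"
    by (intro integrable_mult_right integrable_mult_of_squares step_integrable g_integrable) measurable
  have i3: "integrable \<Omega> (\<lambda>w. (?p w)\<^sup>2)" by (rule step_integrable)
  have Yp: "(\<lambda>w. Y w * of_real (2 * ?p w)) \<in> borel_measurable (Hist n)"
    using Y(1) step_adapted[of n] by measurable
  have iYp: "integrable \<Omega> (\<lambda>w. Y w * of_real (2 * ?p w) * of_real (?g w))"
    using ib[OF i2] by (simp add: ac_simps)
  have iYp2: "integrable \<Omega> (\<lambda>w. Y w * of_real (2 * ?p w) * of_real (?p w))"
    using ib[OF integrable_mult_right[OF i3, of 2]] by (simp add: ac_simps power2_eq_square)
  have iG: "integrable \<Omega> (\<lambda>w. \<sigma>2 + G (X n w))" using G_integrable(1) by auto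
  have step_q: "step ?q x = \<sigma>2 + G x + (step g x)\<^sup>2" for x
  proof -
    obtain K where "dlip (2 * m) K (\<lambda>x. g x * g x)" using dlip_mult[OF m g g] by blast
    then have "integrable N (\<lambda>w. (g (F x w))\<^sup>2)"
      using integrable_dlip_step[OF two_m_ge_1] by (simp add: power2_eq_square)
    then have "step ?q x = step (\<lambda>x. (g x)\<^sup>2) x + step G x"
      unfolding step_def using integrable_dlip_step[OF two_m_ge_1 G] by simp
    then show ?thesis using G_eq[of x] by simp
  qed
  have iq: "integrable \<Omega> (\<lambda>w. step ?q (X n w))" unfolding step_q using iG i3 by auto
  have "E (\<lambda>w. Y w * of_real ((mdiff n w)\<^sup>2 + G (X (Suc n) w))) =
    E (\<lambda>w. Y w * of_real (?q (X (Suc n) w)) - Y w * of_real (2 * ?p w) * of_real (?g w) + Y w * of_real ((?p w)\<^sup>2))"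
    by (rule Bochner_Integration.integral_cong) (simp_all add: mdiff_def power2_eq_square algebra_simps)
  also have "\<dots> = E (\<lambda>w. Y w * of_real (?q (X (Suc n) w))) - E (\<lambda>w. Y w * of_real (2 * ?p w) * of_real (?g w))
      + E (\<lambda>w. Y w * of_real ((?p w)\<^sup>2))"
    using ib[OF i1] iYp ib[OF i3] by (simp del: of_real_mult of_real_add of_real_power)
  also have "\<dots> = E (\<lambda>w. Y w * of_real (step ?q (X n w))) - E (\<lambda>w. Y w * of_real (2 * ?p w) * of_real (?p w))
      + E (\<lambda>w. Y w * of_real ((?p w)\<^sup>2))"
    by (simp only: markov_integral_complex[OF q_meas i1 Y(1) ib[OF i1]]
        markov_integral_complex[OF g_measurable g_integrable(1) Yp iYp])
  also have "\<dots> = E (\<lambda>w. Y w * of_real (step ?q (X n w)) - Y w * of_real (2 * ?p w) * of_real (?p w) + Y w * of_real ((?p w)\<^sup>2))"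
    using ib[OF iq] iYp2 ib[OF i3] by (simp del: of_real_mult of_real_add of_real_power)
  also have "\<dots> = E (\<lambda>w. Y w * of_real (\<sigma>2 + G (X n w)))"
    by (rule Bochner_Integration.integral_cong[OF refl], unfold step_q) (simp add: power2_eq_square algebra_simps)
  finally show ?thesis .
qed

text \<open>Orthogonality reduces the variance to the sum over the increments. Each contributes
  \<open>\<sigma>2\<close> plus a difference of successive means of \<open>G\<close>; the
  differences telescope, so the deviation from linear growth is bounded although the chain starts
  outside equilibrium.\<close>

lemma mart_variance: "\<exists>c. \<forall>n. \<bar>E (\<lambda>w. (mart n w)\<^sup>2) - real n * \<sigma>2\<bar> \<le> c"
proof -
  let ?e = "\<lambda>n. \<integral>w. G (X n w) \<partial>\<Omega>"
  have sq: "E (\<lambda>w. (mdiff n w)\<^sup>2) = \<sigma>2 + ?e n - ?e (Suc n)" for n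
  proof -
    have "E (\<lambda>w. of_real ((mdiff n w)\<^sup>2 + G (X (Suc n) w))) = E (\<lambda>w. complex_of_real (\<sigma>2 + G (X n w)))"
      using cond_square_mdiff[of "\<lambda>_. 1" n] by simp
    then have "E (\<lambda>w. (mdiff n w)\<^sup>2 + G (X (Suc n) w)) = E (\<lambda>w. \<sigma>2 + G (X n w))"
      by (simp only: integral_complex_of_real of_real_eq_iff)
    then show ?thesis using mdiff_integrable(2)[of n] G_integrable(1) by (simp add: \<Omega>.prob_space)
  qed
  have "E (\<lambda>w. (mart n w)\<^sup>2) = real n * \<sigma>2 + ?e 0 - ?e n" for n
  proof (induction n)
    case (Suc n)
    have "E (\<lambda>w. (mart (Suc n) w)\<^sup>2) = E (\<lambda>w. (mart n w)\<^sup>2 + (mdiff n w)\<^sup>2 + 2 * (mart n w * mdiff n w))"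
      by (rule Bochner_Integration.integral_cong) (auto simp: mart_Suc power2_sum)
    also have "\<dots> = E (\<lambda>w. (mart n w)\<^sup>2) + E (\<lambda>w. (mdiff n w)\<^sup>2)"
      using mart_square_integrable mdiff_integrable(2)[of n] integrable_mult_of_squares[of "mart n" "mdiff n"]
      by (simp add: mart_orthogonal)
    finally show ?case using Suc by (simp add: sq algebra_simps)
  qed simp
  note eq = this
  obtain c where c: "\<forall>n. integrable \<Omega> (\<lambda>w. \<bar>G (X n w)\<bar> ^ 1) \<and> E (\<lambda>w. \<bar>G (X n w)\<bar> ^ 1) \<le> c"
    using bounded_moments(3)[of 1] by (elim exE)
  have e: "\<bar>?e n\<bar> \<le> c" for n
  proof -
    have "\<bar>?e n\<bar> \<le> E (\<lambda>w. \<bar>G (X n w)\<bar> ^ 1)" using integral_abs_bound[of \<Omega> "\<lambda>w. G (X n w)"] by simp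
    then show ?thesis using spec[OF c, of n] by linarith
  qed
  have "\<bar>E (\<lambda>w. (mart n w)\<^sup>2) - real n * \<sigma>2\<bar> \<le> 2 * c" for n
    unfolding eq using e[of 0] e[of n] by linarith
  then show ?thesis by blast
qed

text \<open>The correction by \<open>G\<close> turns the conditional variance of \<open>mdiff\<close> into the constant \<open>\<sigma>2\<close>
  up to an error of order \<open>s\<^sup>3\<close> per transition.\<close>

lemma mart_char:
  "\<exists>c\<ge>0. \<forall>s n. \<bar>s\<bar> \<le> 1 \<longrightarrow> s\<^sup>2 * \<sigma>2 / 2 \<le> 2 \<longrightarrow>
     norm (E (\<lambda>w. iexp (s * mart n w)) - of_real ((1 - s\<^sup>2 * \<sigma>2 / 2) ^ n)) \<le> c * (s\<^sup>2 + real n * \<bar>s\<bar> ^ 3)"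
proof -
  obtain c1 where c1: "\<And>n. (E (\<lambda>w. \<bar>G (X n w)\<bar> ^ 1)) \<le> c1" using bounded_moments(3)[of 1] by blast
  obtain c2 where c2: "\<And>n. (E (\<lambda>w. \<bar>G (X n w)\<bar> ^ 2)) \<le> c2" using bounded_moments(3)[of 2] by blast
  obtain d2 where d2: "\<And>n. (E (\<lambda>w. \<bar>mdiff n w\<bar> ^ 2)) \<le> d2" using mdiff_power[of 2] by blast
  obtain d3 where d3: "\<And>n. (E (\<lambda>w. \<bar>mdiff n w\<bar> ^ 3)) \<le> d3" using mdiff_power[of 3] by blast
  have "0 \<le> E (\<lambda>w. \<bar>G (X 0 w)\<bar> ^ 1)" "0 \<le> E (\<lambda>w. \<bar>G (X 0 w)\<bar> ^ 2)"
    "0 \<le> E (\<lambda>w. \<bar>mdiff 0 w\<bar> ^ 2)" "0 \<le> E (\<lambda>w. \<bar>mdiff 0 w\<bar> ^ 3)" by auto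
  then have c0: "c1 \<ge> 0" "c2 \<ge> 0" "d2 \<ge> 0" "d3 \<ge> 0"
    using c1[of 0] c2[of 0] d2[of 0] d3[of 0] by linarith+
  define c where "c = d3 + d2 + c2 + \<sigma>2 * c1 + c1"
  have cc: "c \<ge> 0" "c1 \<le> c" "d3 + d2 + c2 + \<sigma>2 * c1 \<le> c" using c0 \<sigma>2 by (auto simp: c_def)
  have main: "norm (E (\<lambda>w. iexp (s * mart n w)) - of_real ((1 - s\<^sup>2 * \<sigma>2 / 2) ^ n)) \<le> c * (s\<^sup>2 + real n * \<bar>s\<bar> ^ 3)"
    if s: "\<bar>s\<bar> \<le> 1" "s\<^sup>2 * \<sigma>2 / 2 \<le> 2" for s n
  proof -
    define r where "r = 1 - s\<^sup>2 * \<sigma>2 / 2"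
    \<comment> \<open>The restriction on \<open>s\<close> keeps the multiplier of the recursion in
      absolute value at most 1, so the errors of single transitions add up without being
      amplified.\<close>
    have r: "\<bar>r\<bar> \<le> 1" using s \<sigma>2 by (auto simp: r_def abs_le_iff)
    define Y where "Y k w = iexp (s * mart k w)" for k w
    have Y1: "norm (Y k w) = 1" for k w by (simp add: Y_def)
    have Y1': "norm (Y k w) \<le> 1" for k w by (simp add: Y1)
    have Y_adapted: "Y k \<in> borel_measurable (Hist k)" for k
      unfolding Y_def[abs_def] using mart_adapted[of k] by measurable
    have Y_meas [measurable]: "Y k \<in> borel_measurable \<Omega>" for k
      by (rule measurable_from_subalg[OF subalgebra_Hist Y_adapted])
    note ib = integrable_bounded_mult[OF Y_meas Y1']
    have iY: "integrable \<Omega> (Y k)" for k using ib[of "\<lambda>_. 1" k] by simp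
    have iYG: "integrable \<Omega> (\<lambda>w. Y k w * of_real (G (X k w)))" for k by (rule ib[OF G_integrable(1)])
    have nYG: "norm (E (\<lambda>w. Y k w * of_real (G (X k w)))) \<le> c1" for k
    proof -
      have "norm (E (\<lambda>w. Y k w * of_real (G (X k w)))) \<le> E (\<lambda>w. norm (Y k w * of_real (G (X k w))))"
        by (rule integral_norm_bound)
      then show ?thesis using c1[of k] by (simp add: norm_mult Y1)
    qed
    define a where "a k = E (\<lambda>w. Y k w * of_real (1 - s\<^sup>2 / 2 * G (X k w)))" for k
    have a_eq: "a k = E (\<lambda>w. Y k w) - of_real (s\<^sup>2 / 2) * E (\<lambda>w. Y k w * of_real (G (X k w)))" for k
    proof -
      have "a k = E (\<lambda>w. Y k w - of_real (s\<^sup>2 / 2) * (Y k w * of_real (G (X k w))))"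
        unfolding a_def by (rule Bochner_Integration.integral_cong) (simp_all add: algebra_simps)
      then show ?thesis using iY iYG by simp
    qed
    have a_close: "norm (E (\<lambda>w. Y k w) - a k) \<le> s\<^sup>2 / 2 * c1" for k
      using mult_left_mono[OF nYG[of k], of "s\<^sup>2 / 2"] by (simp add: a_eq norm_mult norm_divide norm_power)
    have a_step: "norm (a (Suc k) - of_real r * a k) \<le> c * \<bar>s\<bar> ^ 3" for k
    proof -
      let ?D = "mdiff k" and ?G = "\<lambda>w. G (X (Suc k) w)"
      \<comment> \<open>This is the second order expansion in \<open>s\<close> of the factor by
        which one transition multiplies the exponential, including the corrector. The terms
        containing \<open>?D\<close> occur exactly in the combinations whose conditional
        expectations are known; the remainder \<open>R\<close> is of order 3.\<close>
      define T where "T w = 1 + \<i> * of_real (s * ?D w) - of_real (s\<^sup>2 / 2) * of_real ((?D w)\<^sup>2 + ?G w)" for w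
      define R where "R w = iexp (s * ?D w) * of_real (1 - s\<^sup>2 / 2 * ?G w) - T w" for w
      have R: "norm (R w) \<le> \<bar>s\<bar> ^ 3 * (\<bar>?D w\<bar> ^ 3 + \<bar>?D w\<bar> ^ 2 + \<bar>?G w\<bar> ^ 2)" for w
      proof -
        let ?e = "iexp (s * ?D w)"
        let ?E2 = "1 + \<i> * of_real (s * ?D w) - of_real ((s * ?D w)\<^sup>2 / 2)"
        have "(\<Sum>j\<le>2. (\<i> * of_real (s * ?D w)) ^ j / fact j) = ?E2"
          by (simp add: numeral_2_eq_2 power2_eq_square algebra_simps)
        then have 1: "norm (?e - ?E2) \<le> \<bar>s * ?D w\<bar> ^ 3 / 6"
          using iexp_approx1[of "s * ?D w" 2] by (simp add: fact_numeral numeral_3_eq_3)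
        have 2: "norm (?e - 1) \<le> \<bar>s * ?D w\<bar>" using iexp_approx1[of "s * ?D w" 0] by simp
        have "R w = (?e - ?E2) - of_real (s\<^sup>2 / 2 * ?G w) * (?e - 1)"
          unfolding R_def T_def by (simp add: power2_eq_square field_simps)
        then have "norm (R w) \<le> norm (?e - ?E2) + norm (of_real (s\<^sup>2 / 2 * ?G w) * (?e - 1))"
          by (metis norm_triangle_ineq4)
        also have "norm (of_real (s\<^sup>2 / 2 * ?G w) * (?e - 1)) \<le> \<bar>s\<^sup>2 / 2 * ?G w\<bar> * \<bar>s * ?D w\<bar>"
          unfolding norm_mult norm_of_real by (rule mult_left_mono[OF 2]) simp
        also have "\<dots> = \<bar>s\<bar> ^ 3 * ((\<bar>?D w\<bar> * \<bar>?G w\<bar>) / 2)" by (simp add: abs_mult power2_eq_square power3_eq_cube)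
        also have "\<dots> \<le> \<bar>s\<bar> ^ 3 * (\<bar>?D w\<bar> ^ 2 + \<bar>?G w\<bar> ^ 2)"
        proof (rule mult_left_mono)
          have "0 \<le> \<bar>?D w\<bar> ^ 2" "0 \<le> \<bar>?G w\<bar> ^ 2" by simp_all
          then show "\<bar>?D w\<bar> * \<bar>?G w\<bar> / 2 \<le> \<bar>?D w\<bar> ^ 2 + \<bar>?G w\<bar> ^ 2"
            using sum_squares_bound[of "\<bar>?D w\<bar>" "\<bar>?G w\<bar>"] by linarith
        qed simp
        also have "norm (?e - ?E2) \<le> \<bar>s\<bar> ^ 3 * \<bar>?D w\<bar> ^ 3"
        proof -
          have "0 \<le> \<bar>s * ?D w\<bar> ^ 3" by simp
          then have "norm (?e - ?E2) \<le> \<bar>s * ?D w\<bar> ^ 3" using 1 by linarith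
          also have "\<dots> = \<bar>s\<bar> ^ 3 * \<bar>?D w\<bar> ^ 3" unfolding abs_mult by (rule power_mult_distrib)
          finally show ?thesis .
        qed
        finally show ?thesis by (simp add: algebra_simps)
      qed
      have iR': "integrable \<Omega> (\<lambda>w. \<bar>s\<bar> ^ 3 * (\<bar>?D w\<bar> ^ 3 + \<bar>?D w\<bar> ^ 2 + \<bar>?G w\<bar> ^ 2))"
        using mdiff_integrable[of k] G_integrable[of "Suc k"] by auto
      have iR: "integrable \<Omega> (\<lambda>w. Y k w * R w)"
      proof (rule integrable_le[OF iR'])
        show "(\<lambda>w. Y k w * R w) \<in> borel_measurable \<Omega>" unfolding R_def T_def by measurable
      qed (use R in \<open>simp add: norm_mult Y1\<close>)
      have ER: "norm (E (\<lambda>w. Y k w * R w)) \<le> \<bar>s\<bar> ^ 3 * (d3 + d2 + c2)"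
      proof -
        have "norm (E (\<lambda>w. Y k w * R w)) \<le> E (\<lambda>w. norm (Y k w * R w))" by (rule integral_norm_bound)
        also have "\<dots> \<le> E (\<lambda>w. \<bar>s\<bar> ^ 3 * (\<bar>?D w\<bar> ^ 3 + \<bar>?D w\<bar> ^ 2 + \<bar>?G w\<bar> ^ 2))"
          using R iR by (intro integral_mono iR' integrable_norm) (auto simp: norm_mult Y1)
        also have "\<dots> = \<bar>s\<bar> ^ 3 * (E (\<lambda>w. \<bar>?D w\<bar> ^ 3) + E (\<lambda>w. \<bar>?D w\<bar> ^ 2) + E (\<lambda>w. \<bar>?G w\<bar> ^ 2))"
          using mdiff_integrable[of k] G_integrable[of "Suc k"] by simp
        also have "\<dots> \<le> \<bar>s\<bar> ^ 3 * (d3 + d2 + c2)" by (intro mult_left_mono add_mono d3 d2 c2) auto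
        finally show ?thesis .
      qed
      have iD: "integrable \<Omega> (\<lambda>w. Y k w * of_real (?D w))" by (rule ib[OF mdiff_integrable(1)])
      have "integrable \<Omega> (\<lambda>w. (?D w)\<^sup>2 + ?G w)" using mdiff_integrable(2) G_integrable(1) by auto
      note iDG = ib[OF this, of k]
      have iT: "integrable \<Omega> (\<lambda>w. Y k w + of_real s * \<i> * (Y k w * of_real (?D w))
          - of_real (s\<^sup>2 / 2) * (Y k w * of_real ((?D w)\<^sup>2 + ?G w)))"
        using iY iD iDG by (intro Bochner_Integration.integrable_add Bochner_Integration.integrable_diff integrable_mult_right)
      have "a (Suc k) = E (\<lambda>w. (Y k w + of_real s * \<i> * (Y k w * of_real (?D w))
          - of_real (s\<^sup>2 / 2) * (Y k w * of_real ((?D w)\<^sup>2 + ?G w))) + Y k w * R w)"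
        unfolding a_def
      proof (rule Bochner_Integration.integral_cong)
        fix w
        have "Y (Suc k) w = Y k w * iexp (s * ?D w)"
          by (simp add: Y_def mart_Suc exp_add[symmetric] algebra_simps)
        then have "Y (Suc k) w * of_real (1 - s\<^sup>2 / 2 * ?G w) = Y k w * (T w + R w)" by (simp add: R_def)
        then show "Y (Suc k) w * of_real (1 - s\<^sup>2 / 2 * ?G w) =
            (Y k w + of_real s * \<i> * (Y k w * of_real (?D w))
          - of_real (s\<^sup>2 / 2) * (Y k w * of_real ((?D w)\<^sup>2 + ?G w))) + Y k w * R w"
          by (simp add: T_def algebra_simps)
      qed simp
      also have "\<dots> = E (\<lambda>w. Y k w + of_real s * \<i> * (Y k w * of_real (?D w))
          - of_real (s\<^sup>2 / 2) * (Y k w * of_real ((?D w)\<^sup>2 + ?G w))) + E (\<lambda>w. Y k w * R w)"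
        by (rule Bochner_Integration.integral_add[OF iT iR])
      also have "E (\<lambda>w. Y k w + of_real s * \<i> * (Y k w * of_real (?D w))
          - of_real (s\<^sup>2 / 2) * (Y k w * of_real ((?D w)\<^sup>2 + ?G w))) =
          E (\<lambda>w. Y k w) + of_real s * \<i> * E (\<lambda>w. Y k w * of_real (?D w))
          - of_real (s\<^sup>2 / 2) * E (\<lambda>w. Y k w * of_real ((?D w)\<^sup>2 + ?G w))"
        using iY iD iDG by (simp del: of_real_add of_real_power of_real_divide)
      also have "E (\<lambda>w. Y k w * of_real (?D w)) = 0" by (rule cond_mean_mdiff[OF Y_adapted Y1'])
      also have "E (\<lambda>w. Y k w * of_real ((?D w)\<^sup>2 + ?G w)) = E (\<lambda>w. Y k w * of_real (\<sigma>2 + G (X k w)))"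
        by (rule cond_square_mdiff[OF Y_adapted Y1'])
      also have "\<dots> = of_real \<sigma>2 * E (\<lambda>w. Y k w) + E (\<lambda>w. Y k w * of_real (G (X k w)))"
      proof -
        have "E (\<lambda>w. Y k w * of_real (\<sigma>2 + G (X k w))) = E (\<lambda>w. of_real \<sigma>2 * Y k w + Y k w * of_real (G (X k w)))"
          by (rule Bochner_Integration.integral_cong) (simp_all add: algebra_simps)
        then show ?thesis using iY iYG by simp
      qed
      finally have aS: "a (Suc k) = E (\<lambda>w. Y k w) + of_real s * \<i> * 0 - of_real (s\<^sup>2 / 2) *
          (of_real \<sigma>2 * E (\<lambda>w. Y k w) + E (\<lambda>w. Y k w * of_real (G (X k w)))) + E (\<lambda>w. Y k w * R w)" .
      \<comment> \<open>The expansion produces the corrector with coefficient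
        \<open>s\<^sup>2 / 2\<close>, the recursion asks for \<open>r\<close> times that. The
        mismatch is the term of order \<open>s ^ 4\<close>, which is at most of order 3 because
        \<open>\<bar>s\<bar> \<le> 1\<close>.\<close>
      have "a (Suc k) - of_real r * a k =
          E (\<lambda>w. Y k w * R w) - of_real (s ^ 4 * \<sigma>2 / 4) * E (\<lambda>w. Y k w * of_real (G (X k w)))"
        unfolding aS a_eq[of k] r_def by (simp add: field_simps power2_eq_square power4_eq_xxxx)
      then have "norm (a (Suc k) - of_real r * a k) \<le> norm (E (\<lambda>w. Y k w * R w)) +
          norm (of_real (s ^ 4 * \<sigma>2 / 4) * E (\<lambda>w. Y k w * of_real (G (X k w))))"
        by (metis norm_triangle_ineq4)
      also have "norm (of_real (s ^ 4 * \<sigma>2 / 4) * E (\<lambda>w. Y k w * of_real (G (X k w)))) \<le> \<bar>s ^ 4 * \<sigma>2 / 4\<bar> * c1"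
        unfolding norm_mult norm_of_real by (rule mult_left_mono[OF nYG]) simp
      also have "\<dots> \<le> \<bar>s\<bar> ^ 3 * (\<sigma>2 * c1)"
      proof -
        have "\<bar>s\<bar> ^ 4 \<le> \<bar>s\<bar> ^ 3" using s(1) by (intro power_decreasing) auto
        then have "\<bar>s\<bar> ^ 4 * (\<sigma>2 * c1) \<le> \<bar>s\<bar> ^ 3 * (\<sigma>2 * c1)" using \<sigma>2 c0 by (intro mult_right_mono) auto
        moreover have "\<bar>s ^ 4 * \<sigma>2 / 4\<bar> * c1 = \<bar>s\<bar> ^ 4 * (\<sigma>2 * c1) / 4" using \<sigma>2 by (simp add: abs_mult power_abs)
        moreover have "0 \<le> \<bar>s\<bar> ^ 4 * (\<sigma>2 * c1)" using \<sigma>2 c0 by simp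
        ultimately show ?thesis by linarith
      qed
      also have "norm (E (\<lambda>w. Y k w * R w)) + \<bar>s\<bar> ^ 3 * (\<sigma>2 * c1) \<le> \<bar>s\<bar> ^ 3 * (d3 + d2 + c2 + \<sigma>2 * c1)"
        using ER by (simp add: distrib_left)
      also have "\<dots> \<le> \<bar>s\<bar> ^ 3 * c" using cc by (intro mult_left_mono) auto
      finally show ?thesis by (simp add: mult.commute)
    qed
    have a_n: "norm (a n - of_real (r ^ n) * a 0) \<le> real n * (c * \<bar>s\<bar> ^ 3)" for n
    proof (induction n)
      case (Suc n)
      have "a (Suc n) - of_real (r ^ Suc n) * a 0 = (a (Suc n) - of_real r * a n) + of_real r * (a n - of_real (r ^ n) * a 0)"
        by (simp add: algebra_simps)
      then have "norm (a (Suc n) - of_real (r ^ Suc n) * a 0) \<le> norm (a (Suc n) - of_real r * a n) + \<bar>r\<bar> * norm (a n - of_real (r ^ n) * a 0)"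
        by (metis norm_triangle_ineq norm_mult norm_of_real)
      also have "\<dots> \<le> c * \<bar>s\<bar> ^ 3 + 1 * norm (a n - of_real (r ^ n) * a 0)"
        using r by (intro add_mono a_step mult_right_mono) auto
      finally show ?case using Suc by (simp add: algebra_simps)
    qed simp
    have Y0: "E (\<lambda>w. Y 0 w) = 1" by (simp add: Y_def \<Omega>.prob_space)
    have "norm (of_real (r ^ n) * (a 0 - 1)) \<le> 1 * (s\<^sup>2 / 2 * c1)"
      unfolding norm_mult norm_of_real power_abs using r a_close[of 0]
      by (intro mult_mono power_le_one) (auto simp: Y0 norm_minus_commute)
    moreover have "E (\<lambda>w. Y n w) - of_real (r ^ n) = (E (\<lambda>w. Y n w) - a n) + (a n - of_real (r ^ n) * a 0) + of_real (r ^ n) * (a 0 - 1)"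
      by (simp add: algebra_simps)
    then have "norm (E (\<lambda>w. Y n w) - of_real (r ^ n)) \<le>
       norm (E (\<lambda>w. Y n w) - a n) + norm (a n - of_real (r ^ n) * a 0) + norm (of_real (r ^ n) * (a 0 - 1))"
      using norm_triangle_ineq order_trans add_mono by (smt (verit))
    ultimately have "norm (E (\<lambda>w. Y n w) - of_real (r ^ n)) \<le> s\<^sup>2 * c1 + real n * (c * \<bar>s\<bar> ^ 3)"
      using a_close[of n] a_n[of n] by linarith
    also have "\<dots> \<le> c * (s\<^sup>2 + real n * \<bar>s\<bar> ^ 3)"
      using mult_left_mono[OF cc(2), of "s\<^sup>2"] by (simp add: algebra_simps)
    finally show ?thesis by (simp add: Y_def[abs_def] r_def)
  qed
  then show ?thesis using cc(1) by blast
qed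

end

end

section \<open>The central limit theorem\<close>

lemma centred_normal_singleton:
  assumes "\<sigma> \<ge> 0" "\<sigma> = 0 \<Longrightarrow> \<xi> \<noteq> 0"
  shows "emeasure (centred_normal \<sigma>) {\<xi>} = 0"
proof (cases "\<sigma> = 0")
  case True
  then show ?thesis using assms by (simp add: centred_normal_def)
next
  case False
  have "emeasure (density lborel (normal_density 0 \<sigma>)) {\<xi>} = (\<integral>\<^sup>+x. ennreal (normal_density 0 \<sigma> x) * indicator {\<xi>} x \<partial>lborel)"
    by (rule emeasure_density) auto
  also have "\<dots> = 0"
  proof (subst nn_integral_0_iff_AE)
    show "AE x in lborel. ennreal (normal_density 0 \<sigma> x) * indicator {\<xi>} x = 0"
      using AE_lborel_singleton[of \<xi>] by eventually_elim simp
  qed measurable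
  finally show ?thesis using False by (simp add: centred_normal_def)
qed

lemma tendsto_const_div_sqrt: "(\<lambda>n. K / sqrt (real n)) \<longlonglongrightarrow> 0"
  by (rule tendsto_divide_0[OF tendsto_const])
    (intro filterlim_at_top_imp_at_infinity filterlim_compose[OF sqrt_at_top filterlim_real_sequentially])

text \<open>Weak convergence follows from Levy's continuity theorem. The events concern the open
  half-line and \<open>cdf\<close> the closed one; their common boundary point has no mass in the
  limit, so the values agree and the half-line is a continuity set. In the degenerate case this is
  where \<xi> must differ from 0.\<close>

lemma convergence_in_law_centred_normal:
  fixes S :: "nat \<Rightarrow> 'p \<Rightarrow> real"
  assumes P: "prob_space P" and S [measurable]: "\<And>n. S n \<in> borel_measurable P"
    and \<sigma>: "\<sigma> \<ge> 0"
    and char: "\<And>t. (\<lambda>n. \<integral>w. iexp (t * S n w) \<partial>P) \<longlonglongrightarrow> of_real (exp (- (\<sigma> * t)\<^sup>2 / 2))"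
    and \<xi>: "\<sigma> = 0 \<Longrightarrow> \<xi> \<noteq> 0"
  shows "(\<lambda>n. measure P {w \<in> space P. S n w < \<xi>}) \<longlonglongrightarrow> cdf (centred_normal \<sigma>) \<xi>"
proof -
  interpret P: prob_space P by fact
  let ?M = "\<lambda>n. distr P borel (S n)" and ?N = "centred_normal \<sigma>"
  have M: "real_distribution (?M n)" for n
    by (rule P.real_distribution_distr) (rule S)
  interpret N: real_distribution ?N by (rule real_distribution_centred_normal[OF \<sigma>])
  have N: "real_distribution ?N" by (rule N.real_distribution_axioms)
  have "weak_conv_m ?M ?N"
  proof (rule levy_continuity[OF M N])
    fix t
    have "char (?M n) t = (\<integral>w. iexp (t * S n w) \<partial>P)" for n
      unfolding char_def by (rule integral_distr) auto
    then show "(\<lambda>n. char (?M n) t) \<longlonglongrightarrow> char ?N t" using char[of t] by (simp add: char_centred_normal[OF \<sigma>])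
  qed
  note z = centred_normal_singleton[OF \<sigma> \<xi>]
  have zm: "measure ?N {\<xi>} = 0" using z by (simp add: measure_def)
  have lim: "(\<lambda>n. measure (?M n) {..<\<xi>}) \<longlonglongrightarrow> measure ?N {..<\<xi>}"
  proof (rule weak_conv_imp_continuity_set_conv[OF M N \<open>weak_conv_m ?M ?N\<close>])
    have "frontier {..<\<xi>} = {..\<xi>} - {..<\<xi>}"
      unfolding frontier_def interior_open[OF open_lessThan] by simp
    also have "\<dots> = {\<xi>}" by auto
    finally show "emeasure ?N (frontier {..<\<xi>}) = 0" using z by simp
  qed simp
  have M_eq: "measure (?M n) {..<\<xi>} = measure P {w \<in> space P. S n w < \<xi>}" for n
  proof -
    have "S n -` {..<\<xi>} \<inter> space P = {w \<in> space P. S n w < \<xi>}" by auto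
    then show ?thesis by (simp add: measure_distr)
  qed
  have "{..\<xi>} = {..<\<xi>} \<union> {\<xi>}" by auto
  then have "cdf ?N \<xi> = measure ?N ({..<\<xi>} \<union> {\<xi>})" by (simp only: cdf_def)
  also have "\<dots> = measure ?N {..<\<xi>} + measure ?N {\<xi>}" by (rule N.finite_measure_Union) auto
  finally have "cdf ?N \<xi> = measure ?N {..<\<xi>}" unfolding zm by simp
  then show ?thesis using lim unfolding M_eq by simp
qed

context random_map_chain
begin

theorem central_limit:
  fixes f :: "'a \<Rightarrow> real"
  defines "S \<equiv> \<lambda>(n::nat) w. \<Sum>j=1..n. f (X j w) - (\<integral>x. f x \<partial>\<mu>)"
  assumes m: "m \<ge> 1" and f: "dlip m L f"
  shows "integrable \<mu> f \<and> (\<forall>n. integrable \<Omega> (\<lambda>w. (S n w)\<^sup>2)) \<and>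
    (\<exists>\<sigma>\<ge>0. (\<lambda>n. 1 / real n * E (\<lambda>w. (S n w)\<^sup>2)) \<longlonglongrightarrow> \<sigma>\<^sup>2 \<and>
      (\<forall>\<xi>. (\<sigma> = 0 \<longrightarrow> \<xi> \<noteq> 0) \<longrightarrow>
        (\<lambda>n. measure \<Omega> {w \<in> space \<Omega>. 1 / sqrt (real n) * S n w < \<xi>}) \<longlonglongrightarrow> cdf (centred_normal \<sigma>) \<xi>))"
proof -
  define c where "c = (\<integral>x. f x \<partial>\<mu>)"
  have if_mu: "integrable \<mu> f" by (rule integrable_dlip_mu[OF m f])
  have m2: "2 * m \<ge> 1" using m by simp
  have "dlip m (L + 0) (\<lambda>x. f x - c)" by (rule dlip_diff[OF f dlip_const])
  moreover have "(\<integral>x. f x - c \<partial>\<mu>) = 0" using if_mu by (simp add: c_def)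
  ultimately obtain g Lg where g: "dlip m Lg g" and g_eq: "\<And>x. g x - step g x = f x - c"
    using poisson_equation[OF m] by blast
  \<comment> \<open>This is the conditional variance of an increment at state \<open>x\<close>,
    hence nonnegative. Its mean under the invariant measure is the limiting variance, and its own
    Poisson solution \<open>G\<close> has the exponent \<open>2 * m\<close>.\<close>
  define h where "h x = step (\<lambda>x. (g x)\<^sup>2) x - (step g x)\<^sup>2" for x
  obtain K1 where K1: "dlip (2 * m) K1 (\<lambda>x. (g x)\<^sup>2)" using dlip_mult[OF m g g] by (auto simp: power2_eq_square)
  obtain K2 where K2: "dlip (2 * m) K2 (step (\<lambda>x. (g x)\<^sup>2))" using dlip_step[OF m2 K1] by blast
  obtain Lp where p: "dlip m Lp (step g)" using dlip_step[OF m g] by blast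
  obtain K3 where K3: "dlip (2 * m) K3 (\<lambda>x. (step g x)\<^sup>2)" using dlip_mult[OF m p p] by (auto simp: power2_eq_square)
  have h: "dlip (2 * m) (K2 + K3) h" unfolding h_def[abs_def] by (rule dlip_diff[OF K2 K3])
  have h0: "h x \<ge> 0" for x
    using variance_eq[OF integrable_dlip_step[OF m g] integrable_dlip_step[OF m2 K1], of x]
      variance_positive[of "\<lambda>w. g (F x w)"] by (simp add: h_def step_def)
  define \<sigma>2 where "\<sigma>2 = (\<integral>x. h x \<partial>\<mu>)"
  have \<sigma>2: "\<sigma>2 \<ge> 0" using h0 by (simp add: \<sigma>2_def)
  have "dlip (2 * m) (K2 + K3 + 0) (\<lambda>x. h x - \<sigma>2)" by (rule dlip_diff[OF h dlip_const])
  moreover have "(\<integral>x. h x - \<sigma>2 \<partial>\<mu>) = 0" using integrable_dlip_mu[OF m2 h] by (simp add: \<sigma>2_def)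
  ultimately obtain G LG where G: "dlip (2 * m) LG G" and G_eq: "\<And>x. G x - step G x = h x - \<sigma>2"
    using poisson_equation[OF m2] by blast
  have G_eq': "G x - step G x = step (\<lambda>x. (g x)\<^sup>2) x - (step g x)\<^sup>2 - \<sigma>2" for x
    using G_eq[of x] by (simp add: h_def)
  note ctx = m g G \<sigma>2 G_eq'
  let ?M = "mart g"
  \<comment> \<open>The sum pairs \<open>g (X j)\<close> with \<open>step g (X j)\<close>, the
    martingale pairs it with \<open>step g (X (j - 1))\<close>. Moving the index by one leaves only
    these two boundary terms.\<close>
  define b where "b n w = step g (X 0 w) - step g (X n w)" for n w
  have [measurable]: "g \<in> borel_measurable borel" by (rule dlip_measurable[OF g])
  have [measurable]: "b n \<in> borel_measurable \<Omega>" for n unfolding b_def[abs_def] by measurable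
  have M_meas [measurable]: "?M n \<in> borel_measurable \<Omega>" for n by (rule mart_measurable[OF ctx])
  have S_eq: "S n w = ?M n w + b n w" for n w
  proof (induction n)
    case 0
    then show ?case by (simp add: S_def b_def mart_0[OF ctx])
  next
    case (Suc n)
    have "S (Suc n) w = S n w + (f (X (Suc n) w) - c)" by (simp add: S_def c_def)
    also have "f (X (Suc n) w) - c = g (X (Suc n) w) - step g (X (Suc n) w)" by (simp add: g_eq)
    finally show ?case using Suc by (simp add: b_def mart_Suc[OF ctx] mdiff_def[OF ctx])
  qed
  obtain c1 where c1: "\<And>n. integrable \<Omega> (\<lambda>w. \<bar>step g (X n w)\<bar> ^ 1)" "\<And>n. (E (\<lambda>w. \<bar>step g (X n w)\<bar> ^ 1)) \<le> c1"
    using chain_dlip_power[OF m p, of 1] by metis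
  obtain c2 where c2: "\<And>n. integrable \<Omega> (\<lambda>w. \<bar>step g (X n w)\<bar> ^ 2)" "\<And>n. (E (\<lambda>w. \<bar>step g (X n w)\<bar> ^ 2)) \<le> c2"
    using chain_dlip_power[OF m p, of 2] by metis
  have ib: "integrable \<Omega> (b n)" for n
    unfolding b_def[abs_def] using step_integrable(1)[OF ctx] by auto
  have b_abs: "E (\<lambda>w. \<bar>b n w\<bar>) \<le> 2 * c1" for n
  proof -
    have "E (\<lambda>w. \<bar>b n w\<bar>) \<le> E (\<lambda>w. \<bar>step g (X 0 w)\<bar> + \<bar>step g (X n w)\<bar>)"
      by (rule integral_mono[OF integrable_abs[OF ib]]) (use c1(1)[of 0] c1(1)[of n] in \<open>auto simp: b_def\<close>)
    also have "\<dots> \<le> 2 * c1" using c1(1)[of 0] c1(1)[of n] c1(2)[of 0] c1(2)[of n] by simp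
    finally show ?thesis .
  qed
  have b2_le: "(b n w)\<^sup>2 \<le> 2 * (\<bar>step g (X 0 w)\<bar> ^ 2 + \<bar>step g (X n w)\<bar> ^ 2)" for n w
    using zero_le_power2[of "step g (X 0 w) + step g (X n w)"] by (simp add: b_def power2_eq_square algebra_simps)
  have ib2': "integrable \<Omega> (\<lambda>w. 2 * (\<bar>step g (X 0 w)\<bar> ^ 2 + \<bar>step g (X n w)\<bar> ^ 2))" for n
    using c2(1)[of 0] c2(1)[of n] by auto
  have ib2: "integrable \<Omega> (\<lambda>w. (b n w)\<^sup>2)" for n
    by (rule integrable_le[OF ib2'[of n]]) (use b2_le in auto)
  have b_sq: "E (\<lambda>w. (b n w)\<^sup>2) \<le> 4 * c2" for n
  proof -
    have "E (\<lambda>w. (b n w)\<^sup>2) \<le> E (\<lambda>w. 2 * (\<bar>step g (X 0 w)\<bar> ^ 2 + \<bar>step g (X n w)\<bar> ^ 2))"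
      by (intro integral_mono ib2 ib2' b2_le)
    also have "\<dots> \<le> 4 * c2" using c2(1)[of 0] c2(1)[of n] c2(2)[of 0] c2(2)[of n] by simp
    finally show ?thesis .
  qed
  have iM2: "integrable \<Omega> (\<lambda>w. (?M n w)\<^sup>2)" for n by (rule mart_square_integrable[OF ctx])
  have iMb: "integrable \<Omega> (\<lambda>w. ?M n w * b n w)" for n
    by (rule integrable_mult_of_squares[OF ctx M_meas _ iM2 ib2]) measurable
  have S_sq: "(S n w)\<^sup>2 = (?M n w)\<^sup>2 + (b n w)\<^sup>2 + 2 * (?M n w * b n w)" for n w
    by (simp add: S_eq power2_sum)
  have iS2: "integrable \<Omega> (\<lambda>w. (S n w)\<^sup>2)" for n
    unfolding S_sq using iM2 ib2 iMb by auto
  have S_meas [measurable]: "S n \<in> borel_measurable \<Omega>" for n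
    unfolding S_eq[abs_def] by measurable
  obtain d where d: "\<And>n. \<bar>E (\<lambda>w. (?M n w)\<^sup>2) - real n * \<sigma>2\<bar> \<le> d" using mart_variance[OF ctx] by blast
  have d0: "d \<ge> 0" using d[of 0] by linarith
  have c20: "c2 \<ge> 0" by (rule order_trans[OF _ c2(2)[of 0]]) simp
  have c10: "c1 \<ge> 0" by (rule order_trans[OF _ c1(2)[of 0]]) simp
  define K where "K = 2 * d + \<sigma>2 + 8 * c2"
  have var: "\<bar>1 / real n * E (\<lambda>w. (S n w)\<^sup>2) - \<sigma>2\<bar> \<le> K / sqrt (real n)" if n: "n \<ge> 1" for n
  proof -
    let ?s = "sqrt (real n)"
    have s: "?s \<ge> 1" "?s * ?s = real n" using n by simp_all
    \<comment> \<open>The martingale has second moment of order \<open>n\<close>, the boundary term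
      of order 1. Young's inequality with weight \<open>sqrt n\<close> balances them, so the mixed
      term is of order \<open>sqrt n\<close> and vanishes after division by
      \<open>n\<close>.\<close>
    have cross: "\<bar>2 * (x * y)\<bar> \<le> x\<^sup>2 / ?s + ?s * y\<^sup>2" for x y :: real
    proof -
      have "0 \<le> (\<bar>x\<bar> - ?s * \<bar>y\<bar>)\<^sup>2" by simp
      also have "\<dots> = x\<^sup>2 + real n * y\<^sup>2 - 2 * ?s * \<bar>x * y\<bar>"
        using s(2) by (simp add: power2_diff power_mult_distrib abs_mult)
      finally have "?s * \<bar>2 * (x * y)\<bar> \<le> ?s * (x\<^sup>2 / ?s + ?s * y\<^sup>2)"
        using s by (simp add: distrib_left abs_mult mult.assoc[symmetric])
      then show ?thesis using s(1) by (simp only: mult_le_cancel_left_pos)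
    qed
    have "\<bar>\<integral>w. 2 * (?M n w * b n w) \<partial>\<Omega>\<bar> \<le> E (\<lambda>w. \<bar>2 * (?M n w * b n w)\<bar>)" by (rule integral_abs_bound)
    also have "\<dots> \<le> E (\<lambda>w. (?M n w)\<^sup>2 / ?s + ?s * (b n w)\<^sup>2)"
      by (intro integral_mono cross) (use iMb[of n] iM2[of n] ib2[of n] in auto)
    also have "\<dots> = E (\<lambda>w. (?M n w)\<^sup>2) / ?s + ?s * E (\<lambda>w. (b n w)\<^sup>2)" using iM2[of n] ib2[of n] by simp
    also have "\<dots> \<le> (real n * \<sigma>2 + d) / ?s + ?s * (4 * c2)"
      using d[of n] b_sq[of n] s(1) by (intro add_mono divide_right_mono mult_left_mono) (auto simp: abs_le_iff)
    also have "\<dots> \<le> ?s * \<sigma>2 + d + ?s * (4 * c2)"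
    proof -
      have "real n * \<sigma>2 / ?s = ?s * \<sigma>2" using s by (simp add: field_simps)
      moreover have "d / ?s \<le> d" using d0 s(1) by (simp add: divide_le_eq mult_left_mono[of 1 ?s d, simplified])
      ultimately show ?thesis by (simp add: add_divide_distrib)
    qed
    finally have mb: "\<bar>\<integral>w. 2 * (?M n w * b n w) \<partial>\<Omega>\<bar> \<le> ?s * \<sigma>2 + d + ?s * (4 * c2)" .
    have "E (\<lambda>w. (S n w)\<^sup>2) = E (\<lambda>w. (?M n w)\<^sup>2) + E (\<lambda>w. (b n w)\<^sup>2) + E (\<lambda>w. 2 * (?M n w * b n w))"
      unfolding S_sq using iM2[of n] ib2[of n] iMb[of n] by simp
    moreover have "E (\<lambda>w. (b n w)\<^sup>2) \<ge> 0" by simp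
    ultimately have "\<bar>E (\<lambda>w. (S n w)\<^sup>2) - real n * \<sigma>2\<bar> \<le> d + 4 * c2 + (?s * \<sigma>2 + d + ?s * (4 * c2))"
      using d[of n] b_sq[of n] mb by linarith
    also have "\<dots> \<le> ?s * K"
    proof -
      have "d + 4 * c2 + d \<le> ?s * (d + 4 * c2 + d)" using mult_right_mono[OF s(1), of "d + 4 * c2 + d"] d0 c20 by simp
      then show ?thesis by (simp add: K_def algebra_simps)
    qed
    finally have "\<bar>E (\<lambda>w. (S n w)\<^sup>2) - real n * \<sigma>2\<bar> / real n \<le> ?s * K / real n" by (rule divide_right_mono) simp
    moreover have "\<bar>E (\<lambda>w. (S n w)\<^sup>2) - real n * \<sigma>2\<bar> / real n = \<bar>1 / real n * E (\<lambda>w. (S n w)\<^sup>2) - \<sigma>2\<bar>"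
    proof -
      have "1 / real n * E (\<lambda>w. (S n w)\<^sup>2) - \<sigma>2 = (E (\<lambda>w. (S n w)\<^sup>2) - real n * \<sigma>2) / real n"
        using n by (simp add: diff_divide_distrib)
      then show ?thesis by (simp only: abs_divide abs_of_nat)
    qed
    moreover have "?s * K / (?s * ?s) = K / ?s" using s(1) by (simp del: real_sqrt_mult_self)
    then have "?s * K / real n = K / ?s" unfolding s(2) .
    ultimately show ?thesis by simp
  qed
  have lim_var: "(\<lambda>n. 1 / real n * E (\<lambda>w. (S n w)\<^sup>2)) \<longlonglongrightarrow> \<sigma>2"
  proof (rule LIM_zero_cancel, rule Lim_null_comparison[OF _ tendsto_const_div_sqrt[of K]])
    show "\<forall>\<^sub>F n in sequentially. norm (1 / real n * E (\<lambda>w. (S n w)\<^sup>2) - \<sigma>2) \<le> K / sqrt (real n)"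
      using var by (auto simp: eventually_sequentially)
  qed
  obtain k where k: "k \<ge> 0" and k_char: "\<And>s n. \<bar>s\<bar> \<le> 1 \<Longrightarrow> s\<^sup>2 * \<sigma>2 / 2 \<le> 2 \<Longrightarrow>
     norm (E (\<lambda>w. iexp (s * ?M n w)) - of_real ((1 - s\<^sup>2 * \<sigma>2 / 2) ^ n)) \<le> k * (s\<^sup>2 + real n * \<bar>s\<bar> ^ 3)"
    using mart_char[OF ctx] by blast
  have lim_char: "(\<lambda>n. \<integral>w. iexp (t * (1 / sqrt (real n) * S n w)) \<partial>\<Omega>) \<longlonglongrightarrow> of_real (exp (- (sqrt \<sigma>2 * t)\<^sup>2 / 2))" for t
  proof -
    \<comment> \<open>With \<open>s = t / sqrt n\<close> the approximation
      \<open>1 - s\<^sup>2 * \<sigma>2 / 2\<close> equals \<open>1 + x / n\<close>, whose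
      \<open>n\<close>-th power tends to \<open>exp x\<close>. The error
      \<open>s\<^sup>2 + n * \<bar>s\<bar> ^ 3\<close> is then of order \<open>1 / sqrt n\<close>,
      as is the effect of the boundary term.\<close>
    define x where "x = - (t\<^sup>2 * \<sigma>2 / 2)"
    define K' where "K' = k * (t\<^sup>2 + \<bar>t\<bar> ^ 3) + \<bar>t\<bar> * (2 * c1)"
    have diff: "norm (E (\<lambda>w. iexp (t * (1 / sqrt (real n) * S n w))) - of_real ((1 + x / real n) ^ n)) \<le> K' / sqrt (real n)"
      if n: "n \<ge> 1" "\<bar>t\<bar> \<le> sqrt (real n)" "t\<^sup>2 * \<sigma>2 \<le> 4 * real n" for n
    proof -
      let ?q = "sqrt (real n)"
      have q: "?q \<ge> 1" "?q * ?q = real n" "?q\<^sup>2 = real n" using n by simp_all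
      define s where "s = t / ?q"
      have s1: "\<bar>s\<bar> \<le> 1" using n(2) q by (simp add: s_def divide_le_eq)
      have s2: "s\<^sup>2 = t\<^sup>2 / real n" by (simp add: s_def power_divide q)
      have s3: "s\<^sup>2 * \<sigma>2 / 2 \<le> 2" using n by (simp add: s2 field_simps)
      have s4: "1 - s\<^sup>2 * \<sigma>2 / 2 = 1 + x / real n" by (simp add: s2 x_def)
      have s5: "s\<^sup>2 + real n * \<bar>s\<bar> ^ 3 \<le> (t\<^sup>2 + \<bar>t\<bar> ^ 3) / ?q"
      proof -
        have "?q \<le> real n" using mult_left_mono[OF q(1), of ?q] q by simp
        then have "t\<^sup>2 / real n \<le> t\<^sup>2 / ?q" using q by (intro divide_left_mono) auto
        moreover have "real n * \<bar>s\<bar> ^ 3 = \<bar>t\<bar> ^ 3 / ?q"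
        proof -
          have "\<bar>s\<bar> ^ 3 = \<bar>t\<bar> ^ 3 / (?q * ?q * ?q)" using q by (simp add: s_def power_divide power3_eq_cube)
          then show ?thesis using n q(1) unfolding q(2) by simp
        qed
        ultimately show ?thesis by (simp add: s2 add_divide_distrib)
      qed
      have iS: "integrable \<Omega> (\<lambda>w. iexp (s * S n w))" "integrable \<Omega> (\<lambda>w. iexp (s * ?M n w))"
        by (rule \<Omega>.integrable_const_bound[where B=1]; simp)+
      have pw: "norm (iexp (s * S n w) - iexp (s * ?M n w)) \<le> \<bar>s\<bar> * \<bar>b n w\<bar>" for w
      proof -
        have "iexp (s * S n w) - iexp (s * ?M n w) = iexp (s * ?M n w) * (iexp (s * b n w) - 1)"
          by (simp add: S_eq exp_add[symmetric] algebra_simps)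
        then have "norm (iexp (s * S n w) - iexp (s * ?M n w)) = norm (iexp (s * b n w) - 1)"
          by (simp add: norm_mult)
        then show ?thesis using iexp_approx1[of "s * b n w" 0] by (simp add: abs_mult)
      qed
      have "norm (E (\<lambda>w. iexp (s * S n w)) - E (\<lambda>w. iexp (s * ?M n w))) = norm (E (\<lambda>w. iexp (s * S n w) - iexp (s * ?M n w)))"
        using iS by simp
      also have "\<dots> \<le> E (\<lambda>w. norm (iexp (s * S n w) - iexp (s * ?M n w)))" by (rule integral_norm_bound)
      also have "\<dots> \<le> E (\<lambda>w. \<bar>s\<bar> * \<bar>b n w\<bar>)"
        by (intro integral_mono pw integrable_norm Bochner_Integration.integrable_diff iS) (use ib in auto)
      also have "\<dots> \<le> \<bar>s\<bar> * (2 * c1)" using mult_left_mono[OF b_abs[of n], of "\<bar>s\<bar>"] by simp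
      also have "\<dots> = \<bar>t\<bar> * (2 * c1) / ?q" using q by (simp add: s_def)
      finally have 1: "norm (E (\<lambda>w. iexp (s * S n w)) - E (\<lambda>w. iexp (s * ?M n w))) \<le> \<bar>t\<bar> * (2 * c1) / ?q" .
      have "k * (s\<^sup>2 + real n * \<bar>s\<bar> ^ 3) \<le> k * ((t\<^sup>2 + \<bar>t\<bar> ^ 3) / ?q)" using s5 k by (rule mult_left_mono)
      then have 2: "norm (E (\<lambda>w. iexp (s * ?M n w)) - of_real ((1 + x / real n) ^ n)) \<le> k * (t\<^sup>2 + \<bar>t\<bar> ^ 3) / ?q"
        using k_char[OF s1 s3, of n] unfolding s4 by simp
      have "norm (E (\<lambda>w. iexp (s * S n w)) - of_real ((1 + x / real n) ^ n)) \<le> K' / ?q"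
        using norm_triangle_ineq[of "E (\<lambda>w. iexp (s * S n w)) - E (\<lambda>w. iexp (s * ?M n w))"
            "E (\<lambda>w. iexp (s * ?M n w)) - of_real ((1 + x / real n) ^ n)"] 1 2
        by (simp add: K'_def add_divide_distrib)
      moreover have "t * (1 / ?q * S n w) = s * S n w" for w by (simp add: s_def)
      ultimately show ?thesis by simp
    qed
    have "(\<lambda>n. (E (\<lambda>w. iexp (t * (1 / sqrt (real n) * S n w)))) - of_real ((1 + x / real n) ^ n)) \<longlonglongrightarrow> 0"
    proof (rule Lim_null_comparison[OF _ tendsto_const_div_sqrt[of K']])
      have "\<forall>\<^sub>F n in sequentially. n \<ge> (1::nat)" by (rule eventually_ge_at_top)
      moreover have "\<forall>\<^sub>F n in sequentially. sqrt (real n) \<ge> \<bar>t\<bar>"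
        using filterlim_compose[OF sqrt_at_top filterlim_real_sequentially] by (simp add: filterlim_at_top)
      moreover have "\<forall>\<^sub>F n in sequentially. real n \<ge> t\<^sup>2 * \<sigma>2 / 4"
        using filterlim_real_sequentially unfolding filterlim_at_top by blast
      ultimately show "\<forall>\<^sub>F n in sequentially. norm (E (\<lambda>w. iexp (t * (1 / sqrt (real n) * S n w))) - of_real ((1 + x / real n) ^ n)) \<le> K' / sqrt (real n)"
        by eventually_elim (rule diff, auto)
    qed
    moreover have "(\<lambda>n. of_real ((1 + x / real n) ^ n) :: complex) \<longlonglongrightarrow> of_real (exp x)"
      by (intro tendsto_of_real tendsto_exp_limit_sequentially)
    ultimately have "(\<lambda>n. (E (\<lambda>w. iexp (t * (1 / sqrt (real n) * S n w))) - of_real ((1 + x / real n) ^ n)) + of_real ((1 + x / real n) ^ n)) \<longlonglongrightarrow> 0 + of_real (exp x)"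
      by (rule tendsto_add)
    moreover have "x = - (sqrt \<sigma>2 * t)\<^sup>2 / 2" using \<sigma>2 by (simp add: x_def power_mult_distrib mult.commute)
    ultimately show ?thesis by simp
  qed
  have "(\<lambda>n. measure \<Omega> {w \<in> space \<Omega>. 1 / sqrt (real n) * S n w < \<xi>}) \<longlonglongrightarrow> cdf (centred_normal (sqrt \<sigma>2)) \<xi>"
    if "sqrt \<sigma>2 = 0 \<longrightarrow> \<xi> \<noteq> 0" for \<xi>
    by (rule convergence_in_law_centred_normal[OF prob_space_chain _ _ lim_char]) (use that \<sigma>2 in auto)
  then show ?thesis using if_mu iS2 lim_var \<sigma>2 by (intro conjI allI exI[of _ "sqrt \<sigma>2"]) auto
qed

end

section \<open>The pCN chain\<close>

lemma dist2_le_segment: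
  fixes x y :: "'a::real_normed_vector"
  assumes \<eta>: "\<eta> > 0" and \<epsilon>: "\<epsilon> > 0" and xy: "x \<noteq> y"
  shows "dist2 i \<eta> \<epsilon> x y \<le>
    ennreal (1 / \<epsilon> * (exp (\<eta> * max (norm x) (norm y)) * norm (x - y) * (1 + norm x ^ i + norm y ^ i)))"
proof -
  define T where "T = norm (x - y)"
  have T: "T > 0" using xy by (simp add: T_def)
  \<comment> \<open>The straight segment traversed at unit speed is one admissible path. By
    convexity of the norm the integrand along it is bounded in terms of the endpoints.\<close>
  define u where "u = (1 / T) *\<^sub>R (y - x)"
  define \<psi> where "\<psi> t = x + t *\<^sub>R u" for t
  let ?r = "max (norm x) (norm y)"
  have "norm u = 1" using T by (simp add: u_def T_def norm_minus_commute)
  moreover have "\<psi> 0 = x" "\<psi> T = y" using T by (simp_all add: \<psi>_def u_def)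
  moreover have "(\<psi> has_vector_derivative u) (at t within {0..T})" for t
    unfolding \<psi>_def by (auto intro!: derivative_eq_intros)
  ultimately have path: "\<psi> \<in> unit_speed_paths T x y"
    unfolding unit_speed_paths_def by (auto intro!: exI[of _ "\<lambda>_. u"])
  have bound: "norm (\<psi> t) \<le> ?r" if t: "t \<in> {0..T}" for t
  proof -
    have "\<psi> t = (1 - t / T) *\<^sub>R x + (t / T) *\<^sub>R y" by (simp add: \<psi>_def u_def algebra_simps)
    then have "norm (\<psi> t) \<le> (1 - t / T) * norm x + (t / T) * norm y"
      using norm_triangle_ineq[of "(1 - t / T) *\<^sub>R x" "(t / T) *\<^sub>R y"] t T by simp
    also have "\<dots> \<le> (1 - t / T) * ?r + (t / T) * ?r" using t T by (intro add_mono mult_left_mono) auto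
    finally show ?thesis by (simp add: algebra_simps)
  qed
  define c where "c = exp (\<eta> * ?r) * (1 + norm x ^ i + norm y ^ i)"
  have "integral {0..T} (\<lambda>t. exp (\<eta> * norm (\<psi> t)) * (1 + norm (\<psi> t) ^ i)) \<le> integral {0..T} (\<lambda>_. c)"
  proof (rule integral_le)
    show "(\<lambda>t. exp (\<eta> * norm (\<psi> t)) * (1 + norm (\<psi> t) ^ i)) integrable_on {0..T}"
      unfolding \<psi>_def by (intro integrable_continuous_real continuous_intros)
    fix t assume t: "t \<in> {0..T}"
    have "norm (\<psi> t) ^ i \<le> ?r ^ i" using bound[OF t] by (intro power_mono) auto
    also have "?r ^ i \<le> norm x ^ i + norm y ^ i" by (auto simp: max_def)
    finally show "exp (\<eta> * norm (\<psi> t)) * (1 + norm (\<psi> t) ^ i) \<le> c"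
      unfolding c_def using bound[OF t] \<eta> by (intro mult_mono) auto
  qed auto
  also have "\<dots> = T * c" using T by simp
  finally have "1 / \<epsilon> * integral {0..T} (\<lambda>t. exp (\<eta> * norm (\<psi> t)) * (1 + norm (\<psi> t) ^ i)) \<le> 1 / \<epsilon> * (T * c)"
    using \<epsilon> by (intro mult_left_mono) auto
  moreover have "dist2 i \<eta> \<epsilon> x y \<le> ennreal (1 / \<epsilon> * integral {0..T} (\<lambda>t. exp (\<eta> * norm (\<psi> t)) * (1 + norm (\<psi> t) ^ i)))"
    unfolding dist2_def using path T by (intro INF_lower2[of "(T, \<psi>)"]) auto
  ultimately show ?thesis
    by (auto simp: c_def T_def ac_simps intro: order_trans ennreal_leI)
qed

lemma dist0_le:
  fixes x y :: "'a::real_normed_vector"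
  assumes \<eta>: "\<eta> > 0" and \<epsilon>: "\<epsilon> > 0"
  shows "dist0 i \<eta> \<epsilon> x y \<le>
    (1 + norm x ^ i + norm y ^ i) * min 1 (exp (\<eta> * max (norm x) (norm y)) * norm (x - y) / \<epsilon>)"
proof (cases "x = y")
  case True
  then show ?thesis by (simp add: dist0_def dist1_def enn2real_mono[of _ 0, simplified])
next
  case False
  let ?v = "1 + norm x ^ i + norm y ^ i" and ?t = "exp (\<eta> * max (norm x) (norm y)) * norm (x - y)"
  have v: "?v \<ge> 1" by simp
  have "min (ennreal (dist1 i x y)) (dist2 i \<eta> \<epsilon> x y) \<le> min (ennreal ?v) (ennreal (1 / \<epsilon> * (?t * ?v)))"
    using dist2_le_segment[OF \<eta> \<epsilon> False] False by (intro min.mono) (auto simp: dist1_def)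
  also have "\<dots> = ennreal (min ?v (1 / \<epsilon> * (?t * ?v)))" by (rule min_ennreal) (use v \<epsilon> in auto)
  finally have "dist0 i \<eta> \<epsilon> x y \<le> min ?v (1 / \<epsilon> * (?t * ?v))"
    unfolding dist0_def using v \<epsilon> by (intro enn2real_leI) auto
  also have "1 / \<epsilon> * (?t * ?v) = ?v * (?t / \<epsilon>)" by simp
  also have "min ?v (?v * (?t / \<epsilon>)) = ?v * min 1 (?t / \<epsilon>)"
  proof -
    have "min a (a * b) = a * min 1 b" if "a \<ge> 0" for a b :: real
      using that mult_left_mono[of 1 b a] mult_left_mono[of b 1 a] by (cases "b \<le> 1") (auto simp: min_def)
    from this[of ?v "?t / \<epsilon>"] show ?thesis using v by linarith
  qed
  finally show ?thesis .
qed

lemma dist'_bounds: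
  fixes x y :: "'a::real_normed_vector"
  shows "0 \<le> dist' i \<eta> \<epsilon> x y" "dist' i \<eta> \<epsilon> x y \<le> sqrt (dist0 i \<eta> \<epsilon> x y)"
proof -
  let ?S = "{\<Sum>j=1..n-1. dist0 i \<eta> \<epsilon> (z j) (z (j + 1)) | (n::nat) (z::nat \<Rightarrow> 'a). 2 \<le> n \<and> z 1 = x \<and> z n = y}"
  \<comment> \<open>The chain with only two points; positions are numbered from 1.\<close>
  have "dist0 i \<eta> \<epsilon> x y \<in> ?S"
    by (rule CollectI, rule exI[of _ 2], rule exI[of _ "\<lambda>j. if j \<le> 1 then x else y"]) simp
  moreover have "0 \<le> t" if "t \<in> ?S" for t
    using that by (auto intro!: sum_nonneg simp: dist0_def)
  ultimately have "0 \<le> Inf ?S" "Inf ?S \<le> dist0 i \<eta> \<epsilon> x y"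
    by (blast intro: cInf_greatest, intro cInf_lower bdd_belowI[of _ 0])
  then show "0 \<le> dist' i \<eta> \<epsilon> x y" "dist' i \<eta> \<epsilon> x y \<le> sqrt (dist0 i \<eta> \<epsilon> x y)"
    unfolding dist'_def by simp_all
qed

text \<open>Both \<open>min 1 t\<close> and \<open>\<phi>\<close> are bounded and linear near 0, and
  \<open>min 1 t \<le> 2 * (1 - exp (- t))\<close>. The exponent \<open>Suc i\<close> replaces
  \<open>i\<close> because the drift estimates ask for an exponent of at least 1, which
  \<open>i = 0\<close> would violate. The constant \<open>c\<close> collects a factor 3 from this
  change of exponent, 2 from \<open>\<phi>\<close>, and \<open>max 1 (1 / \<epsilon>)\<close> from
  the scale of the metric.\<close>

lemma (in contracting_random_map) lipschitz_dist'_imp_dlip: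
  assumes \<epsilon>: "\<epsilon> > 0" and f: "lipschitz_wrt (dist' i \<eta> \<epsilon>) f"
  shows "\<exists>L. dlip (Suc i) L f"
proof -
  obtain L where L: "\<And>x y. \<bar>f x - f y\<bar> \<le> L * dist' i \<eta> \<epsilon> x y" using f by (auto simp: lipschitz_wrt_def)
  define c where "c = 6 * max 1 (1 / \<epsilon>)"
  have d0: "dist0 i \<eta> \<epsilon> x y \<le> c * (\<phi> x y * (1 + 1 * (norm x ^ Suc i + norm y ^ Suc i)))" for x y
  proof -
    let ?t = "wdist x y"
    have "min 1 (?t / \<epsilon>) \<le> max 1 (1 / \<epsilon>) * min 1 ?t"
    proof (cases "?t \<le> 1")
      case True
      have "?t / \<epsilon> = 1 / \<epsilon> * ?t" by simp
      also have "\<dots> \<le> max 1 (1 / \<epsilon>) * ?t" using wdist_nonneg[of x y] by (intro mult_right_mono) auto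
      finally show ?thesis using True by (simp add: min.coboundedI2)
    qed (simp add: min.coboundedI1)
    also have "min 1 ?t \<le> 2 * \<phi> x y"
    proof -
      have e: "exp (- \<Lambda> * ?t) \<le> exp (- ?t)" using Lambda(1) wdist_nonneg[of x y] mult_right_mono[of 1 \<Lambda> ?t] by simp
      have "exp ?t * (2 - min 1 ?t) \<ge> 2"
      proof -
        have "(1 + ?t) * (2 - min 1 ?t) \<ge> 2" using wdist_nonneg[of x y] by (auto simp: min_def algebra_simps mult_left_le)
        moreover have "(1 + ?t) * (2 - min 1 ?t) \<le> exp ?t * (2 - min 1 ?t)"
          using exp_ge_add_one_self by (intro mult_right_mono) auto
        ultimately show ?thesis by linarith
      qed
      then have "2 * exp (- ?t) \<le> exp (- ?t) * (exp ?t * (2 - min 1 ?t))" by simp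
      also have "\<dots> = 2 - min 1 ?t" by (simp add: exp_minus)
      finally have "2 * exp (- ?t) \<le> 2 - min 1 ?t" .
      then show ?thesis using e unfolding \<phi>_def right_diff_distrib by linarith
    qed
    finally have m: "min 1 (?t / \<epsilon>) \<le> max 1 (1 / \<epsilon>) * (2 * \<phi> x y)" by (simp add: mult_left_mono)
    have p: "a ^ i \<le> 1 + a ^ Suc i" if "a \<ge> 0" for a :: real
    proof (cases "a \<le> 1")
      case True
      then have "a ^ i \<le> 1" using that by (simp add: power_le_one)
      then show ?thesis using that by (simp add: add_increasing2)
    next
      case False
      then have "a ^ i \<le> a ^ Suc i" by (intro power_increasing) auto
      then show ?thesis by simp
    qed
    have v: "1 + norm x ^ i + norm y ^ i \<le> 3 * (1 + 1 * (norm x ^ Suc i + norm y ^ Suc i))"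
    proof -
      have "0 \<le> norm x ^ Suc i" "0 \<le> norm y ^ Suc i" by simp_all
      then show ?thesis
        using p[OF norm_ge_zero, of x] p[OF norm_ge_zero, of y] unfolding mult_1_left distrib_left by linarith
    qed
    have "dist0 i \<eta> \<epsilon> x y \<le> (1 + norm x ^ i + norm y ^ i) * min 1 (?t / \<epsilon>)"
      using dist0_le[OF eta \<epsilon>] by (simp add: wdist_def)
    also have "\<dots> \<le> (3 * (1 + 1 * (norm x ^ Suc i + norm y ^ Suc i))) * (max 1 (1 / \<epsilon>) * (2 * \<phi> x y))"
      using \<epsilon> wdist_nonneg[of x y] by (intro mult_mono v m) auto
    also have "\<dots> = c * (\<phi> x y * (1 + 1 * (norm x ^ Suc i + norm y ^ Suc i)))" by (simp add: c_def)
    finally show ?thesis .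
  qed
  have "\<bar>f x - f y\<bar> \<le> \<bar>L\<bar> * sqrt c * wsemi 1 (Suc i) x y" for x y
  proof -
    have "dist' i \<eta> \<epsilon> x y \<le> sqrt (dist0 i \<eta> \<epsilon> x y)" by (rule dist'_bounds(2))
    also have "\<dots> \<le> sqrt (c * (\<phi> x y * (1 + 1 * (norm x ^ Suc i + norm y ^ Suc i))))" by (rule real_sqrt_le_mono[OF d0])
    also have "\<dots> = sqrt c * wsemi 1 (Suc i) x y" unfolding wsemi_def by (rule real_sqrt_mult)
    finally have d: "dist' i \<eta> \<epsilon> x y \<le> sqrt c * wsemi 1 (Suc i) x y" .
    have "L * dist' i \<eta> \<epsilon> x y \<le> \<bar>L\<bar> * dist' i \<eta> \<epsilon> x y" using dist'_bounds(1) by (intro mult_right_mono) auto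
    also have "\<dots> \<le> \<bar>L\<bar> * (sqrt c * wsemi 1 (Suc i) x y)" using d by (intro mult_left_mono) auto
    finally show ?thesis using L[of x y] by (simp add: mult.assoc)
  qed
  moreover have "c \<ge> 0" by (simp add: c_def)
  ultimately show ?thesis by (intro exI[of _ "\<bar>L\<bar> * sqrt c"]) (simp add: dlip_def)
qed

section \<open>Acceptance probabilities and the shared uniform variable\<close>

lemma acceptance_bounds: "0 \<le> acceptance \<Phi> x y" "acceptance \<Phi> x y \<le> 1"
  by (auto simp: acceptance_def)

text \<open>The truncated exponential is \<open>exp (min 0 a)\<close>, and the exponential has slope
  at most 1 on the negative half-line.\<close>

lemma acceptance_lipschitz: "\<bar>min 1 (exp a) - min 1 (exp b)\<bar> \<le> \<bar>a - b :: real\<bar>"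
proof -
  have e: "min 1 (exp a) = exp (min 0 a)" for a :: real by (simp add: min_def)
  have *: "\<bar>exp u - exp v\<bar> \<le> v - u" if "u \<le> v" "v \<le> 0" for u v :: real
  proof -
    have "exp v - exp u = exp v * (1 - exp (u - v))" by (simp add: algebra_simps exp_diff)
    also have "\<dots> \<le> 1 * (1 - exp (u - v))" using that by (intro mult_right_mono) auto
    also have "\<dots> \<le> v - u" using exp_ge_add_one_self[of "u - v"] unfolding mult_1_left by linarith
    finally show ?thesis using that by simp
  qed
  have "\<bar>exp u - exp v\<bar> \<le> \<bar>u - v\<bar>" if "u \<le> 0" "v \<le> 0" for u v :: real
    using *[of u v] *[of v u] that by linarith
  then have "\<bar>exp (min 0 a) - exp (min 0 b)\<bar> \<le> \<bar>min 0 a - min 0 b\<bar>" by simp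
  also have "\<dots> \<le> \<bar>a - b\<bar>" by (auto simp: min_def)
  finally show ?thesis by (simp only: e)
qed

abbreviation unif :: "real measure" where "unif \<equiv> uniform_measure lborel {0..1}"

lemma prob_space_unif: "prob_space unif"
  by (rule prob_space_uniform_measure) auto

lemma sets_unif [measurable_cong]: "sets unif = sets borel"
  by simp

lemma emeasure_unif_atMost:
  assumes "0 \<le> a" "a \<le> 1"
  shows "emeasure unif {..a} = ennreal a" "emeasure unif {a<..} = ennreal (1 - a)"
proof -
  have "{0..1} \<inter> {..a} = {0..a}" "{0..1} \<inter> {a<..} = {a<..1}" using assms by auto
  then show "emeasure unif {..a} = ennreal a" "emeasure unif {a<..} = ennreal (1 - a)"
    using assms by (simp_all add: divide_ennreal_def)
qed

text \<open>Two decisions based on the same uniform variable differ only if it falls between their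
  thresholds.\<close>

lemma emeasure_unif_separates:
  assumes "{u. (u \<le> a) \<noteq> (u \<le> b)} \<in> sets borel"
  shows "emeasure unif {u. (u \<le> a) \<noteq> (u \<le> b)} \<le> ennreal \<bar>a - b\<bar>"
proof -
  have "emeasure unif {u. (u \<le> a) \<noteq> (u \<le> b)} = emeasure lborel ({0..1} \<inter> {u. (u \<le> a) \<noteq> (u \<le> b)})"
    using assms by (simp add: divide_ennreal_def)
  also have "\<dots> \<le> emeasure lborel {min a b..max a b}" by (rule emeasure_mono) auto
  also have "\<dots> = ennreal \<bar>a - b\<bar>" by (simp add: min_def max_def abs_if)
  finally show ?thesis .
qed

section \<open>The pCN transition as a random map\<close>

definition pcn_step :: "('a::real_inner \<Rightarrow> real) \<Rightarrow> real \<Rightarrow> 'a \<Rightarrow> 'a \<times> real \<Rightarrow> 'a" where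
  "pcn_step \<Phi> \<delta> x = (\<lambda>(\<xi>, u). if u \<le> acceptance \<Phi> x (pcn_proposal \<delta> x \<xi>) then pcn_proposal \<delta> x \<xi> else x)"

lemma pcn_kernel_eq: "pcn_kernel \<gamma> \<Phi> \<delta> = (\<lambda>x. distr (\<gamma> \<Otimes>\<^sub>M unif) borel (pcn_step \<Phi> \<delta> x))"
  by (simp add: fun_eq_iff pcn_kernel_def pcn_step_def)

locale pcn = gaussian \<gamma> for \<gamma> :: "'a::{real_inner, second_countable_topology} measure" +
  fixes \<Phi> :: "'a \<Rightarrow> real" and \<delta> :: real
  assumes delta: "0 < \<delta>" "\<delta> \<le> 1 / 2"
    and integrable_density: "integrable \<gamma> (\<lambda>x. exp (- \<Phi> x))"
    and local_lipschitz: "\<And>\<kappa>. \<kappa> > 0 \<Longrightarrow> \<exists>C\<ge>0. \<forall>x y.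
      \<bar>\<Phi> x - \<Phi> y\<bar> \<le> C * (exp (\<kappa> * max (norm x) (norm y)) * norm (x - y))"
    and uniform_acceptance: "\<And>K. K \<ge> 0 \<Longrightarrow> \<exists>p>0. \<forall>x \<zeta>. norm \<zeta> \<le> K \<longrightarrow>
      p \<le> acceptance \<Phi> x (sqrt (1 - 2 * \<delta>) *\<^sub>R x + \<zeta>)"
begin

lemma Phi_measurable [measurable]: "\<Phi> \<in> borel_measurable borel"
proof -
  obtain C where C: "C \<ge> 0" "\<And>x y. \<bar>\<Phi> x - \<Phi> y\<bar> \<le> C * (exp (1 * max (norm x) (norm y)) * norm (x - y))"
    using local_lipschitz[of 1] by auto
  have "isCont \<Phi> x" for x
  proof -
    have "((\<lambda>y. C * (exp (1 * max (norm y) (norm x)) * norm (y - x))) \<longlongrightarrow> C * (exp (1 * max (norm x) (norm x)) * norm (x - x))) (at x)"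
      by (intro tendsto_intros)
    then have "((\<lambda>y. C * (exp (1 * max (norm y) (norm x)) * norm (y - x))) \<longlongrightarrow> 0) (at x)" by simp
    then have "((\<lambda>y. \<Phi> y - \<Phi> x) \<longlongrightarrow> 0) (at x)"
      by (rule Lim_null_comparison[rotated]) (use C(2) in auto)
    then show ?thesis by (simp add: isCont_def Lim_null[symmetric])
  qed
  then show ?thesis by (intro borel_measurable_continuous_onI continuous_at_imp_continuous_on) auto
qed

sublocale unif: prob_space unif by (rule prob_space_unif)
sublocale noise: pair_prob_space \<gamma> unif ..

abbreviation "\<Theta> \<equiv> \<gamma> \<Otimes>\<^sub>M unif"
abbreviation "\<mu> \<equiv> target_measure \<gamma> \<Phi>"
abbreviation "c1 \<equiv> sqrt (1 - 2 * \<delta>)"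
abbreviation "c2 \<equiv> sqrt (2 * \<delta>)"

lemma proposal_coefficients: "0 \<le> c1" "c1 < 1" "0 < c2" "c1\<^sup>2 + c2\<^sup>2 = 1"
  using delta by auto

lemma proposal_measurable [measurable]:
  fixes f g :: "'b \<Rightarrow> 'a"
  assumes [measurable]: "f \<in> borel_measurable M" "g \<in> borel_measurable M"
  shows "(\<lambda>w. pcn_proposal \<delta> (f w) (g w)) \<in> M \<rightarrow>\<^sub>M borel"
  unfolding pcn_proposal_def by measurable

lemma acceptance_measurable [measurable]:
  fixes f g :: "'b \<Rightarrow> 'a"
  assumes [measurable]: "f \<in> borel_measurable M" "g \<in> borel_measurable M"
  shows "(\<lambda>w. acceptance \<Phi> (f w) (g w)) \<in> borel_measurable M"
  unfolding acceptance_def by measurable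

lemma step_measurable: "case_prod (pcn_step \<Phi> \<delta>) \<in> borel \<Otimes>\<^sub>M \<Theta> \<rightarrow>\<^sub>M borel"
proof -
  have "case_prod (pcn_step \<Phi> \<delta>) = (\<lambda>p. if snd (snd p) \<le> acceptance \<Phi> (fst p) (pcn_proposal \<delta> (fst p) (fst (snd p)))
      then pcn_proposal \<delta> (fst p) (fst (snd p)) else fst p)"
    by (auto simp: pcn_step_def fun_eq_iff)
  also have "\<dots> \<in> borel \<Otimes>\<^sub>M \<Theta> \<rightarrow>\<^sub>M borel" by measurable
  finally show ?thesis .
qed

lemma step_measurable' [measurable]: "pcn_step \<Phi> \<delta> x \<in> \<Theta> \<rightarrow>\<^sub>M borel"
  using measurable_Pair2[OF step_measurable, of x] by simp

lemma proposal_norm: "norm (pcn_proposal \<delta> x \<xi>) \<le> c1 * norm x + c2 * norm \<xi>"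
  using norm_triangle_ineq[of "c1 *\<^sub>R x" "c2 *\<^sub>R \<xi>"] proposal_coefficients by (simp add: pcn_proposal_def)

lemma proposal_diff: "norm (pcn_proposal \<delta> x \<xi> - pcn_proposal \<delta> y \<xi>) = c1 * norm (x - y)"
  using proposal_coefficients by (simp add: pcn_proposal_def scaleR_diff_right[symmetric])

lemma normalisation: "0 < (\<integral>x. exp (- \<Phi> x) \<partial>\<gamma>)"
proof -
  have "(\<integral>x. exp (- \<Phi> x) \<partial>\<gamma>) \<noteq> 0"
  proof
    assume "(\<integral>x. exp (- \<Phi> x) \<partial>\<gamma>) = 0"
    then have "AE x in \<gamma>. exp (- \<Phi> x) = 0"
      using integrable_density by (subst (asm) integral_nonneg_eq_0_iff_AE) auto
    then show False by simp
  qed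
  then show ?thesis unfolding less_le by auto
qed

definition dens :: "'a \<Rightarrow> ennreal" where
  "dens x = ennreal (exp (- \<Phi> x) / (\<integral>y. exp (- \<Phi> y) \<partial>\<gamma>))"

lemma dens_measurable [measurable]: "dens \<in> borel_measurable borel"
  unfolding dens_def[abs_def] by measurable

lemma mu_eq: "\<mu> = density \<gamma> dens"
  by (simp add: target_measure_def dens_def[abs_def])

lemma sets_mu: "sets \<mu> = sets borel"
  by (simp add: mu_eq)

lemma prob_space_mu: "prob_space \<mu>"
proof (rule prob_spaceI)
  have "emeasure \<mu> (space \<mu>) = (\<integral>\<^sup>+x. dens x \<partial>\<gamma>)"
    by (simp add: mu_eq emeasure_density)
  also have "\<dots> = ennreal (\<integral>x. exp (- \<Phi> x) / (\<integral>y. exp (- \<Phi> y) \<partial>\<gamma>) \<partial>\<gamma>)"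
    unfolding dens_def using normalisation integrable_density by (intro nn_integral_eq_integral) auto
  also have "\<dots> = 1" using normalisation by simp
  finally show "emeasure \<mu> (space \<mu>) = 1" .
qed

text \<open>The Metropolis rule: up to the normalising constant both sides are the smaller of
  \<open>exp (- \<Phi> x)\<close> and \<open>exp (- \<Phi> y)\<close>.\<close>

lemma detailed_balance:
  "dens x * ennreal (acceptance \<Phi> x y) = dens y * ennreal (acceptance \<Phi> y x)"
proof -
  have "exp (- a) * min 1 (exp (a - b)) = exp (- b) * min 1 (exp (b - a))" for a b :: real
    by (auto simp: min_def exp_add[symmetric])
  then have eq: "exp (- \<Phi> x) / K * acceptance \<Phi> x y = exp (- \<Phi> y) / K * acceptance \<Phi> y x" for K
    by (simp add: acceptance_def)
  then show ?thesis
    unfolding dens_def by (simp only: ennreal_mult''[OF acceptance_bounds(1), symmetric] eq)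
qed

text \<open>Integrating out the uniform variable separates accepted moves from rejections.
  Exchangeability of state and proposal together with detailed balance turns the mass accepted into
  \<open>S\<close> into the mass accepted when starting in \<open>S\<close>; with the rejections
  from \<open>S\<close> this adds up to the mass of \<open>S\<close>.\<close>

lemma mu_invariant: "distr (\<mu> \<Otimes>\<^sub>M \<Theta>) borel (case_prod (pcn_step \<Phi> \<delta>)) = \<mu>"
proof (rule measure_eqI)
  fix S assume "S \<in> sets (distr (\<mu> \<Otimes>\<^sub>M \<Theta>) borel (case_prod (pcn_step \<Phi> \<delta>)))"
  then have S [measurable]: "S \<in> sets borel" by simp
  let ?F = "case_prod (pcn_step \<Phi> \<delta>)"
  let ?A = "\<lambda>x \<xi>. acceptance \<Phi> x (pcn_proposal \<delta> x \<xi>)"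
  have F: "?F \<in> \<mu> \<Otimes>\<^sub>M \<Theta> \<rightarrow>\<^sub>M borel"
    using step_measurable by (simp cong: measurable_cong_sets sets_pair_measure_cong add: sets_mu)
  have inner: "(\<integral>\<^sup>+u. indicator S (pcn_step \<Phi> \<delta> x (\<xi>, u)) \<partial>unif) =
      ennreal (?A x \<xi>) * indicator S (pcn_proposal \<delta> x \<xi>) + ennreal (1 - ?A x \<xi>) * indicator S x" for x \<xi>
  proof -
    have "(\<integral>\<^sup>+u. indicator S (pcn_step \<Phi> \<delta> x (\<xi>, u)) \<partial>unif) =
       (\<integral>\<^sup>+u. indicator S (pcn_proposal \<delta> x \<xi>) * indicator {..?A x \<xi>} u + indicator S x * indicator {?A x \<xi><..} u \<partial>unif)"
      by (rule nn_integral_cong) (auto simp: pcn_step_def indicator_def)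
    also have "\<dots> = indicator S (pcn_proposal \<delta> x \<xi>) * emeasure unif {..?A x \<xi>} + indicator S x * emeasure unif {?A x \<xi><..}"
      by (subst nn_integral_add) (auto simp: nn_integral_cmult_indicator simp del: emeasure_uniform_measure)
    also have "\<dots> = ennreal (?A x \<xi>) * indicator S (pcn_proposal \<delta> x \<xi>) + ennreal (1 - ?A x \<xi>) * indicator S x"
      by (simp only: emeasure_unif_atMost[OF acceptance_bounds] mult.commute)
    finally show ?thesis .
  qed
  define W where "W = (\<lambda>p. dens (fst p) * (ennreal (acceptance \<Phi> (fst p) (snd p)) * indicator S (snd p)))"
  have W [measurable]: "W \<in> borel_measurable (borel \<Otimes>\<^sub>M borel)" unfolding W_def by measurable
  let ?prp = "\<lambda>p. c1 *\<^sub>R fst p + c2 *\<^sub>R snd p"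
  have prp: "pcn_proposal \<delta> (fst p) (snd p) = ?prp p" for p by (simp add: pcn_proposal_def)
  have "emeasure (distr (\<mu> \<Otimes>\<^sub>M \<Theta>) borel ?F) S = (\<integral>\<^sup>+p. indicator S (?F p) \<partial>(\<mu> \<Otimes>\<^sub>M \<Theta>))"
    by (subst nn_integral_indicator[symmetric], simp, subst nn_integral_distr[OF F]) auto
  also have "\<dots> = (\<integral>\<^sup>+x. \<integral>\<^sup>+w. indicator S (?F (x, w)) \<partial>\<Theta> \<partial>\<mu>)"
    by (rule noise.P.nn_integral_fst[symmetric]) (use measurable_compose[OF F borel_measurable_indicator[OF S]] in simp)
  also have "\<dots> = (\<integral>\<^sup>+x. dens x * (\<integral>\<^sup>+w. indicator S (pcn_step \<Phi> \<delta> x w) \<partial>\<Theta>) \<partial>\<gamma>)"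
  proof -
    have "(\<lambda>x. \<integral>\<^sup>+w. indicator S (?F (x, w)) \<partial>\<Theta>) \<in> borel_measurable borel"
      by (rule noise.P.borel_measurable_nn_integral_fst)
        (use measurable_compose[OF step_measurable borel_measurable_indicator[OF S]] in simp)
    then show ?thesis unfolding mu_eq by (subst nn_integral_density) auto
  qed
  also have "\<dots> = (\<integral>\<^sup>+x. dens x * (\<integral>\<^sup>+\<xi>. \<integral>\<^sup>+u. indicator S (pcn_step \<Phi> \<delta> x (\<xi>, u)) \<partial>unif \<partial>\<gamma>) \<partial>\<gamma>)"
    by (subst unif.nn_integral_fst) auto
  also have "\<dots> = (\<integral>\<^sup>+x. \<integral>\<^sup>+\<xi>. W (x, pcn_proposal \<delta> x \<xi>) + dens x * (ennreal (1 - ?A x \<xi>) * indicator S x) \<partial>\<gamma> \<partial>\<gamma>)"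
    unfolding inner W_def by (subst nn_integral_cmult[symmetric]) (auto simp: distrib_left)
  also have "\<dots> = (\<integral>\<^sup>+p. W (fst p, ?prp p) + dens (fst p) * (ennreal (1 - ?A (fst p) (snd p)) * indicator S (fst p)) \<partial>(\<gamma> \<Otimes>\<^sub>M \<gamma>))"
    by (subst nn_integral_fst[symmetric]) (auto simp: pcn_proposal_def)
  also have "\<dots> = (\<integral>\<^sup>+p. W (fst p, ?prp p) \<partial>(\<gamma> \<Otimes>\<^sub>M \<gamma>)) +
      (\<integral>\<^sup>+p. dens (fst p) * (ennreal (1 - ?A (fst p) (snd p)) * indicator S (fst p)) \<partial>(\<gamma> \<Otimes>\<^sub>M \<gamma>))"
    by (rule nn_integral_add) measurable
  also have "(\<integral>\<^sup>+p. W (fst p, ?prp p) \<partial>(\<gamma> \<Otimes>\<^sub>M \<gamma>)) = (\<integral>\<^sup>+p. W (?prp p, fst p) \<partial>(\<gamma> \<Otimes>\<^sub>M \<gamma>))"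
    by (rule gaussian_exchangeable[OF proposal_coefficients(4) W])
  also have "\<dots> = (\<integral>\<^sup>+p. dens (fst p) * (ennreal (?A (fst p) (snd p)) * indicator S (fst p)) \<partial>(\<gamma> \<Otimes>\<^sub>M \<gamma>))"
    by (rule nn_integral_cong) (simp add: W_def prp mult.assoc[symmetric] detailed_balance)
  also have "\<dots> + (\<integral>\<^sup>+p. dens (fst p) * (ennreal (1 - ?A (fst p) (snd p)) * indicator S (fst p)) \<partial>(\<gamma> \<Otimes>\<^sub>M \<gamma>)) =
     (\<integral>\<^sup>+p. dens (fst p) * (ennreal (?A (fst p) (snd p)) * indicator S (fst p)) +
        dens (fst p) * (ennreal (1 - ?A (fst p) (snd p)) * indicator S (fst p)) \<partial>(\<gamma> \<Otimes>\<^sub>M \<gamma>))"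
    by (rule nn_integral_add[symmetric]) measurable
  also have "\<dots> = (\<integral>\<^sup>+p. dens (fst p) * indicator S (fst p) \<partial>(\<gamma> \<Otimes>\<^sub>M \<gamma>))"
  proof (rule nn_integral_cong)
    fix p :: "'a \<times> 'a"
    have "ennreal (?A (fst p) (snd p)) + ennreal (1 - ?A (fst p) (snd p)) = 1"
      using acceptance_bounds by (subst ennreal_plus[symmetric]) auto
    then show "dens (fst p) * (ennreal (?A (fst p) (snd p)) * indicator S (fst p)) +
        dens (fst p) * (ennreal (1 - ?A (fst p) (snd p)) * indicator S (fst p)) = dens (fst p) * indicator S (fst p)"
      by (simp only: distrib_left[symmetric] distrib_right[symmetric] mult_1_left)
  qed
  also have "\<dots> = (\<integral>\<^sup>+x. dens x * indicator S x \<partial>\<gamma>)"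
    by (subst nn_integral_fst[symmetric]) (auto simp: emeasure_space_1[simplified])
  also have "\<dots> = emeasure \<mu> S" unfolding mu_eq by (subst emeasure_density) auto
  finally show "emeasure (distr (\<mu> \<Otimes>\<^sub>M \<Theta>) borel ?F) S = emeasure \<mu> S" .
qed (simp add: sets_mu)

text \<open>With common noise two proposals are no farther apart than their states, and the same
  holds trivially after two rejections, so the copies can separate only if their decisions differ.
  The acceptance probabilities differ by at most the increments of \<open>\<Phi>\<close> between the
  states and between the proposals. The proposals bring in the factor
  \<open>exp (\<eta> * (c2 * norm \<xi>))\<close>, whose integral is finite by assumption.\<close>

lemma mismatch_bound:
  assumes \<eta>: "\<eta> > 0" and int: "integrable \<gamma> (\<lambda>\<xi>. exp (\<eta> * (c2 * norm \<xi>)))"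
  shows "\<exists>C\<ge>0. \<forall>x y. noise.P.prob {w \<in> space \<Theta>. norm (pcn_step \<Phi> \<delta> x w - pcn_step \<Phi> \<delta> y w) > norm (x - y)}
      \<le> C * (exp (\<eta> * max (norm x) (norm y)) * norm (x - y))"
proof -
  obtain C where C: "C \<ge> 0" "\<And>x y. \<bar>\<Phi> x - \<Phi> y\<bar> \<le> C * (exp (\<eta> * max (norm x) (norm y)) * norm (x - y))"
    using local_lipschitz[OF \<eta>] by blast
  define E where "E = (\<integral>\<xi>. exp (\<eta> * (c2 * norm \<xi>)) \<partial>\<gamma>)"
  have E: "E \<ge> 0" by (simp add: E_def)
  have main: "noise.P.prob {w \<in> space \<Theta>. norm (pcn_step \<Phi> \<delta> x w - pcn_step \<Phi> \<delta> y w) > norm (x - y)}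
      \<le> C * (1 + E) * (exp (\<eta> * max (norm x) (norm y)) * norm (x - y))" for x y
  proof -
    let ?t = "exp (\<eta> * max (norm x) (norm y)) * norm (x - y)"
    let ?px = "\<lambda>\<xi>. pcn_proposal \<delta> x \<xi>" and ?py = "\<lambda>\<xi>. pcn_proposal \<delta> y \<xi>"
    let ?ax = "\<lambda>\<xi>. acceptance \<Phi> x (?px \<xi>)" and ?ay = "\<lambda>\<xi>. acceptance \<Phi> y (?py \<xi>)"
    let ?D = "{w \<in> space \<Theta>. norm (pcn_step \<Phi> \<delta> x w - pcn_step \<Phi> \<delta> y w) > norm (x - y)}"
    let ?Q = "{w. (snd w \<le> ?ax (fst w)) \<noteq> (snd w \<le> ?ay (fst w))}"
    have "Measurable.pred \<Theta> (\<lambda>w. (snd w \<le> ?ax (fst w)) \<noteq> (snd w \<le> ?ay (fst w)))" by measurable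
    then have Q: "?Q \<in> sets \<Theta>" by (simp add: pred_def space_pair_measure)
    have diff: "\<bar>?ax \<xi> - ?ay \<xi>\<bar> \<le> C * ?t * (1 + exp (\<eta> * (c2 * norm \<xi>)))" for \<xi>
    proof -
      have "\<bar>?ax \<xi> - ?ay \<xi>\<bar> \<le> \<bar>(\<Phi> x - \<Phi> (?px \<xi>)) - (\<Phi> y - \<Phi> (?py \<xi>))\<bar>"
        unfolding acceptance_def by (rule acceptance_lipschitz)
      also have "\<dots> \<le> \<bar>\<Phi> x - \<Phi> y\<bar> + \<bar>\<Phi> (?px \<xi>) - \<Phi> (?py \<xi>)\<bar>" by linarith
      also have "\<bar>\<Phi> (?px \<xi>) - \<Phi> (?py \<xi>)\<bar> \<le> C * (exp (\<eta> * max (norm (?px \<xi>)) (norm (?py \<xi>))) * norm (?px \<xi> - ?py \<xi>))"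
        by (rule C(2))
      also have "\<dots> \<le> C * (exp (\<eta> * (max (norm x) (norm y) + c2 * norm \<xi>)) * norm (x - y))"
      proof (intro mult_left_mono mult_mono C(1))
        have shrink: "c1 * norm z \<le> norm z" for z :: 'a using proposal_coefficients mult_right_mono[of c1 1 "norm z"] by simp
        have "max (norm (?px \<xi>)) (norm (?py \<xi>)) \<le> max (norm x) (norm y) + c2 * norm \<xi>"
          using proposal_norm[of x \<xi>] proposal_norm[of y \<xi>] shrink[of x] shrink[of y] by linarith
        then show "exp (\<eta> * max (norm (?px \<xi>)) (norm (?py \<xi>))) \<le> exp (\<eta> * (max (norm x) (norm y) + c2 * norm \<xi>))"
          using \<eta> by simp
        show "norm (?px \<xi> - ?py \<xi>) \<le> norm (x - y)"
          unfolding proposal_diff using proposal_coefficients mult_right_mono[of c1 1 "norm (x - y)"] by simp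
      qed auto
      also have "\<dots> = C * ?t * exp (\<eta> * (c2 * norm \<xi>))" by (simp add: distrib_left exp_add)
      finally show ?thesis using C(2)[of x y] by (simp add: distrib_left)
    qed
    have "?D \<subseteq> ?Q"
    proof
      fix w assume "w \<in> ?D"
      then have n: "norm (pcn_step \<Phi> \<delta> x w - pcn_step \<Phi> \<delta> y w) > norm (x - y)" by simp
      obtain \<xi> u where w: "w = (\<xi>, u)" by (cases w)
      have "norm (?px \<xi> - ?py \<xi>) \<le> norm (x - y)"
        unfolding proposal_diff using proposal_coefficients mult_right_mono[of c1 1 "norm (x - y)"] by simp
      with n show "w \<in> ?Q" unfolding w by (auto simp: pcn_step_def split: if_splits)
    qed
    then have "emeasure \<Theta> ?D \<le> emeasure \<Theta> ?Q" using Q by (rule emeasure_mono)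
    also have "\<dots> = (\<integral>\<^sup>+\<xi>. emeasure unif (Pair \<xi> -` ?Q) \<partial>\<gamma>)" by (rule unif.emeasure_pair_measure_alt[OF Q])
    also have "\<dots> \<le> (\<integral>\<^sup>+\<xi>. ennreal (C * ?t * (1 + exp (\<eta> * (c2 * norm \<xi>)))) \<partial>\<gamma>)"
    proof (rule nn_integral_mono)
      fix \<xi>
      have "Pair \<xi> -` ?Q = {u. (u \<le> ?ax \<xi>) \<noteq> (u \<le> ?ay \<xi>)}" by auto
      moreover have "{u. (u \<le> ?ax \<xi>) \<noteq> (u \<le> ?ay \<xi>)} \<in> sets borel" by measurable
      ultimately have "emeasure unif (Pair \<xi> -` ?Q) \<le> ennreal \<bar>?ax \<xi> - ?ay \<xi>\<bar>"
        using emeasure_unif_separates by simp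
      then show "emeasure unif (Pair \<xi> -` ?Q) \<le> ennreal (C * ?t * (1 + exp (\<eta> * (c2 * norm \<xi>))))"
        using diff[of \<xi>] by (auto intro: order_trans ennreal_leI)
    qed
    also have "\<dots> = ennreal (\<integral>\<xi>. C * ?t * (1 + exp (\<eta> * (c2 * norm \<xi>))) \<partial>\<gamma>)"
      using int C(1) by (intro nn_integral_eq_integral) auto
    also have "(\<integral>\<xi>. C * ?t * (1 + exp (\<eta> * (c2 * norm \<xi>))) \<partial>\<gamma>) = C * ?t * (1 + E)"
      using int prob_space by (simp add: E_def)
    finally have "ennreal (noise.P.prob ?D) \<le> ennreal (C * ?t * (1 + E))"
      by (simp only: noise.P.emeasure_eq_measure)
    then have "noise.P.prob ?D \<le> C * ?t * (1 + E)"
      by (subst (asm) ennreal_le_iff) (use C E in auto)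
    then show ?thesis by (simp add: ac_simps)
  qed
  then show ?thesis using C(1) E by (intro exI[of _ "C * (1 + E)"]) auto
qed

text \<open>The event \<open>B\<close> asks for noise in a fixed ball and a uniform variable below
  \<open>p\<close>, so that every state accepts its proposal there. The quantities \<open>s\<close>,
  \<open>p\<close>, \<open>K\<close> and \<open>B\<close> are fixed before \<open>\<eta>\<close>,
  hence the smallness conditions on \<open>\<eta>\<close> are not circular; the mismatch constant
  \<open>C\<close> comes last and may depend on \<open>\<eta>\<close>.\<close>

theorem pcn_invariant_random_map:
  "\<exists>\<eta>0>0. \<forall>\<eta>. 0 < \<eta> \<and> \<eta> < \<eta>0 \<longrightarrow>
    (\<exists>Z B K C. invariant_random_map \<Theta> (pcn_step \<Phi> \<delta>) Z B (1 - c1) K \<eta> C \<mu>)"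
proof -
  obtain a where a: "a > 0" "integrable \<gamma> (\<lambda>x. exp (a * norm x))" using gaussian_exp_moment by blast
  obtain s where s: "s > 0" "prob {x. norm x \<le> s} \<ge> 1 / 2" using gaussian_ball_prob[of "1 / 2"] by auto
  define K where "K = c2 * s"
  have K: "K \<ge> 0" using proposal_coefficients s by (simp add: K_def)
  obtain p where p: "p > 0" "\<And>x \<zeta>. norm \<zeta> \<le> K \<Longrightarrow> p \<le> acceptance \<Phi> x (c1 *\<^sub>R x + \<zeta>)"
    using uniform_acceptance[OF K] by blast
  have p1: "p \<le> 1" using order_trans[OF p(2)[of 0 0] acceptance_bounds(2)] K by simp
  define Z where "Z = (\<lambda>w :: 'a \<times> real. c2 * norm (fst w))"
  define B where "B = {x :: 'a. norm x \<le> s} \<times> {..p}"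
  define \<rho> where "\<rho> = 1 - c1"
  have rho: "0 < \<rho>" "\<rho> \<le> 1" using proposal_coefficients by (auto simp: \<rho>_def)
  have [measurable]: "{x :: 'a. norm x \<le> s} \<in> sets borel" by measurable
  have B_sets: "B \<in> sets \<Theta>" unfolding B_def by (intro pair_measureI) auto
  have "emeasure \<Theta> B = emeasure \<gamma> {x. norm x \<le> s} * emeasure unif {..p}"
    unfolding B_def by (rule unif.emeasure_pair_measure_Times) auto
  then have B_prob: "noise.P.prob B = prob {x. norm x \<le> s} * p"
    using p p1 emeasure_unif_atMost(1)[of p] by (simp add: measure_def enn2real_mult del: emeasure_uniform_measure)
  have "0 < prob {x. norm x \<le> s} * p" using s p by (intro mult_pos_pos) linarith+
  then have B_pos: "noise.P.prob B > 0" by (simp add: B_prob)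
  define a' where "a' = a / c2"
  have a': "a' > 0" "a' * (c2 * r) = a * r" for r using a proposal_coefficients by (auto simp: a'_def)
  define E where "E = (\<integral>x. exp (a * norm x) \<partial>\<gamma>)"
  have E: "E \<ge> 1"
  proof -
    have "(\<integral>x. 1 \<partial>\<gamma>) \<le> (\<integral>x. exp (a * norm x) \<partial>\<gamma>)"
      using a by (intro integral_mono) auto
    then show ?thesis using prob_space by (simp add: E_def)
  qed
  define q where "q = noise.P.prob B * \<rho> / 8"
  have q: "q > 0" using B_pos rho by (simp add: q_def)
  \<comment> \<open>The three bounds serve the exponential moment of the noise, its closeness to 1
    up to \<open>q\<close>, and the inequality \<open>(1 - \<rho>) * exp (\<eta> * K) \<le> (1 -
    \<rho>) * (1 + \<rho> / 2) \<le> 1 - \<rho> / 2\<close>. The summand 1 in \<open>K + 1\<close>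
    keeps the denominator positive.\<close>
  define \<eta>0 where "\<eta>0 = min a' (min (a' * q / E) (ln (1 + \<rho> / 2) / (K + 1)))"
  have "0 < ln (1 + \<rho> / 2)" using rho by (intro ln_gt_zero) simp
  then have "\<eta>0 > 0" using a' q E K by (simp add: \<eta>0_def)
  moreover have "\<exists>Z B K C. invariant_random_map \<Theta> (pcn_step \<Phi> \<delta>) Z B (1 - c1) K \<eta> C \<mu>"
    if \<eta>: "0 < \<eta>" "\<eta> < \<eta>0" for \<eta>
  proof -
    have \<eta>1: "\<eta> < a'" "\<eta> < a' * q / E" "\<eta> < ln (1 + \<rho> / 2) / (K + 1)" using \<eta> by (auto simp: \<eta>0_def)
    \<comment> \<open>Convexity of the exponential between 0 and \<open>a * r\<close> bounds the
      excess over 1 by a multiple of \<open>\<eta>\<close>, so the moment tends to 1 linearly as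
      \<open>\<eta>\<close> decreases.\<close>
    have ez: "exp (\<eta> * (c2 * r)) \<le> 1 + \<eta> / a' * exp (a * r)" if r: "r \<ge> 0" for r
    proof -
      have "exp ((1 - \<eta> / a') *\<^sub>R 0 + (\<eta> / a') *\<^sub>R (a * r)) \<le> (1 - \<eta> / a') * exp 0 + (\<eta> / a') * exp (a * r)"
        using \<eta> \<eta>1 a'(1) by (intro convex_onD[OF exp_convex]) auto
      moreover have "\<eta> / a' * (a * r) = \<eta> * (c2 * r)" 
        unfolding a'(2)[of r, symmetric] using a'(1) by simp
      moreover have "0 \<le> \<eta> / a'" using \<eta> a'(1) by simp
      ultimately show ?thesis by simp
    qed
    have ib: "integrable \<gamma> (\<lambda>x. 1 + \<eta> / a' * exp (a * norm x))" using a by auto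
    have iZ: "integrable \<gamma> (\<lambda>x. exp (\<eta> * (c2 * norm x)))"
      by (rule integrable_le[OF ib]) (use ez[OF norm_ge_zero] in auto)
    have EZ: "(\<integral>x. exp (\<eta> * (c2 * norm x)) \<partial>\<gamma>) \<le> 1 + q"
    proof -
      have "(\<integral>x. exp (\<eta> * (c2 * norm x)) \<partial>\<gamma>) \<le> (\<integral>x. 1 + \<eta> / a' * exp (a * norm x) \<partial>\<gamma>)"
        by (intro integral_mono iZ ib ez norm_ge_zero)
      also have "\<dots> = 1 + \<eta> / a' * E" using a prob_space by (simp add: E_def)
      also have "\<dots> \<le> 1 + q" using \<eta>1(2) a'(1) E by (simp add: field_simps)
      finally show ?thesis .
    qed
    have fst_law: "integrable \<Theta> (\<lambda>w. exp (\<eta> * Z w)) \<and> noise.P.expectation (\<lambda>w. exp (\<eta> * Z w)) = (\<integral>x. exp (\<eta> * (c2 * norm x)) \<partial>\<gamma>)"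
    proof -
      have i: "integrable \<Theta> (\<lambda>w. exp (\<eta> * (c2 * norm (fst w))))"
      proof (rule noise.Fubini_integrable)
        show "integrable \<gamma> (\<lambda>x. unif.expectation (\<lambda>y. norm (exp (\<eta> * (c2 * norm (fst (x, y)))))))"
          using iZ unif.prob_space by simp
      qed auto
      have "noise.P.expectation (\<lambda>w. exp (\<eta> * (c2 * norm (fst w)))) = (\<integral>x. exp (\<eta> * (c2 * norm x)) \<partial>\<gamma>)"
        using noise.integral_fst'[OF i] unif.prob_space by simp
      with i show ?thesis by (simp add: Z_def)
    qed
    obtain C where C: "C \<ge> 0" "\<And>x y. noise.P.prob {w \<in> space \<Theta>. norm (pcn_step \<Phi> \<delta> x w - pcn_step \<Phi> \<delta> y w) > norm (x - y)}
      \<le> C * (exp (\<eta> * max (norm x) (norm y)) * norm (x - y))"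
      using mismatch_bound[OF \<eta>(1) iZ] by blast
    have onB: "pcn_step \<Phi> \<delta> x w = pcn_proposal \<delta> x (fst w)" "norm (fst w) \<le> s" if w: "w \<in> B" for x w
    proof -
      obtain \<xi> u where wu: "w = (\<xi>, u)" by (cases w)
      have n: "norm \<xi> \<le> s" "u \<le> p" using w by (auto simp: wu B_def)
      then have "norm (c2 *\<^sub>R \<xi>) \<le> K" unfolding K_def using proposal_coefficients by (simp add: mult_left_mono)
      from p(2)[OF this, of x] n(2) have "u \<le> acceptance \<Phi> x (pcn_proposal \<delta> x \<xi>)"
        by (simp add: pcn_proposal_def)
      then show "pcn_step \<Phi> \<delta> x w = pcn_proposal \<delta> x (fst w)" "norm (fst w) \<le> s"
        using n by (simp_all add: wu pcn_step_def)
    qed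
    have "invariant_random_map \<Theta> (pcn_step \<Phi> \<delta>) Z B \<rho> K \<eta> C \<mu>"
    proof (intro invariant_random_map.intro contracting_random_map.intro
        contracting_random_map_axioms.intro invariant_random_map_axioms.intro)
      show "prob_space \<Theta>" by (rule noise.P.prob_space_axioms)
      show "case_prod (pcn_step \<Phi> \<delta>) \<in> borel \<Otimes>\<^sub>M \<Theta> \<rightarrow>\<^sub>M borel" by (rule step_measurable)
      show "Z \<in> borel_measurable \<Theta>" unfolding Z_def by measurable
      show "0 \<le> Z w" for w using proposal_coefficients by (simp add: Z_def)
      show "norm (pcn_step \<Phi> \<delta> x w) \<le> norm x + Z w" for x w
      proof (cases w)
        case (Pair \<xi> u)
        have "c1 * norm x \<le> norm x" using proposal_coefficients mult_right_mono[of c1 1 "norm x"] by simp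
        then have "norm (pcn_proposal \<delta> x \<xi>) \<le> norm x + c2 * norm \<xi>" using proposal_norm[of x \<xi>] by linarith
        moreover have "0 \<le> c2 * norm \<xi>" using proposal_coefficients by simp
        ultimately show ?thesis by (simp add: Pair pcn_step_def Z_def)
      qed
      show "norm (pcn_step \<Phi> \<delta> x w) \<le> (1 - \<rho>) * norm x + K" if "w \<in> B" for x w
      proof -
        have "c2 * norm (fst w) \<le> c2 * s" using onB(2)[OF that] proposal_coefficients by (intro mult_left_mono) auto
        then have "norm (pcn_proposal \<delta> x (fst w)) \<le> c1 * norm x + c2 * s"
          using proposal_norm[of x "fst w"] by linarith
        then show ?thesis unfolding onB(1)[OF that] K_def \<rho>_def by simp
      qed
      show "norm (pcn_step \<Phi> \<delta> x w - pcn_step \<Phi> \<delta> y w) \<le> (1 - \<rho>) * norm (x - y)" if "w \<in> B" for x y w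
        using onB(1)[OF that] by (simp add: \<rho>_def proposal_diff)
      show "integrable \<Theta> (\<lambda>w. exp (\<eta> * Z w))" using fst_law by simp
      show "noise.P.expectation (\<lambda>w. exp (\<eta> * Z w)) \<le> 1 + noise.P.prob B * \<rho> / 8"
        using fst_law EZ by (simp add: q_def)
      show "(1 - \<rho>) * exp (\<eta> * K) \<le> 1 - \<rho> / 2"
      proof -
        have "\<eta> * (K + 1) < ln (1 + \<rho> / 2)" using \<eta>1(3) K by (simp add: field_simps)
        then have "\<eta> * K \<le> ln (1 + \<rho> / 2)" using \<eta> by (simp add: distrib_left)
        then have "exp (\<eta> * K) \<le> exp (ln (1 + \<rho> / 2))" by simp
        also have "\<dots> = 1 + \<rho> / 2" using rho by simp
        finally have "(1 - \<rho>) * exp (\<eta> * K) \<le> (1 - \<rho>) * (1 + \<rho> / 2)" using rho by (intro mult_left_mono) auto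
        also have "\<dots> \<le> 1 - \<rho> / 2" using zero_le_square[of \<rho>] by (simp add: algebra_simps)
        finally show ?thesis .
      qed
      show "prob_space \<mu>" by (rule prob_space_mu)
    qed (rule B_sets B_pos rho K \<eta> C sets_mu mu_invariant)+
    then show ?thesis unfolding \<rho>_def by blast
  qed
  ultimately show ?thesis by blast
qed

end

text \<open>Each case supplies the same two facts: local Lipschitz constants of
  \<open>\<Phi>\<close> below every exponential rate, and acceptance bounded from below for noise in
  any fixed ball. The threshold for \<eta> is chosen independently of \<open>i\<close>, of the
  function and of the chain. Integrability is part of the conclusion because a Bochner integral that
  does not exist has the default value 0.\<close>

theorem theorem4p4:
  fixes \<gamma> :: "'a::{real_inner, banach, second_countable_topology} measure"
    and \<Phi> :: "'a \<Rightarrow> real" and r :: "real \<Rightarrow> real"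
    and \<delta> \<rho> R \<alpha>l :: real and i :: nat
  assumes gauss: "centred_gaussian \<gamma>"
    and delta: "0 < \<delta>" "\<delta> \<le> 1 / 2"
    and rho: "\<rho> = 1 - sqrt (1 - 2 * \<delta>)"
    and integrable_Phi: "integrable \<gamma> (\<lambda>x. exp (- \<Phi> x))"
    and R_pos: "R > 0"
    and r_pos: "\<And>s. s > 0 \<Longrightarrow> r s > 0"
    and r_le: "\<And>s. s \<ge> R \<Longrightarrow> r s \<le> \<rho> / 2 * s"
    and accept: "\<And>x. x \<notin> ball 0 R \<Longrightarrow>
      (INF z\<in>ball ((1 - \<rho>) *\<^sub>R x) (r (norm x)). exp (- \<Phi> z + \<Phi> x)) > exp \<alpha>l"
    and cases:
      "((\<exists>L. L-lipschitz_on UNIV \<Phi>) \<and>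
         ((\<exists>c>0. \<exists>a. 1 / 2 < a \<and> a < 1 \<and> (\<forall>s>0. r s = c * s powr a)) \<or>
          (\<exists>c>0. \<forall>s>0. r s = c)))
       \<or>
       ((\<forall>\<kappa>>0. \<exists>C. \<forall>s>0. \<forall>x\<in>ball 0 s. \<forall>y\<in>ball 0 s. x \<noteq> y \<longrightarrow>
            \<bar>\<Phi> x - \<Phi> y\<bar> / norm (x - y) \<le> C * exp (\<kappa> * s)) \<and>
         (\<exists>c>0. \<exists>a. 1 / 2 < a \<and> a < 1 \<and> (\<forall>s>0. r s = c * s powr a)))"
  shows "\<exists>\<eta>0>0. \<forall>\<eta>. 0 < \<eta> \<and> \<eta> < \<eta>0 \<longrightarrow>
    (\<exists>\<epsilon>0>0. \<forall>\<epsilon>. 0 < \<epsilon> \<and> \<epsilon> < \<epsilon>0 \<longrightarrow>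
      (\<forall>(f :: 'a \<Rightarrow> real) (\<Omega> :: 'w measure) (X :: nat \<Rightarrow> 'w \<Rightarrow> 'a) (x0 :: 'a).
        lipschitz_wrt (dist' i \<eta> \<epsilon>) f \<and> markov_chain \<Omega> (pcn_kernel \<gamma> \<Phi> \<delta>) x0 X \<longrightarrow>
        (let \<mu> = target_measure \<gamma> \<Phi>;
             S = (\<lambda>(n::nat) \<omega>. \<Sum>j=1..n. f (X j \<omega>) - (\<integral>x. f x \<partial>\<mu>))
         in integrable \<mu> f \<and> (\<forall>n. integrable \<Omega> (\<lambda>\<omega>. (S n \<omega>)\<^sup>2)) \<and>
            (\<exists>\<sigma>\<ge>0.
               (\<lambda>n. 1 / real n * (\<integral>\<omega>. (S n \<omega>)\<^sup>2 \<partial>\<Omega>)) \<longlonglongrightarrow> \<sigma>\<^sup>2 \<and>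
               (\<forall>\<xi>. (\<sigma> = 0 \<longrightarrow> \<xi> \<noteq> 0) \<longrightarrow>
                  (\<lambda>n. measure \<Omega> {\<omega> \<in> space \<Omega>. 1 / sqrt (real n) * S n \<omega> < \<xi>})
                    \<longlonglongrightarrow> cdf (centred_normal \<sigma>) \<xi>)))))"
proof -
  have lipschitz_cases: "(\<exists>L. L-lipschitz_on UNIV \<Phi>) \<or> (\<forall>\<kappa>>0. \<exists>C. \<forall>s>0. \<forall>x\<in>ball 0 s. \<forall>y\<in>ball 0 s. x \<noteq> y \<longrightarrow>
            \<bar>\<Phi> x - \<Phi> y\<bar> / norm (x - y) \<le> C * exp (\<kappa> * s))"
    using cases by blast
  have radius_cases: "(\<exists>L. L-lipschitz_on UNIV \<Phi>) \<or>
      (\<exists>c>0. \<exists>a. 1 / 2 < a \<and> a < 1 \<and> (\<forall>s>0. r s = c * s powr a))"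
    using cases by blast
  have Phi_local: "\<exists>C\<ge>0. \<forall>x y. \<bar>\<Phi> x - \<Phi> y\<bar> \<le> C * (exp (\<kappa> * max (norm x) (norm y)) * norm (x - y))"
    if \<kappa>: "\<kappa> > 0" for \<kappa>
    using lipschitz_cases
  proof (elim disjE)
    assume "\<exists>L. L-lipschitz_on UNIV \<Phi>"
    then obtain L where L: "L-lipschitz_on UNIV \<Phi>" by blast
    then have L0: "L \<ge> 0" by (rule lipschitz_on_nonneg)
    have "\<bar>\<Phi> x - \<Phi> y\<bar> \<le> L * (exp (\<kappa> * max (norm x) (norm y)) * norm (x - y))" for x y
    proof -
      have "\<bar>\<Phi> x - \<Phi> y\<bar> \<le> L * norm (x - y)" using lipschitz_onD[OF L, of x y] by (simp add: dist_norm)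
      also have "1 * norm (x - y) \<le> exp (\<kappa> * max (norm x) (norm y)) * norm (x - y)"
        using \<kappa> by (intro mult_right_mono) (auto simp: max_def)
      then have "L * norm (x - y) \<le> L * (exp (\<kappa> * max (norm x) (norm y)) * norm (x - y))"
        using L0 by (intro mult_left_mono) auto
      finally show ?thesis .
    qed
    with L0 show ?thesis by blast
  next
    assume "\<forall>\<kappa>>0. \<exists>C. \<forall>s>0. \<forall>x\<in>ball 0 s. \<forall>y\<in>ball 0 s. x \<noteq> y \<longrightarrow>
            \<bar>\<Phi> x - \<Phi> y\<bar> / norm (x - y) \<le> C * exp (\<kappa> * s)"
    then obtain C where C: "\<forall>s>0. \<forall>x\<in>ball 0 s. \<forall>y\<in>ball 0 s. x \<noteq> y \<longrightarrow>
            \<bar>\<Phi> x - \<Phi> y\<bar> / norm (x - y) \<le> C * exp (\<kappa> * s)" using \<kappa> by blast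
    have "\<bar>\<Phi> x - \<Phi> y\<bar> \<le> (\<bar>C\<bar> * exp \<kappa>) * (exp (\<kappa> * max (norm x) (norm y)) * norm (x - y))" for x y
    proof (cases "x = y")
      case False
      \<comment> \<open>The balls are open, so the radius must exceed both norms; the extra 1 costs
        the factor \<open>exp \<kappa>\<close>.\<close>
      define s where "s = max (norm x) (norm y) + 1"
      have "norm x < s" "norm y < s" by (auto simp: s_def)
      then have s: "s > 0" "x \<in> ball 0 s" "y \<in> ball 0 s" using le_less_trans[OF norm_ge_zero] by auto
      have "\<bar>\<Phi> x - \<Phi> y\<bar> / norm (x - y) \<le> C * exp (\<kappa> * s)" using C s False by blast
      then have "\<bar>\<Phi> x - \<Phi> y\<bar> \<le> C * exp (\<kappa> * s) * norm (x - y)" using False by (simp add: pos_divide_le_eq)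
      also have "\<dots> \<le> \<bar>C\<bar> * exp (\<kappa> * s) * norm (x - y)" by (intro mult_right_mono) auto
      also have "exp (\<kappa> * s) = exp \<kappa> * exp (\<kappa> * max (norm x) (norm y))" by (simp add: s_def distrib_left exp_add)
      finally show ?thesis by (simp add: mult.assoc)
    qed simp
    then show ?thesis by (intro exI[of _ "\<bar>C\<bar> * exp \<kappa>"]) auto
  qed
  have near: "\<Phi> z - \<Phi> x \<le> - \<alpha>l" if x: "norm x \<ge> R" and z: "norm (z - (1 - \<rho>) *\<^sub>R x) < r (norm x)" for x z
  proof -
    let ?B = "ball ((1 - \<rho>) *\<^sub>R x) (r (norm x))"
    have "z \<in> ?B" using z by (simp add: dist_norm norm_minus_commute)
    \<comment> \<open>A real infimum lies below the values only if these are bounded below; here 0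
      is a lower bound.\<close>
    then have "(INF z\<in>?B. exp (- \<Phi> z + \<Phi> x)) \<le> exp (- \<Phi> z + \<Phi> x)"
      by (intro cINF_lower bdd_belowI2[of _ 0]) auto
    moreover have "x \<notin> ball 0 R" using x by simp
    ultimately have "exp \<alpha>l < exp (- \<Phi> z + \<Phi> x)" using accept[of x] by linarith
    then show ?thesis by simp
  qed
  text \<open>For Lipschitz \<open>\<Phi>\<close> only the centre of the ball in the acceptance hypothesis matters; otherwise the radius
    of that ball eventually exceeds \<open>K\<close>.\<close>
  have far: "\<exists>R' D. R' > 0 \<and> (\<forall>x z. norm x \<ge> R' \<longrightarrow> norm (z - (1 - \<rho>) *\<^sub>R x) \<le> K \<longrightarrow> \<Phi> z - \<Phi> x \<le> D)"
    if K: "K \<ge> 0" for K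
    using radius_cases
  proof (elim disjE)
    assume "\<exists>L. L-lipschitz_on UNIV \<Phi>"
    then obtain L where L: "L-lipschitz_on UNIV \<Phi>" by blast
    then have L0: "L \<ge> 0" by (rule lipschitz_on_nonneg)
    have "\<Phi> z - \<Phi> x \<le> L * K - \<alpha>l" if x: "norm x \<ge> R" and z: "norm (z - (1 - \<rho>) *\<^sub>R x) \<le> K" for x z
    proof -
      have "\<bar>\<Phi> z - \<Phi> ((1 - \<rho>) *\<^sub>R x)\<bar> \<le> L * norm (z - (1 - \<rho>) *\<^sub>R x)"
        using lipschitz_onD[OF L, of z "(1 - \<rho>) *\<^sub>R x"] by (simp add: dist_norm)
      also have "\<dots> \<le> L * K" using z L0 by (rule mult_left_mono)
      finally have "\<Phi> z - \<Phi> ((1 - \<rho>) *\<^sub>R x) \<le> L * K" by linarith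
      moreover have "r (norm x) > 0" using x R_pos by (intro r_pos) linarith
      then have "\<Phi> ((1 - \<rho>) *\<^sub>R x) - \<Phi> x \<le> - \<alpha>l" using x by (intro near) auto
      ultimately show ?thesis by linarith
    qed
    then show ?thesis using R_pos by blast
  next
    assume "\<exists>c>0. \<exists>a. 1 / 2 < a \<and> a < 1 \<and> (\<forall>s>0. r s = c * s powr a)"
    then obtain c a where c: "c > 0" "1 / 2 < a" "\<And>s. s > 0 \<Longrightarrow> r s = c * s powr a" by blast
    \<comment> \<open>The solution of \<open>c * b powr a = K + 1\<close>: from norm
      \<open>b\<close> on, the radius in the acceptance hypothesis exceeds \<open>K\<close>
      strictly.\<close>
    define b where "b = ((K + 1) / c) powr (1 / a)"
    have b: "b > 0" "b powr a = (K + 1) / c" using c K by (auto simp: b_def powr_powr)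
    have "\<Phi> z - \<Phi> x \<le> - \<alpha>l" if x: "norm x \<ge> max R b" and z: "norm (z - (1 - \<rho>) *\<^sub>R x) \<le> K" for x z
    proof (rule near)
      have "K < c * b powr a" using b c K by simp
      also have "\<dots> \<le> c * norm x powr a" using b c x by (intro mult_left_mono powr_mono2) auto
      also have "\<dots> = r (norm x)" using x R_pos by (intro c(3)[symmetric]) linarith
      finally show "norm (z - (1 - \<rho>) *\<^sub>R x) < r (norm x)" using z by linarith
    qed (use x in simp)
    then show ?thesis using R_pos by (intro exI[of _ "max R b"] exI[of _ "- \<alpha>l"]) auto
  qed
  have rho1: "sqrt (1 - 2 * \<delta>) = 1 - \<rho>" using rho by simp
  have rho01: "0 \<le> 1 - \<rho>" "1 - \<rho> \<le> 1" using rho delta by auto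
  have uniform: "\<exists>p>0. \<forall>x \<zeta>. norm \<zeta> \<le> K \<longrightarrow> p \<le> acceptance \<Phi> x (sqrt (1 - 2 * \<delta>) *\<^sub>R x + \<zeta>)"
    if K: "K \<ge> 0" for K
  proof -
    obtain R' D where RD: "R' > 0" "\<And>x z. norm x \<ge> R' \<Longrightarrow> norm (z - (1 - \<rho>) *\<^sub>R x) \<le> K \<Longrightarrow> \<Phi> z - \<Phi> x \<le> D"
      using far[OF K] by blast
    obtain C where C: "C \<ge> 0" "\<And>x y. \<bar>\<Phi> x - \<Phi> y\<bar> \<le> C * (exp (1 * max (norm x) (norm y)) * norm (x - y))"
      using Phi_local[of 1] by auto
    \<comment> \<open>Outside the ball of radius \<open>R'\<close> the increase of
      \<open>\<Phi>\<close> is at most \<open>D\<close>. Inside it, state and proposal have norm at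
      most \<open>R' + K\<close> and distance at most \<open>2 * R' + K\<close>, so the local
      Lipschitz bound with rate 1 applies.\<close>
    define D' where "D' = max D (C * (exp (R' + K) * (2 * R' + K)))"
    have "exp (- max 0 D') \<le> acceptance \<Phi> x (sqrt (1 - 2 * \<delta>) *\<^sub>R x + \<zeta>)" if \<zeta>: "norm \<zeta> \<le> K" for x \<zeta>
    proof -
      define z where "z = (1 - \<rho>) *\<^sub>R x + \<zeta>"
      have "\<Phi> z - \<Phi> x \<le> D'"
      proof (cases "norm x \<ge> R'")
        case True
        have "\<Phi> z - \<Phi> x \<le> D" by (rule RD(2)[OF True]) (use \<zeta> in \<open>simp add: z_def\<close>)
        then show ?thesis by (simp add: D'_def)
      next
        case False
        have "norm z \<le> (1 - \<rho>) * norm x + K"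
          unfolding z_def using norm_triangle_ineq[of "(1 - \<rho>) *\<^sub>R x" \<zeta>] rho01 \<zeta> by simp
        also have "(1 - \<rho>) * norm x \<le> norm x" using rho01 by (intro mult_left_le_one_le) auto
        finally have nz: "norm z \<le> R' + K" using False by simp
        have nx: "norm x \<le> R' + K" using False K by simp
        have nzx: "norm (z - x) \<le> 2 * R' + K" using norm_triangle_ineq4[of z x] nz False by linarith
        have "\<bar>\<Phi> z - \<Phi> x\<bar> \<le> C * (exp (1 * max (norm z) (norm x)) * norm (z - x))" by (rule C(2))
        also have "\<dots> \<le> C * (exp (R' + K) * (2 * R' + K))"
          using nz nx nzx C(1) by (intro mult_left_mono mult_mono) auto
        finally show ?thesis by (simp add: D'_def)
      qed
      then have "- max 0 D' \<le> \<Phi> x - \<Phi> z" by simp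
      then have "exp (- max 0 D') \<le> exp (\<Phi> x - \<Phi> z)" by simp
      then show ?thesis unfolding rho1 acceptance_def z_def by simp
    qed
    then show ?thesis by (intro exI[of _ "exp (- max 0 D')"]) auto
  qed
  interpret pcn \<gamma> \<Phi> \<delta>
    by (intro pcn.intro gaussian.intro pcn_axioms.intro gauss delta integrable_Phi Phi_local uniform)
  obtain \<eta>0 where \<eta>0: "\<eta>0 > 0" "\<And>\<eta>. 0 < \<eta> \<and> \<eta> < \<eta>0 \<Longrightarrow>
      \<exists>Z B K C. invariant_random_map \<Theta> (pcn_step \<Phi> \<delta>) Z B (1 - sqrt (1 - 2 * \<delta>)) K \<eta> C (target_measure \<gamma> \<Phi>)"
    using pcn_invariant_random_map by blast
  show ?thesis
  proof (rule exI[of _ \<eta>0], intro conjI \<eta>0(1) allI impI, rule exI[of _ 1], intro conjI zero_less_one allI impI, elim conjE)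
    fix \<eta> \<epsilon> :: real and f :: "'a \<Rightarrow> real" and \<Omega> :: "'w measure" and X :: "nat \<Rightarrow> 'w \<Rightarrow> 'a" and x0 :: 'a
    assume \<eta>: "0 < \<eta>" "\<eta> < \<eta>0" and \<epsilon>: "0 < \<epsilon>" "\<epsilon> < 1"
      and f: "lipschitz_wrt (dist' i \<eta> \<epsilon>) f" and X: "markov_chain \<Omega> (pcn_kernel \<gamma> \<Phi> \<delta>) x0 X"
    obtain Z B K C where inv: "invariant_random_map \<Theta> (pcn_step \<Phi> \<delta>) Z B (1 - sqrt (1 - 2 * \<delta>)) K \<eta> C (target_measure \<gamma> \<Phi>)"
      using \<eta>0(2) \<eta> by blast
    interpret chain: random_map_chain \<Theta> "pcn_step \<Phi> \<delta>" Z B "1 - sqrt (1 - 2 * \<delta>)" K \<eta> C "target_measure \<gamma> \<Phi>" \<Omega> X x0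
      using X unfolding pcn_kernel_eq by (intro random_map_chain.intro inv random_map_chain_axioms.intro)
    obtain L where L: "chain.dlip (Suc i) L f" using chain.lipschitz_dist'_imp_dlip[OF \<epsilon>(1) f] by blast
    show "let \<mu> = target_measure \<gamma> \<Phi>;
             S = (\<lambda>(n::nat) \<omega>. \<Sum>j=1..n. f (X j \<omega>) - (\<integral>x. f x \<partial>\<mu>))
         in integrable \<mu> f \<and> (\<forall>n. integrable \<Omega> (\<lambda>\<omega>. (S n \<omega>)\<^sup>2)) \<and>
            (\<exists>\<sigma>\<ge>0.
               (\<lambda>n. 1 / real n * (\<integral>\<omega>. (S n \<omega>)\<^sup>2 \<partial>\<Omega>)) \<longlonglongrightarrow> \<sigma>\<^sup>2 \<and>
               (\<forall>\<xi>. (\<sigma> = 0 \<longrightarrow> \<xi> \<noteq> 0) \<longrightarrow>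
                  (\<lambda>n. measure \<Omega> {\<omega> \<in> space \<Omega>. 1 / sqrt (real n) * S n \<omega> < \<xi>})
                    \<longlonglongrightarrow> cdf (centred_normal \<sigma>) \<xi>))"
      unfolding Let_def by (rule chain.central_limit[OF _ L]) simp
  qed
qed

end
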